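(* Let $n\ge 2$ and $p>1$. There exists a constant $C_{p,n}$ depending only on $p$ and $n$ such that for any bounded domain $\Omega\subset\mathbb R^n$ with smooth boundary $\Sigma=\partial\Omega$ and every integer $k\ge 1$, $$ \mu_{k,p}(\Sigma)\le C_{p,n}\,I(\Omega)^{1+\frac{p}{n-1}}\left(\frac{k}{|\Sigma|}\right)^{\frac{p}{n-1}}, $$ where $\mu_{k,p}(\Sigma)$ denotes the $k$-th variational eigenvalue of the $p$-Laplacian on $\Sigma$ with the induced Riemannian metric and $I(\Omega):=\frac{|\Sigma|}{|\Omega|^{(n-1)/n}}$ is the isoperimetric ratio of $\Omega$.
   Context: A bounded domain is a bounded connected open set. $|\Omega|$ is the $n$-dimensional Lebesgue measure of $\Omega$ and $|\Sigma|$ the $(n-1)$-dimensional volume of $\Sigma$. Variational eigenvalues on the closed hypersurface $\Sigma$ (with induced metric, gradient $\nabla$ and volume element $dv$): $$\mu_{k,p}(\Sigma):=\inf_{F\in\Gamma_k}\sup_{u\in F}\frac{\int_\Sigma|\nabla u|^p\,dv}{\int_\Sigma|u|^p\,dv},\qquad k=1,2,\dots,$$ where $\Gamma_k$ is the family of sets $F\subset W^{1,p}(\Sigma)\setminus\{0\}$ such that $F\cap\{u:\|u\|_{L^p(\Sigma)}=1\}$ is compact, $F$ is symmetric ($F=-F$), and $\gamma(F)\ge k$. Here $\gamma(F)$ is the Krasnoselskii genus: the minimum $\ell\in\mathbb N$ for which there exists a continuous odd map $f:F\to\mathbb R^\ell\setminus\{0\}$ (and $+\infty$ if there is no such $\ell$).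 *)

theory Defs
  imports "HOL-Analysis.Analysis"
begin

section \<open>Hausdorff measure\<close>

text \<open>
  The \<open>m\<close>-dimensional volume is the \<open>m\<close>-dimensional Hausdorff measure, normalised by the volume of
  the unit ball of \<open>\<real>\<^sup>m\<close>.  On an embedded \<open>m\<close>-dimensional submanifold of a Euclidean space it is
  the Riemannian volume measure of the induced metric.
\<close>

definition hausdorff_gauge :: "nat \<Rightarrow> 'a::euclidean_space set \<Rightarrow> ennreal" where
  "hausdorff_gauge m A =
     (if A = {} then 0 else ennreal (unit_ball_vol (real m) * (diameter A / 2) ^ m))"

definition hausdorff_pre :: "nat \<Rightarrow> real \<Rightarrow> 'a::euclidean_space set \<Rightarrow> ennreal" where
  "hausdorff_pre m \<delta> A =
     (INF C\<in>{C :: nat \<Rightarrow> 'a set. A \<subseteq> (\<Union>i. C i) \<and> (\<forall>i. bounded (C i) \<and> diameter (C i) \<le> \<delta>)}.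
        \<Sum>i. hausdorff_gauge m (C i))"

definition hausdorff_outer :: "nat \<Rightarrow> 'a::euclidean_space set \<Rightarrow> ennreal" where
  "hausdorff_outer m A = (SUP \<delta>\<in>{0<..}. hausdorff_pre m \<delta> A)"

definition hausdorff_measure :: "nat \<Rightarrow> 'a::euclidean_space measure" where
  "hausdorff_measure m = measure_of UNIV (sets borel) (hausdorff_outer m)"

lemma space_hausdorff_measure [simp]: "space (hausdorff_measure m) = UNIV"
  by (simp add: hausdorff_measure_def)

lemma sets_hausdorff_measure [simp, measurable_cong]: "sets (hausdorff_measure m) = sets borel"
  by (simp add: hausdorff_measure_def sets_measure_of_conv)
     (metis sets.sigma_sets_eq space_borel)

text \<open>
  The function \<^const>\<open>measure_of\<close> returns the zero measure unless it is given a countably additive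
  function, so we check that \<^const>\<open>hausdorff_outer\<close> is countably additive on the Borel sets.
\<close>

lemma hausdorff_gauge_empty [simp]: "hausdorff_gauge m {} = 0"
  by (simp add: hausdorff_gauge_def)

lemma hausdorff_gauge_mono:
  assumes "A \<subseteq> B" "bounded B"
  shows "hausdorff_gauge m A \<le> hausdorff_gauge m B"
proof -
  have "diameter A \<le> diameter B" using assms by (rule diameter_subset)
  moreover have "0 \<le> diameter A" using assms bounded_subset diameter_ge_0 by blast
  ultimately show ?thesis using assms
    by (auto simp: hausdorff_gauge_def intro!: ennreal_leI mult_left_mono power_mono)
qed

lemma hausdorff_pre_lower:
  assumes "A \<subseteq> (\<Union>i. C i)" "\<And>i. bounded (C i)" "\<And>i. diameter (C i) \<le> \<delta>"
  shows "hausdorff_pre m \<delta> A \<le> (\<Sum>i. hausdorff_gauge m (C i))"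
  unfolding hausdorff_pre_def using assms by (intro INF_lower) auto

lemma hausdorff_pre_empty [simp]: "0 < \<delta> \<Longrightarrow> hausdorff_pre m \<delta> {} = 0"
  using hausdorff_pre_lower[of "{}" "\<lambda>_. {}" \<delta> m] by simp

lemma hausdorff_pre_mono: "A \<subseteq> B \<Longrightarrow> hausdorff_pre m \<delta> A \<le> hausdorff_pre m \<delta> B"
  unfolding hausdorff_pre_def by (rule INF_superset_mono) auto

lemma hausdorff_pre_antimono: "\<delta> \<le> \<epsilon> \<Longrightarrow> hausdorff_pre m \<epsilon> A \<le> hausdorff_pre m \<delta> A"
  unfolding hausdorff_pre_def by (rule INF_superset_mono) (auto intro: order_trans)

lemma hausdorff_pre_le_outer: "0 < \<delta> \<Longrightarrow> hausdorff_pre m \<delta> A \<le> hausdorff_outer m A"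
  unfolding hausdorff_outer_def by (rule SUP_upper) auto

lemma hausdorff_outer_mono: "A \<subseteq> B \<Longrightarrow> hausdorff_outer m A \<le> hausdorff_outer m B"
  unfolding hausdorff_outer_def by (rule SUP_mono) (auto intro: hausdorff_pre_mono)

lemma hausdorff_pre_UN_le:
  assumes "0 < \<delta>"
  shows "hausdorff_pre m \<delta> (\<Union>i. A i) \<le> (\<Sum>n. hausdorff_pre m \<delta> (A n))"
proof (rule ennreal_le_epsilon)
  fix e :: real assume "0 < e" "(\<Sum>n. hausdorff_pre m \<delta> (A n)) < top"
  then have *: "hausdorff_pre m \<delta> (A n) < hausdorff_pre m \<delta> (A n) + e * (1/2)^Suc n" for n
    by (auto simp add: less_top dest!: ennreal_suminf_lessD)
  have "\<exists>B. A n \<subseteq> (\<Union>i. B i) \<and> (\<forall>i. bounded (B i) \<and> diameter (B i) \<le> \<delta>) \<and>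
          (\<Sum>i. hausdorff_gauge m (B i)) \<le> hausdorff_pre m \<delta> (A n) + e * (1/2)^Suc n" for n
    using *[of n] unfolding hausdorff_pre_def INF_less_iff by (auto intro: less_imp_le)
  then obtain B where B: "\<And>n. A n \<subseteq> (\<Union>i. B n i)"
      "\<And>n i. bounded (B n i)" "\<And>n i. diameter (B n i) \<le> \<delta>"
      "\<And>n. (\<Sum>i. hausdorff_gauge m (B n i)) \<le> hausdorff_pre m \<delta> (A n) + e * (1/2)^Suc n"
    by metis
  define C where "C = case_prod B o prod_decode"
  have "(\<Union>i. A i) \<subseteq> (\<Union>i. C i)"
    using B(1) by (auto simp add: C_def subset_eq) (metis prod.case prod_encode_inverse)
  then have "hausdorff_pre m \<delta> (\<Union>i. A i) \<le> (\<Sum>i. hausdorff_gauge m (C i))"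
    using B by (intro hausdorff_pre_lower) (auto simp: C_def split_def)
  also have "\<dots> = (\<Sum>n. \<Sum>i. hausdorff_gauge m (B n i))"
    unfolding C_def comp_def
    using suminf_ennreal_2dimen[of "\<lambda>n. \<Sum>i. hausdorff_gauge m (B n i)"
        "\<lambda>x. hausdorff_gauge m (case_prod B x)"]
    by (simp add: comp_def)
  also have "\<dots> \<le> (\<Sum>n. hausdorff_pre m \<delta> (A n) + e * (1/2) ^ Suc n)"
    by (intro suminf_le allI B) auto
  also have "\<dots> = (\<Sum>n. hausdorff_pre m \<delta> (A n)) + (\<Sum>n. ennreal e * ennreal ((1/2) ^ Suc n))"
    using \<open>0 < e\<close> by (subst suminf_add[symmetric])
                     (auto simp del: ennreal_suminf_cmult simp add: ennreal_mult[symmetric])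
  also have "\<dots> = (\<Sum>n. hausdorff_pre m \<delta> (A n)) + e"
    unfolding ennreal_suminf_cmult
    by (subst suminf_ennreal_eq[OF zero_le_power power_half_series]) auto
  finally show "hausdorff_pre m \<delta> (\<Union>i. A i) \<le> (\<Sum>n. hausdorff_pre m \<delta> (A n)) + e" .
qed

lemma hausdorff_outer_UN_le:
  fixes A :: "nat \<Rightarrow> 'a::euclidean_space set"
  shows "hausdorff_outer m (\<Union>i. A i) \<le> (\<Sum>i. hausdorff_outer m (A i))"
proof -
  have "hausdorff_pre m \<delta> (\<Union>i. A i) \<le> (\<Sum>i. hausdorff_outer m (A i))" if \<delta>: "0 < \<delta>" for \<delta>
    by (rule order_trans[OF hausdorff_pre_UN_le[OF \<delta>]])
       (intro suminf_le allI hausdorff_pre_le_outer \<delta>, auto)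
  then show ?thesis
    unfolding hausdorff_outer_def[of m "\<Union>i. A i"] by (intro SUP_least) auto
qed

lemma hausdorff_outer_empty [simp]: "hausdorff_outer m {} = 0"
  by (simp add: hausdorff_outer_def cong: SUP_cong_simp)

lemma outer_measure_space_hausdorff: "outer_measure_space UNIV (hausdorff_outer m)"
  by (simp add: outer_measure_space_def positive_def increasing_def countably_subadditive_def
      hausdorff_outer_mono hausdorff_outer_UN_le)

lemma hausdorff_outer_Un_le:
  fixes A B :: "'a::euclidean_space set"
  shows "hausdorff_outer m (A \<union> B) \<le> hausdorff_outer m A + hausdorff_outer m B"
proof -
  have "subadditive UNIV (hausdorff_outer m :: 'a set \<Rightarrow> ennreal)"
    by (intro ring_of_sets.countably_subadditive_subadditive[of UNIV])
       (use outer_measure_space_hausdorff[where 'a='a, of m] ring_of_sets_Pow[of "UNIV :: 'a set"]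
        in \<open>auto simp: outer_measure_space_def\<close>)
  moreover have "hausdorff_outer m (A \<union> B) = hausdorff_outer m (A \<union> (B - A))" by simp
  ultimately have "hausdorff_outer m (A \<union> B) \<le> hausdorff_outer m A + hausdorff_outer m (B - A)"
    by (metis UNIV_I Diff_disjoint subadditiveD)
  also have "\<dots> \<le> hausdorff_outer m A + hausdorff_outer m B"
    by (intro add_left_mono hausdorff_outer_mono) auto
  finally show ?thesis .
qed

lemma hausdorff_outer_separated:
  assumes d: "0 < d" and AB: "\<And>x y. x \<in> A \<Longrightarrow> y \<in> B \<Longrightarrow> d \<le> dist x y"
  shows "hausdorff_outer m A + hausdorff_outer m B \<le> hausdorff_outer m (A \<union> B)"
proof -
  have pre: "hausdorff_pre m \<delta> A + hausdorff_pre m \<delta> B \<le> hausdorff_outer m (A \<union> B)"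
    if \<delta>: "0 < \<delta>" "\<delta> < d" for \<delta>
  proof (rule order_trans[OF _ hausdorff_pre_le_outer[OF \<delta>(1)]])
    show "hausdorff_pre m \<delta> A + hausdorff_pre m \<delta> B \<le> hausdorff_pre m \<delta> (A \<union> B)"
      unfolding hausdorff_pre_def[of m \<delta> "A \<union> B"]
    proof (rule INF_greatest)
      fix C :: "nat \<Rightarrow> 'a set"
      assume "C \<in> {C. A \<union> B \<subseteq> (\<Union>i. C i) \<and> (\<forall>i. bounded (C i) \<and> diameter (C i) \<le> \<delta>)}"
      then have C: "A \<union> B \<subseteq> (\<Union>i. C i)" "\<And>i. bounded (C i)" "\<And>i. diameter (C i) \<le> \<delta>"
        by auto
      have bd: "bounded (C i \<inter> S)" for i S
        using C(2) bounded_subset by blast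
      have di: "diameter (C i \<inter> S) \<le> \<delta>" for i S
        using diameter_subset[OF _ C(2), of "C i \<inter> S" i] C(3)[of i] by auto
      have "hausdorff_pre m \<delta> A + hausdorff_pre m \<delta> B
          \<le> (\<Sum>i. hausdorff_gauge m (C i \<inter> A)) + (\<Sum>i. hausdorff_gauge m (C i \<inter> B))"
        by (intro add_mono hausdorff_pre_lower bd di) (use C in auto)
      also have "\<dots> = (\<Sum>i. hausdorff_gauge m (C i \<inter> A) + hausdorff_gauge m (C i \<inter> B))"
        by (rule suminf_add) auto
      also have "\<dots> \<le> (\<Sum>i. hausdorff_gauge m (C i))"
      proof (intro suminf_le allI)
        fix i
        have "C i \<inter> A = {} \<or> C i \<inter> B = {}"
        proof (rule ccontr)
          assume "\<not> ?thesis"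
          then obtain x y where xy: "x \<in> C i" "x \<in> A" "y \<in> C i" "y \<in> B" by blast
          then have "d \<le> dist x y" using AB by blast
          also have "\<dots> \<le> diameter (C i)" using C xy by (intro diameter_bounded_bound) auto
          finally show False using C(3)[of i] \<delta> by simp
        qed
        then show "hausdorff_gauge m (C i \<inter> A) + hausdorff_gauge m (C i \<inter> B)
            \<le> hausdorff_gauge m (C i)"
          using hausdorff_gauge_mono[OF Int_lower1 C(2)] by auto
      qed auto
      finally show "hausdorff_pre m \<delta> A + hausdorff_pre m \<delta> B \<le> (\<Sum>i. hausdorff_gauge m (C i))" .
    qed
  qed
  have "hausdorff_outer m A + hausdorff_outer m B =
      (SUP \<delta>\<in>{0<..}. SUP \<epsilon>\<in>{0<..}. hausdorff_pre m \<delta> A + hausdorff_pre m \<epsilon> B)"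
    unfolding hausdorff_outer_def
    by (subst ennreal_SUP_add_left[symmetric], simp, subst ennreal_SUP_add_right) auto
  also have "\<dots> \<le> hausdorff_outer m (A \<union> B)"
  proof (intro SUP_least)
    fix \<delta> \<epsilon> :: real assume "\<delta> \<in> {0<..}" "\<epsilon> \<in> {0<..}"
    define r where "r = min (min \<delta> \<epsilon>) (d/2)"
    have r: "0 < r" "r < d" "r \<le> \<delta>" "r \<le> \<epsilon>"
      using \<open>\<delta> \<in> _\<close> \<open>\<epsilon> \<in> _\<close> d by (auto simp: r_def)
    have "hausdorff_pre m \<delta> A + hausdorff_pre m \<epsilon> B \<le> hausdorff_pre m r A + hausdorff_pre m r B"
      by (intro add_mono hausdorff_pre_antimono r)
    also have "\<dots> \<le> hausdorff_outer m (A \<union> B)" by (rule pre[OF r(1,2)])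
    finally show "hausdorff_pre m \<delta> A + hausdorff_pre m \<epsilon> B \<le> hausdorff_outer m (A \<union> B)" .
  qed
  finally show ?thesis .
qed

lemma hausdorff_outer_closed:
  fixes X C :: "'a::euclidean_space set"
  assumes C: "closed C"
  shows "hausdorff_outer m (X \<inter> C) + hausdorff_outer m (X - C) \<le> hausdorff_outer m X"
proof (cases "C = {} \<or> hausdorff_outer m X = \<infinity>")
  case True
  then show ?thesis by auto
next
  case False
  then have ne: "C \<noteq> {}" and fin: "hausdorff_outer m X \<noteq> \<infinity>" by auto
  let ?h = "hausdorff_outer m :: 'a set \<Rightarrow> ennreal"
  let ?f = "\<lambda>x. infdist x C"
  define A where "A = (\<lambda>n::nat. {x\<in>X. 1 / real (Suc n) \<le> ?f x})"
  define R where "R = (\<lambda>n::nat. {x\<in>X. 1 / real (Suc (Suc n)) \<le> ?f x \<and> ?f x < 1 / real (Suc n)})"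
  have lip: "?f x - ?f y \<le> dist x y" for x y
    using infdist_triangle[of x C y] by simp
  have zero: "x \<in> C \<longleftrightarrow> ?f x = 0" for x
    using in_closed_iff_infdist_zero[OF C ne] by simp
  have cover: "X - C \<subseteq> A n \<union> (\<Union>k. R (n + k))" for n
  proof
    fix x assume x: "x \<in> X - C"
    then have pos: "0 < ?f x" using zero[of x] infdist_nonneg[of x C] by auto
    show "x \<in> A n \<union> (\<Union>k. R (n + k))"
    proof (cases "x \<in> A n")
      case False
      have ex: "\<exists>j. 1 / real (Suc j) \<le> ?f x"
        using reals_Archimedean[OF pos] by (auto simp: inverse_eq_divide intro: less_imp_le)
      define j where "j = (LEAST j. 1 / real (Suc j) \<le> ?f x)"
      have j: "1 / real (Suc j) \<le> ?f x" unfolding j_def using ex by (rule LeastI_ex)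
      have "n < j"
      proof (rule ccontr)
        assume "\<not> n < j"
        then have "1 / real (Suc n) \<le> 1 / real (Suc j)" by (simp add: frac_le)
        then show False using j False x by (auto simp: A_def)
      qed
      then obtain i where i: "j = Suc i" "n \<le> i" by (cases j) auto
      have "\<not> 1 / real (Suc i) \<le> ?f x"
        using not_less_Least[of i "\<lambda>j. 1 / real (Suc j) \<le> ?f x"] i by (simp add: j_def)
      then have "x \<in> R i" using x j i by (auto simp: R_def)
      then show ?thesis using i(2) by (metis UN_I UNIV_I UnI2 le_Suc_ex)
    qed simp
  qed
  have sep: "?h (\<Union>k<N. R (2*k+a)) \<ge> (\<Sum>k<N. ?h (R (2*k+a)))" for N a
  proof (induction N)
    case (Suc N)
    have s: "?h (\<Union>k<N. R (2*k+a)) + ?h (R (2*N+a)) \<le> ?h ((\<Union>k<N. R (2*k+a)) \<union> R (2*N+a))"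
      if N: "N > 0"
    proof (rule hausdorff_outer_separated)
      show "0 < 1 / real (2*N+a) - 1 / real (Suc (2*N+a))" using N by (simp add: frac_less2)
      fix x y assume x: "x \<in> (\<Union>k<N. R (2*k+a))" and y: "y \<in> R (2*N+a)"
      from x obtain k where k: "k < N" "x \<in> R (2*k+a)" by auto
      have "1 / real (2*N+a) \<le> 1 / real (Suc (Suc (2*k+a)))"
        using k(1) by (intro divide_left_mono) auto
      then have "1 / real (2*N+a) \<le> ?f x" using k(2) by (auto simp: R_def)
      moreover have "?f y < 1 / real (Suc (2*N+a))" using y by (auto simp: R_def)
      ultimately show "1 / real (2*N+a) - 1 / real (Suc (2*N+a)) \<le> dist x y"
        using lip[of x y] by linarith
    qed
    have "(\<Sum>k<Suc N. ?h (R (2*k+a))) \<le> ?h (\<Union>k<N. R (2*k+a)) + ?h (R (2*N+a))"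
      using Suc.IH by (simp add: add_right_mono)
    also have "\<dots> \<le> ?h ((\<Union>k<N. R (2*k+a)) \<union> R (2*N+a))"
      using s by (cases "N > 0") auto
    finally show ?case by (simp add: lessThan_Suc Un_commute)
  qed simp
  have "(\<Sum>k. ?h (R (2*k+a))) \<le> ?h X" for a
  proof (rule suminf_le_const)
    show "(\<Sum>k<N. ?h (R (2*k+a))) \<le> ?h X" for N
      by (rule order_trans[OF sep hausdorff_outer_mono]) (auto simp: R_def)
  qed simp
  note half = this
  have "(\<Sum>k. ?h (R k)) \<le> ?h X + ?h X"
  proof (rule suminf_le_const)
    fix N
    have "(\<Sum>k<N. ?h (R k)) \<le> (\<Sum>k<2*N. ?h (R k))"
      by (intro sum_mono2) auto
    also have "\<dots> = (\<Sum>k<N. ?h (R (2*k))) + (\<Sum>k<N. ?h (R (2*k+1)))"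
      by (induction N) (auto simp: algebra_simps)
    also have "\<dots> \<le> (\<Sum>k. ?h (R (2*k))) + (\<Sum>k. ?h (R (2*k+1)))"
      by (intro add_mono sum_le_suminf) auto
    also have "\<dots> \<le> ?h X + ?h X" using half[of 0] half[of 1] by (intro add_mono) auto
    finally show "(\<Sum>k<N. ?h (R k)) \<le> ?h X + ?h X" .
  qed simp
  then have sumfin: "(\<Sum>k. ?h (R k)) \<noteq> \<infinity>"
    using fin by (metis ennreal_add_eq_top infinity_ennreal_def neq_top_trans)
  have tail: "(\<lambda>n. \<Sum>k. ?h (R (n + k))) \<longlonglongrightarrow> 0"
  proof -
    let ?S = "\<Sum>k. ?h (R k)"
    have "(\<Sum>k. ?h (R (n + k))) = ?S - (\<Sum>k<n. ?h (R k))" for n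
    proof -
      have "(\<Sum>k<n. ?h (R k)) \<le> ?S" by (rule sum_le_suminf) auto
      then have "(\<Sum>k<n. ?h (R k)) \<noteq> top" using sumfin by (metis infinity_ennreal_def neq_top_trans)
      then show ?thesis
        using suminf_offset[of "\<lambda>k. ?h (R k)" n] by (simp add: add.commute)
    qed
    moreover have "(\<lambda>n. ?S - (\<Sum>k<n. ?h (R k))) \<longlonglongrightarrow> ?S - ?S"
      using sumfin by (intro tendsto_diff_ennreal tendsto_const summable_LIMSEQ) auto
    ultimately show ?thesis using sumfin by simp
  qed
  have le: "?h (X \<inter> C) + ?h (X - C) \<le> ?h X + (\<Sum>k. ?h (R (n + k)))" for n
  proof -
    have "?h (X - C) \<le> ?h (A n \<union> (\<Union>k. R (n + k)))" by (rule hausdorff_outer_mono[OF cover])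
    also have "\<dots> \<le> ?h (A n) + (\<Sum>k. ?h (R (n + k)))"
      by (rule order_trans[OF hausdorff_outer_Un_le add_left_mono[OF hausdorff_outer_UN_le]])
    finally have "?h (X \<inter> C) + ?h (X - C) \<le> (?h (X \<inter> C) + ?h (A n)) + (\<Sum>k. ?h (R (n + k)))"
      by (simp add: add.assoc add_left_mono)
    also have "?h (X \<inter> C) + ?h (A n) \<le> ?h (X \<inter> C \<union> A n)"
    proof (rule hausdorff_outer_separated)
      show "0 < 1 / real (Suc n)" by simp
      fix x y assume "x \<in> X \<inter> C" "y \<in> A n"
      then show "1 / real (Suc n) \<le> dist x y"
        using lip[of y x] zero[of x] by (auto simp: A_def dist_commute)
    qed
    also have "\<dots> \<le> ?h X" by (rule hausdorff_outer_mono) (auto simp: A_def)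
    finally show ?thesis by (simp add: add_right_mono)
  qed
  have "(\<lambda>n. ?h X + (\<Sum>k. ?h (R (n + k)))) \<longlonglongrightarrow> ?h X + 0"
    by (intro tendsto_add tendsto_const tail)
  then show ?thesis
    using le by (intro LIMSEQ_le_const[where X="\<lambda>n. ?h X + (\<Sum>k. ?h (R (n + k)))"]) auto
qed

theorem emeasure_hausdorff_measure:
  fixes A :: "'a::euclidean_space set"
  assumes "A \<in> sets borel"
  shows "emeasure (hausdorff_measure m) A = hausdorff_outer m A"
proof -
  let ?h = "hausdorff_outer m :: 'a set \<Rightarrow> ennreal"
  let ?L = "lambda_system UNIV UNIV ?h"
  interpret P: sigma_algebra UNIV "UNIV :: 'a set set"
    using sigma_algebra_Pow[of "UNIV :: 'a set"] by simp
  have ms: "measure_space UNIV ?L ?h"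
    using P.caratheodory_lemma[OF outer_measure_space_hausdorff] .
  then have sig: "sigma_algebra UNIV ?L" by (simp add: measure_space_def)
  have "Collect closed \<subseteq> ?L"
    unfolding P.lambda_system_eq
  proof safe
    fix C X :: "'a set" assume "closed C"
    have "?h X = ?h ((X \<inter> C) \<union> (X - C))" by (simp add: Int_Diff_Un)
    then have "?h X \<le> ?h (X \<inter> C) + ?h (X - C)"
      using hausdorff_outer_Un_le[of m "X \<inter> C" "X - C"] by simp
    then show "?h (X \<inter> C) + ?h (X - C) = ?h X"
      using hausdorff_outer_closed[OF \<open>closed C\<close>, of m X] by (rule antisym[rotated])
  qed auto
  then have "sigma_sets UNIV (Collect closed) \<subseteq> ?L"
    using sig by (rule sigma_algebra.sigma_sets_subset[rotated])
  moreover have "sets (borel :: 'a measure) = sigma_sets UNIV (Collect closed)"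
    unfolding borel_eq_closed by simp
  ultimately have "sets borel \<subseteq> ?L" by simp
  then have "measure_space UNIV (sets borel) ?h"
    using measure_down[OF ms] sets.sigma_algebra_axioms[of "borel :: 'a measure"] by simp
  then show ?thesis
    unfolding hausdorff_measure_def using assms
    by (intro emeasure_measure_of_sigma)
       (auto simp: measure_space_def)
qed


section \<open>Smooth functions, domains with smooth boundary\<close>

primrec Ck_on :: "nat \<Rightarrow> ('a::real_normed_vector \<Rightarrow> 'b::real_normed_vector) \<Rightarrow> 'a set \<Rightarrow> bool" where
  "Ck_on 0 f U \<longleftrightarrow> continuous_on U f"
| "Ck_on (Suc k) f U \<longleftrightarrow>
     (\<forall>x\<in>U. f differentiable (at x)) \<and> (\<forall>v. Ck_on k (\<lambda>x. frechet_derivative f (at x) v) U)"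

text \<open>To be used for open sets \<open>U\<close> of a Euclidean space only.\<close>

definition smooth_on :: "'a set \<Rightarrow> ('a::real_normed_vector \<Rightarrow> 'b::real_normed_vector) \<Rightarrow> bool" where
  "smooth_on U f \<longleftrightarrow> (\<forall>k. Ck_on k f U)"

definition bounded_domain :: "'a::euclidean_space set \<Rightarrow> bool" where
  "bounded_domain \<Omega> \<longleftrightarrow> \<Omega> \<noteq> {} \<and> open \<Omega> \<and> connected \<Omega> \<and> bounded \<Omega>"

text \<open>
  Near each boundary point, after a rotation of the coordinates, \<open>\<Omega>\<close> is the region above the graph
  of a smooth function; \<open>e\<close> is the direction of the last coordinate axis and \<open>g\<close> is a function of
  the remaining coordinates.
\<close>

definition smooth_boundary :: "'a::euclidean_space set \<Rightarrow> bool" where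
  "smooth_boundary \<Omega> \<longleftrightarrow>
     (\<forall>x\<in>frontier \<Omega>. \<exists>r>0. \<exists>e g. norm e = 1 \<and> smooth_on UNIV g \<and>
        (\<forall>y t. g (y + t *\<^sub>R e) = g y) \<and>
        \<Omega> \<inter> ball x r = {y \<in> ball x r. (g y :: real) < y \<bullet> e})"


section \<open>Calculus on a hypersurface\<close>

definition surface_measure :: "'a::euclidean_space set \<Rightarrow> 'a measure" where
  "surface_measure S = restrict_space (hausdorff_measure (DIM('a) - 1)) S"

definition area :: "'a::euclidean_space set \<Rightarrow> real" where
  "area S = measure (surface_measure S) S"

definition smooth_curve_at :: "'a::euclidean_space set \<Rightarrow> 'a \<Rightarrow> (real \<Rightarrow> 'a) \<Rightarrow> 'a \<Rightarrow> bool" where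
  "smooth_curve_at S x c v \<longleftrightarrow>
     (\<exists>e>0. smooth_on {-e<..<e} c \<and> c ` {-e<..<e} \<subseteq> S) \<and>
     c 0 = x \<and> (c has_vector_derivative v) (at 0)"

definition tangent_space :: "'a::euclidean_space set \<Rightarrow> 'a \<Rightarrow> 'a set" where
  "tangent_space S x = {v. \<exists>c. smooth_curve_at S x c v}"

text \<open>Smooth functions on \<open>S\<close>; only the values on \<open>S\<close> of the function \<open>f\<close> matter.\<close>

definition smooth_fun :: "'a::euclidean_space set \<Rightarrow> ('a \<Rightarrow> real) \<Rightarrow> bool" where
  "smooth_fun S f \<longleftrightarrow>
     (\<forall>x\<in>S. \<exists>U g. open U \<and> x \<in> U \<and> smooth_on U g \<and> (\<forall>y\<in>S \<inter> U. f y = g y))"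

text \<open>
  The gradient for the induced metric: the tangent vector that represents the differential of
  \<open>f\<close>, the latter being the derivative of \<open>f\<close> along curves in \<open>S\<close>.
\<close>

definition surface_grad :: "'a::euclidean_space set \<Rightarrow> ('a \<Rightarrow> real) \<Rightarrow> 'a \<Rightarrow> 'a" where
  "surface_grad S f x =
     (THE w. w \<in> tangent_space S x \<and>
        (\<forall>c v. smooth_curve_at S x c v \<longrightarrow> ((\<lambda>t. f (c t)) has_real_derivative w \<bullet> v) (at 0)))"


section \<open>The Sobolev space on a hypersurface\<close>

definition in_Lp :: "real \<Rightarrow> 'a measure \<Rightarrow> ('a \<Rightarrow> 'b::euclidean_space) \<Rightarrow> bool" where
  "in_Lp p M f \<longleftrightarrow> f \<in> borel_measurable M \<and> integrable M (\<lambda>x. norm (f x) powr p)"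

definition Lp_norm :: "real \<Rightarrow> 'a measure \<Rightarrow> ('a \<Rightarrow> 'b::euclidean_space) \<Rightarrow> real" where
  "Lp_norm p M f = (LINT x|M. norm (f x) powr p) powr (1 / p)"

text \<open>
  \<open>W\<^sup>1\<^sup>,\<^sup>p(S)\<close> is the completion of the smooth functions with finite Sobolev norm
  \<open>(\<parallel>u\<parallel>\<^sub>p\<^sup>p + \<parallel>\<nabla>u\<parallel>\<^sub>p\<^sup>p)\<^sup>1\<^sup>/\<^sup>p\<close>, that is, the closure of \<open>{(\<phi>, \<nabla>\<phi>) | \<phi> smooth}\<close> in \<open>L\<^sup>p \<times> L\<^sup>p\<close>.  An element
  is a function together with its weak gradient.  On a smooth hypersurface the latter is determined
  by the function almost everywhere, so that the first component identifies the element.  As usual,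
  elements are represented by functions, and two representatives are equivalent if their Sobolev
  distance is 0.
\<close>

type_synonym 'a sobolev = "('a \<Rightarrow> real) \<times> ('a \<Rightarrow> 'a)"

definition sobolev_space :: "real \<Rightarrow> 'a::euclidean_space set \<Rightarrow> 'a sobolev set" where
  "sobolev_space p S =
     {(u, G). in_Lp p (surface_measure S) u \<and> in_Lp p (surface_measure S) G \<and>
        (\<exists>\<phi> :: nat \<Rightarrow> 'a \<Rightarrow> real.
           (\<forall>j. smooth_fun S (\<phi> j) \<and> in_Lp p (surface_measure S) (\<phi> j) \<and>
                in_Lp p (surface_measure S) (surface_grad S (\<phi> j))) \<and>
           (\<lambda>j. Lp_norm p (surface_measure S) (\<lambda>x. \<phi> j x - u x)) \<longlonglongrightarrow> 0 \<and>
           (\<lambda>j. Lp_norm p (surface_measure S) (\<lambda>x. surface_grad S (\<phi> j) x - G x)) \<longlonglongrightarrow> 0)}"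

definition sobolev_norm :: "real \<Rightarrow> 'a::euclidean_space set \<Rightarrow> 'a sobolev \<Rightarrow> real" where
  "sobolev_norm p S w =
     ((LINT x|surface_measure S. \<bar>fst w x\<bar> powr p) +
      (LINT x|surface_measure S. norm (snd w x) powr p)) powr (1 / p)"

definition sobolev_topology :: "real \<Rightarrow> 'a::euclidean_space set \<Rightarrow> 'a sobolev topology" where
  "sobolev_topology p S =
     topology (\<lambda>U. U \<subseteq> sobolev_space p S \<and>
       (\<forall>w\<in>U. \<exists>\<epsilon>>0. \<forall>z\<in>sobolev_space p S. sobolev_norm p S (z - w) < \<epsilon> \<longrightarrow> z \<in> U))"

lemma openin_sobolev_topology:
  "openin (sobolev_topology p S) U \<longleftrightarrow> U \<subseteq> sobolev_space p S \<and>
     (\<forall>w\<in>U. \<exists>\<epsilon>>0. \<forall>z\<in>sobolev_space p S. sobolev_norm p S (z - w) < \<epsilon> \<longrightarrow> z \<in> U)"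
proof -
  let ?P = "\<lambda>U. U \<subseteq> sobolev_space p S \<and>
     (\<forall>w\<in>U. \<exists>\<epsilon>>0. \<forall>z\<in>sobolev_space p S. sobolev_norm p S (z - w) < \<epsilon> \<longrightarrow> z \<in> U)"
  have "istopology ?P"
    unfolding istopology_def
  proof (intro conjI allI impI)
    fix U V assume U: "?P U" and V: "?P V"
    show "U \<inter> V \<subseteq> sobolev_space p S" using U by blast
    show "\<forall>w\<in>U \<inter> V. \<exists>\<epsilon>>0. \<forall>z\<in>sobolev_space p S. sobolev_norm p S (z - w) < \<epsilon> \<longrightarrow> z \<in> U \<inter> V"
    proof
      fix w assume "w \<in> U \<inter> V"
      then obtain \<epsilon> \<delta> where
        "\<epsilon> > 0" "\<forall>z\<in>sobolev_space p S. sobolev_norm p S (z - w) < \<epsilon> \<longrightarrow> z \<in> U"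
        "\<delta> > 0" "\<forall>z\<in>sobolev_space p S. sobolev_norm p S (z - w) < \<delta> \<longrightarrow> z \<in> V"
        using U V by (metis IntE)
      then show "\<exists>\<epsilon>>0. \<forall>z\<in>sobolev_space p S. sobolev_norm p S (z - w) < \<epsilon> \<longrightarrow> z \<in> U \<inter> V"
        by (intro exI[of _ "min \<epsilon> \<delta>"]) auto
    qed
  next
    fix K assume K: "\<forall>U\<in>K. ?P U"
    show "\<Union>K \<subseteq> sobolev_space p S" using K by blast
    show "\<forall>w\<in>\<Union>K. \<exists>\<epsilon>>0. \<forall>z\<in>sobolev_space p S. sobolev_norm p S (z - w) < \<epsilon> \<longrightarrow> z \<in> \<Union>K"
      using K by (metis Union_iff)
  qed
  then show ?thesis by (simp add: sobolev_topology_def topology_inverse')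
qed

lemma topspace_sobolev_topology [simp]: "topspace (sobolev_topology p S) = sobolev_space p S"
proof (rule antisym)
  show "topspace (sobolev_topology p S) \<subseteq> sobolev_space p S"
    using openin_topspace[of "sobolev_topology p S"] by (simp only: openin_sobolev_topology)
  show "sobolev_space p S \<subseteq> topspace (sobolev_topology p S)"
    by (rule openin_subset) (auto simp: openin_sobolev_topology intro: exI[of _ 1])
qed


section \<open>Variational eigenvalues\<close>

text \<open>
  \<open>\<nat>\<close> contains 0 here: \<open>\<real>\<^sup>0 - {0}\<close> is empty, so that exactly the empty set has genus 0.
\<close>

definition krasnoselskii_genus :: "'w::uminus topology \<Rightarrow> 'w set \<Rightarrow> enat" where
  "krasnoselskii_genus X F =
     Inf {enat l | l. \<exists>f. continuous_map (subtopology X F)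
                            (subtopology (Euclidean_space l) (- {\<lambda>i. 0})) f \<and>
                          (\<forall>w\<in>F. f (- w) = (\<lambda>i. - f w i))}"

definition genus_family :: "nat \<Rightarrow> real \<Rightarrow> 'a::euclidean_space set \<Rightarrow> 'a sobolev set set" where
  "genus_family k p S =
     {F. F \<subseteq> sobolev_space p S - {w. sobolev_norm p S w = 0} \<and>
         compactin (sobolev_topology p S) (F \<inter> {w. Lp_norm p (surface_measure S) (fst w) = 1}) \<and>
         uminus ` F = F \<and>
         krasnoselskii_genus (sobolev_topology p S) F \<ge> enat k}"

definition rayleigh_quotient :: "real \<Rightarrow> 'a::euclidean_space set \<Rightarrow> 'a sobolev \<Rightarrow> ennreal" where
  "rayleigh_quotient p S w =
     (\<integral>\<^sup>+x. ennreal (norm (snd w x) powr p) \<partial>surface_measure S) /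
     (\<integral>\<^sup>+x. ennreal (\<bar>fst w x\<bar> powr p) \<partial>surface_measure S)"

definition variational_eigenvalue :: "nat \<Rightarrow> real \<Rightarrow> 'a::euclidean_space set \<Rightarrow> ennreal" where
  "variational_eigenvalue k p S = (INF F\<in>genus_family k p S. SUP w\<in>F. rayleigh_quotient p S w)"

definition isoperimetric_ratio :: "'a::euclidean_space set \<Rightarrow> real" where
  "isoperimetric_ratio \<Omega> =
     area (frontier \<Omega>) / measure lebesgue \<Omega> powr ((real DIM('a) - 1) / real DIM('a))"

end

theory Submission
  imports Defs "HOL-Homology.Homology" "HOL-Computational_Algebra.Polynomial"
begin

text \<open>
  Write \<open>n\<close> for the dimension, \<open>V = |\<Omega>|\<close> and \<open>D(h) = |{x \<in> \<Omega>. x + h \<notin> \<Omega>}|\<close>.  Averaging over a cube of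
  volume \<open>4 V\<close> gives a displacement \<open>h\<close> of size about \<open>V\<^sup>1\<^sup>/\<^sup>n\<close> with \<open>D(h) \<ge> V / 2\<close>.  Since \<open>D\<close> is
  subadditive, for every \<open>r\<close> up to that size some coordinate vector \<open>t e\<^sub>i\<close> with \<open>|t| \<le> r\<close> satisfies
  \<open>D(t e\<^sub>i) \<ge> c r V\<^sup>1\<^sup>-\<^sup>1\<^sup>/\<^sup>n\<close>.  Cut space into cubes \<open>Q\<close> of side \<open>r\<close>.  Every segment \<open>[x, x + t e\<^sub>i]\<close> with
  \<open>x \<in> \<Omega>\<close> and \<open>x + t e\<^sub>i \<notin> \<Omega>\<close> meets \<open>\<Sigma>\<close>, so that projecting along \<open>e\<^sub>i\<close> bounds the share of \<open>Q\<close> in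
  \<open>D(t e\<^sub>i)\<close> by a multiple of \<open>r |\<Sigma> \<inter> 3Q|\<close>; this share is also at most \<open>r\<^sup>n\<close>.  For \<open>r\<close> a small multiple of
  \<open>V\<^sup>1\<^sup>/\<^sup>n k\<^sup>-\<^sup>1\<^sup>/\<^sup>(\<^sup>n\<^sup>-\<^sup>1\<^sup>)\<close> the cubes of one colour class modulo 5 can therefore be put into \<open>2 k\<close> groups of
  comparable total share, and in \<open>k\<close> of them the part of \<open>\<Sigma>\<close> near the group has area at most \<open>|\<Sigma>| / k\<close>.
  Smooth cutoffs at scale \<open>r\<close> around these groups are \<open>k\<close> functions with disjoint supports and
  controlled Rayleigh quotients.  The nonzero elements of their span have genus at least \<open>k\<close> by the
  Borsuk--Ulam theorem.
\<close>

subsection \<open>The Borsuk--Ulam theorem\<close>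

text \<open>The area of \<open>\<Sigma>\<close> has no upper bound at small scales: one cube may
  carry almost all of it, so cubes cannot be grouped evenly by area. Displaced volume can be
  grouped, since a cube contributes at most \<open>r^n\<close>, and by projection it bounds area
  from below, which is what the denominators of the Rayleigh quotients need. The numerators need an
  upper bound only on average: of \<open>2 k\<close> disjoint groups at most \<open>k\<close> carry
  more than \<open>|\<Sigma>| / k\<close>. The scale is forced by the demand that a cube be no
  heavier than a group: \<open>r^n\<close> at most a multiple of \<open>r V^(1-1/n) / k\<close>. The
  quotients are then at most a multiple of \<open>r^(-p) (|\<Sigma>| / k) / (V^(1-1/n) / k)\<close>,
  that is \<open>r^(-p) I\<close>, and inserting \<open>r\<close> gives the exponents
  \<open>1 + p/(n-1)\<close> and \<open>p/(n-1)\<close>. The modulus 5 is the width of a cutoff in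
  units of \<open>r\<close>: the cube, one unit on each side to catch the boundary, one more to
  decay. In Borsuk-Ulam, the parity of the degree passes to the equator only for odd maps that
  preserve the equator; a merely continuous map may cover all directions there, hence the
  approximation.\<close>

definition unit_sphere :: "nat \<Rightarrow> (nat \<Rightarrow> real) set" where
  "unit_sphere m = {x. (\<forall>i>m. x i = 0) \<and> (\<Sum>i\<le>m. (x i)\<^sup>2) = 1}"

text \<open>Here and in \<open>unit_sphere\<close>, \<open>m\<close> is the dimension of the sphere,
  so the coordinates in use are \<open>0..m\<close>, in accordance with
  \<open>nsphere m\<close>.\<close>

definition punctured :: "nat \<Rightarrow> (nat \<Rightarrow> real) set" where
  "punctured m = {x. (\<forall>i>m. x i = 0) \<and> x \<noteq> (\<lambda>i. 0)}"

definition normalise :: "nat \<Rightarrow> (nat \<Rightarrow> real) \<Rightarrow> nat \<Rightarrow> real" where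
  "normalise m x = (\<lambda>i. x i / sqrt (\<Sum>j\<le>m. (x j)\<^sup>2))"

text \<open>Composing with the radial retraction lets homotopies be plain formulas that only have to
  avoid the origin.\<close>

definition punctured_degree :: "nat \<Rightarrow> ((nat \<Rightarrow> real) \<Rightarrow> nat \<Rightarrow> real) \<Rightarrow> int" where
  "punctured_degree m f = Brouwer_degree2 m (\<lambda>x. normalise m (f x))"

lemma continuous_on_component [continuous_intros]:
  "continuous_on S (\<lambda>x::'i \<Rightarrow> 'b::topological_space. x i)"
  by (rule continuous_on_product_then_coordinatewise[OF continuous_on_id])

lemma nsphere_eq: "nsphere m = top_of_set (unit_sphere m)"
proof -
  have "{x::nat \<Rightarrow> real. \<forall>i\<ge>Suc m. x i = 0} \<inter> {x. (\<Sum>i\<le>m. (x i)\<^sup>2) = 1} = unit_sphere m"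
    by (auto simp: unit_sphere_def Suc_le_eq)
  then show ?thesis
    by (simp add: nsphere_def Euclidean_space_def subtopology_subtopology euclidean_product_topology)
qed

lemma topspace_nsphere_eq: "topspace (nsphere m) = unit_sphere m"
  by (simp add: nsphere_eq)

lemma punctured_sum_pos:
  assumes "x \<in> punctured m"
  shows "0 < (\<Sum>j\<le>m. (x j)\<^sup>2)"
proof -
  obtain i where "x i \<noteq> 0" "i \<le> m"
    using assms by (auto simp: punctured_def) (meson not_le_imp_less)
  then show ?thesis by (intro sum_pos2[of _ i]) auto
qed

lemma unit_sphere_subset_punctured: "unit_sphere m \<subseteq> punctured m"
  by (auto simp: unit_sphere_def punctured_def)

lemma normalise_in_sphere: "x \<in> punctured m \<Longrightarrow> normalise m x \<in> unit_sphere m"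
  using punctured_sum_pos[of x m]
  by (simp add: unit_sphere_def normalise_def power_divide sum_divide_distrib[symmetric] punctured_def)

lemma normalise_uminus: "normalise m (\<lambda>i. - x i) = (\<lambda>i. - normalise m x i)"
  by (simp add: normalise_def)

lemma continuous_on_normalise:
  assumes "continuous_on S f" "f ` S \<subseteq> punctured m"
  shows "continuous_on S (\<lambda>x. normalise m (f x))"
  unfolding normalise_def
proof (intro continuous_on_coordinatewise_then_product continuous_intros)
  show "continuous_on S (\<lambda>x. f x i)" for i
    using assms(1) by (rule continuous_on_product_then_coordinatewise)
  then show "continuous_on S (\<lambda>x. f x i)" for i .
  show "\<forall>x\<in>S. sqrt (\<Sum>j\<le>m. (f x j)\<^sup>2) \<noteq> 0"
    using punctured_sum_pos[of _ m] assms(2) by (fastforce simp: image_subset_iff)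
qed

lemma punctured_degree_homotopic:
  assumes h: "continuous_on ({0..1::real} \<times> unit_sphere m) h" "h ` ({0..1} \<times> unit_sphere m) \<subseteq> punctured m"
  shows "punctured_degree m (\<lambda>x. h (0, x)) = punctured_degree m (\<lambda>x. h (1, x))"
  unfolding punctured_degree_def
proof (rule Brouwer_degree2_homotopic)
  have "continuous_map (prod_topology (top_of_set {0..1}) (top_of_set (unit_sphere m)))
     (top_of_set (unit_sphere m)) (\<lambda>z. normalise m (h z))"
    using continuous_on_normalise[OF h] h(2) normalise_in_sphere
    by (auto simp: prod_topology_subtopology_eu image_subset_iff)
  then show "homotopic_with (\<lambda>x. True) (nsphere m) (nsphere m)
     (\<lambda>x. normalise m (h (0, x))) (\<lambda>x. normalise m (h (1, x)))"
    unfolding homotopic_with_def nsphere_eq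
    by (intro exI[of _ "\<lambda>z. normalise m (h z)"]) auto
qed

lemma punctured_degree_cong:
  assumes "\<And>x. x \<in> unit_sphere m \<Longrightarrow> f x = g x"
  shows "punctured_degree m f = punctured_degree m g"
  unfolding punctured_degree_def using assms
  by (intro Brouwer_degree2_eq) (simp add: topspace_nsphere_eq)

text \<open>Every point of the segment from \<open>f x\<close> to \<open>g x\<close> has positive
  inner product with \<open>f x\<close>, so the segment misses the origin.\<close>

lemma punctured_degree_straight_line:
  assumes f: "continuous_on (unit_sphere m) f" "f ` unit_sphere m \<subseteq> punctured m"
    and g: "continuous_on (unit_sphere m) g" "\<And>x i. x \<in> unit_sphere m \<Longrightarrow> i > m \<Longrightarrow> g x i = 0"
    and fg: "\<And>x. x \<in> unit_sphere m \<Longrightarrow> 0 < (\<Sum>i\<le>m. g x i * f x i)"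
  shows "punctured_degree m f = punctured_degree m g"
proof -
  define h where "h = (\<lambda>(t::real, x) i. (1 - t) * f x i + t * g x i)"
  have "continuous_on ({0..1} \<times> unit_sphere m) h"
    unfolding h_def split_def
  proof (intro continuous_on_coordinatewise_then_product continuous_intros)
    fix i
    have *: "continuous_on ({0..1} \<times> unit_sphere m) (\<lambda>z. g' (snd z) i)"
      if "continuous_on (unit_sphere m) g'" for g' :: "_ \<Rightarrow> nat \<Rightarrow> real"
      by (rule continuous_on_compose2[OF continuous_on_product_then_coordinatewise[OF that]]) (auto intro: continuous_intros)
    show "continuous_on ({0..1} \<times> unit_sphere m) (\<lambda>z. f (snd z) i)"
         "continuous_on ({0..1} \<times> unit_sphere m) (\<lambda>z. g (snd z) i)"
      using f(1) g(1) by (auto intro: *)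
  qed
  moreover have "h (t, x) \<in> punctured m" if t: "0 \<le> t" "t \<le> 1" and x: "x \<in> unit_sphere m" for t x
  proof -
    have fx: "f x \<in> punctured m" using f x by auto
    have "0 < (1 - t) * (\<Sum>i\<le>m. (f x i)\<^sup>2) + t * (\<Sum>i\<le>m. g x i * f x i)"
      using punctured_sum_pos[OF fx] fg[OF x] t
      by (cases "t = 1") (auto intro!: add_pos_nonneg)
    also have "\<dots> = (\<Sum>i\<le>m. h (t, x) i * f x i)"
      unfolding sum_distrib_left sum.distrib[symmetric]
      by (rule sum.cong) (simp_all add: h_def power2_eq_square algebra_simps)
    finally have "h (t, x) \<noteq> (\<lambda>i. 0)" by auto
    then show ?thesis using fx g(2)[OF x] by (auto simp: punctured_def h_def)
  qed
  ultimately have "punctured_degree m (\<lambda>x. h (0, x)) = punctured_degree m (\<lambda>x. h (1, x))"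
    by (intro punctured_degree_homotopic) auto
  then show ?thesis by (simp add: h_def)
qed

text \<open>Carries \<open>Borsuk_odd_mapping_degree_step\<close> over to maps that are not
  normalised: on the equator the last coordinate of \<open>f x\<close> is 0, so normalising in
  either dimension gives the same point.\<close>

lemma punctured_degree_step:
  assumes m: "m > 0" and f: "continuous_on (unit_sphere m) f" "f ` unit_sphere m \<subseteq> punctured m"
    and odd: "\<And>x. x \<in> unit_sphere m \<Longrightarrow> f (\<lambda>i. - x i) = (\<lambda>i. - f x i)"
    and eq: "\<And>x. x \<in> unit_sphere m \<Longrightarrow> x m = 0 \<Longrightarrow> f x m = 0"
  shows "even (punctured_degree m f - punctured_degree (m - 1) f)"
proof -
  obtain l where l: "m = Suc l" using m by (cases m) auto
  have sub: "x \<in> unit_sphere m \<and> x m = 0" if "x \<in> unit_sphere l" for x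
    using that l by (auto simp: unit_sphere_def)
  have nl: "normalise m (f x) = normalise l (f x)" if "x \<in> unit_sphere l" for x
    using eq[of x] sub[OF that] l by (simp add: normalise_def)
  have pl: "f x \<in> punctured l" if "x \<in> unit_sphere l" for x
  proof -
    have "f x \<in> punctured m" using f(2) sub[OF that] by auto
    moreover have "f x i = 0" if "i > l" for i
      using that l eq[of x] sub[OF \<open>x \<in> unit_sphere l\<close>] calculation
      by (cases "i = m") (auto simp: punctured_def)
    ultimately show ?thesis by (simp add: punctured_def)
  qed
  have "even (Brouwer_degree2 m (\<lambda>x. normalise m (f x)) - Brouwer_degree2 (m - Suc 0) (\<lambda>x. normalise m (f x)))"
  proof (rule Borsuk_odd_mapping_degree_step)
    show "continuous_map (nsphere m) (nsphere m) (\<lambda>x. normalise m (f x))"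
      unfolding nsphere_eq using continuous_on_normalise[OF f] f(2) normalise_in_sphere by auto
    show "(\<lambda>x. normalise m (f x)) \<in> topspace (nsphere (m - Suc 0)) \<rightarrow> topspace (nsphere (m - Suc 0))"
      using l nl pl normalise_in_sphere by (auto simp: topspace_nsphere_eq)
  next
    fix u assume "u \<in> topspace (nsphere m)"
    then show "((\<lambda>x. normalise m (f x)) \<circ> (\<lambda>x i. - x i)) u = ((\<lambda>x i. - x i) \<circ> (\<lambda>x. normalise m (f x))) u"
      by (simp add: topspace_nsphere_eq odd normalise_uminus)
  qed
  moreover have "Brouwer_degree2 l (\<lambda>x. normalise m (f x)) = Brouwer_degree2 l (\<lambda>x. normalise l (f x))"
    by (intro Brouwer_degree2_eq) (simp add: nl topspace_nsphere_eq)
  ultimately show ?thesis using l by (simp add: punctured_degree_def)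
qed

text \<open>The sphere consists of two points, and a normalised odd map is the identity or the swap;
  the latter is the reflection in coordinate 0, of degree -1.\<close>

lemma punctured_degree_0:
  assumes f: "f ` unit_sphere 0 \<subseteq> punctured 0"
    and fodd: "\<And>x. x \<in> unit_sphere 0 \<Longrightarrow> f (\<lambda>i. - x i) = (\<lambda>i. - f x i)"
  shows "odd (punctured_degree 0 f)"
proof -
  define e where "e = (\<lambda>i::nat. if i = 0 then 1 else 0 :: real)"
  have S: "unit_sphere 0 = {e, \<lambda>i. - e i}"
  proof -
    have "x = e \<or> x = (\<lambda>i. - e i)" if "x \<in> unit_sphere 0" for x
    proof -
      from that have "x 0 = 1 \<or> x 0 = -1" and "\<forall>i>0. x i = 0"
        by (auto simp: unit_sphere_def power2_eq_1_iff)
      then show ?thesis by (auto simp: e_def fun_eq_iff)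
    qed
    then show ?thesis by (auto simp: unit_sphere_def e_def)
  qed
  define a where "a = f e 0"
  have fe: "f e \<in> punctured 0" using f S by auto
  have fi: "f e i = 0" if "i > 0" for i using fe that by (auto simp: punctured_def)
  have a: "a \<noteq> 0"
  proof
    assume "a = 0"
    then have "f e i = 0" for i using fi[of i] by (cases "i = 0") (auto simp: a_def)
    then show False using fe by (auto simp: punctured_def)
  qed
  have f1: "f e = (\<lambda>i. a * e i)" using fi by (auto simp: a_def e_def)
  have f2: "f (\<lambda>i. - e i) = (\<lambda>i. - (a * e i))" using fodd[of e] f1 S by auto
  have n: "normalise 0 (\<lambda>i. b * e i) = (\<lambda>i. b / \<bar>b\<bar> * e i)" for b
    by (auto simp: normalise_def e_def)
  have n1: "normalise 0 (f e) = (\<lambda>i. a / \<bar>a\<bar> * e i)"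
    and n2: "normalise 0 (f (\<lambda>i. - e i)) = (\<lambda>i. - (a / \<bar>a\<bar>) * e i)"
    unfolding f1 f2 using n[of a] n[of "- a"] by auto
  show ?thesis
  proof (cases "a > 0")
    case True
    have "Brouwer_degree2 0 (\<lambda>x. normalise 0 (f x)) = Brouwer_degree2 0 id"
      by (rule Brouwer_degree2_eq) (use True n1 n2 in \<open>auto simp: topspace_nsphere_eq S\<close>)
    then show ?thesis by (simp add: punctured_degree_def)
  next
    case False
    have r: "(\<lambda>i. if i = 0 then - e i else e i) = (\<lambda>i. - e i)"
            "(\<lambda>i. if i = 0 then - (- e i) else - e i) = e"
      by (auto simp: e_def)
    have "Brouwer_degree2 0 (\<lambda>x. normalise 0 (f x)) = Brouwer_degree2 0 (\<lambda>x i. if i = 0 then - x i else x i)"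
    proof (rule Brouwer_degree2_eq)
      fix x assume "x \<in> topspace (nsphere 0)"
      then consider "x = e" | "x = (\<lambda>i. - e i)" by (auto simp: topspace_nsphere_eq S)
      then show "normalise 0 (f x) = (\<lambda>i. if i = 0 then - x i else x i)"
      proof cases
        case 1
        show ?thesis using False a unfolding 1 n1 r(1) by (auto simp: abs_if)
      next
        case 2
        show ?thesis using False a unfolding 2 n2 r(2) by (auto simp: abs_if)
      qed
    qed
    then show ?thesis by (simp add: punctured_degree_def Brouwer_degree2_reflection)
  qed
qed

section \<open>Annihilating covectors, the max norm and the surface of a cube\<close>

text \<open>There are \<open>m + 1\<close> unknowns and at most \<open>m\<close> equations. Gaussian
  elimination on the last coordinate gives the induction.\<close>

lemma exists_annihilator:
  fixes W :: "(nat \<Rightarrow> 'a::field) set"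
  assumes "finite W" "card W \<le> m"
  shows "\<exists>c. (\<exists>i\<le>m. c i \<noteq> 0) \<and> (\<forall>w\<in>W. (\<Sum>i\<le>m. c i * w i) = 0)"
  using assms
proof (induction m arbitrary: W)
  case 0
  then show ?case by (intro exI[of _ "\<lambda>_. 1"]) auto
next
  case (Suc m)
  show ?case
  proof (cases "\<forall>w\<in>W. w (Suc m) = 0")
    case True
    then show ?thesis by (intro exI[of _ "\<lambda>i. if i = Suc m then 1 else 0"]) auto
  next
    case False
    then obtain u where u: "u \<in> W" "u (Suc m) \<noteq> 0" by auto
    \<comment> \<open>With pivot \<open>u\<close>, \<open>p\<close> clears the last coordinate. A
      solution for the cleared vectors is then extended by the one coefficient that annihilates
      \<open>u\<close>.\<close>
    define p where "p = (\<lambda>w i. w i - w (Suc m) / u (Suc m) * u i)"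
    have "card (p ` (W - {u})) \<le> card (W - {u})" using Suc.prems by (intro card_image_le) auto
    then have "card (p ` (W - {u})) \<le> m" using Suc.prems u by auto
    then obtain c where c: "\<exists>i\<le>m. c i \<noteq> 0" "\<And>w. w \<in> W - {u} \<Longrightarrow> (\<Sum>i\<le>m. c i * p w i) = 0"
      using Suc.IH[of "p ` (W - {u})"] Suc.prems by auto
    define s where "s = (\<Sum>i\<le>m. c i * u i)"
    define d where "d = c(Suc m := - s / u (Suc m))"
    have d: "(\<Sum>i\<le>Suc m. d i * w i) = (\<Sum>i\<le>m. c i * w i) - s / u (Suc m) * w (Suc m)" for w
    proof -
      have "(\<Sum>i\<le>m. d i * w i) = (\<Sum>i\<le>m. c i * w i)" by (rule sum.cong) (auto simp: d_def)
      then show ?thesis by (simp add: d_def)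
    qed
    have "(\<Sum>i\<le>Suc m. d i * w i) = 0" if w: "w \<in> W" for w
    proof (cases "w = u")
      case True
      then show ?thesis using u unfolding d by (simp add: s_def)
    next
      case False
      have "0 = (\<Sum>i\<le>m. c i * p w i)" using c(2) False w by auto
      also have "\<dots> = (\<Sum>i\<le>m. c i * w i) - (\<Sum>i\<le>m. w (Suc m) / u (Suc m) * (c i * u i))"
        unfolding sum_subtractf[symmetric] by (rule sum.cong) (simp_all add: p_def algebra_simps)
      also have "\<dots> = (\<Sum>i\<le>m. c i * w i) - s / u (Suc m) * w (Suc m)"
        by (subst sum_distrib_left[symmetric]) (simp add: s_def)
      finally show ?thesis unfolding d by simp
    qed
    moreover obtain i where "i \<le> m" "c i \<noteq> 0" using c(1) by auto
    then have "\<exists>i\<le>Suc m. d i \<noteq> 0" by (intro exI[of _ i]) (simp add: d_def)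
    ultimately show ?thesis by blast
  qed
qed

text \<open>The recursion builds the max norm from binary maxima, so that its continuity is an
  induction.\<close>

primrec maxabs :: "nat \<Rightarrow> (nat \<Rightarrow> real) \<Rightarrow> real" where
  "maxabs 0 x = \<bar>x 0\<bar>"
| "maxabs (Suc m) x = max (maxabs m x) \<bar>x (Suc m)\<bar>"

lemma maxabs_upper: "i \<le> m \<Longrightarrow> \<bar>x i\<bar> \<le> maxabs m x"
proof (induction m)
  case (Suc m)
  then show ?case by (cases "i = Suc m") auto
qed auto

lemma maxabs_attained: "\<exists>i\<le>m. maxabs m x = \<bar>x i\<bar>"
proof (induction m)
  case (Suc m)
  then obtain i where "i \<le> m" "maxabs m x = \<bar>x i\<bar>" by auto
  then show ?case by (cases "maxabs m x \<le> \<bar>x (Suc m)\<bar>") (auto simp: max_def intro: exI[of _ i])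
qed auto

lemma continuous_on_maxabs [continuous_intros]: "continuous_on S (maxabs m)"
proof (induction m)
  case 0
  show ?case by (simp add: continuous_on_component continuous_on_rabs)
next
  case (Suc m)
  then show ?case
    using continuous_on_max[OF Suc continuous_on_rabs[OF continuous_on_component]] by simp
qed

lemma maxabs_pos:
  assumes "x \<in> punctured m"
  shows "0 < maxabs m x"
proof -
  obtain i where i: "i \<le> m" "x i \<noteq> 0"
    using assms by (auto simp: punctured_def) (meson not_le_imp_less)
  then show ?thesis using maxabs_upper[OF i(1), of x] by linarith
qed

lemma maxabs_scale: "0 \<le> c \<Longrightarrow> maxabs m (\<lambda>i. c * x i) = c * maxabs m x"
proof (induction m)
  case (Suc m)
  then show ?case by (simp add: abs_mult max_mult_distrib_left)
qed (simp add: abs_mult)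

lemma maxabs_uminus: "maxabs m (\<lambda>i. - x i) = maxabs m x"
  by (induction m) auto

text \<open>By Tychonoff a product of intervals is compact in the topology of pointwise convergence.
  The coefficient sets of the eigenvalue argument use this as well.\<close>

lemma compact_coordinate_box:
  fixes R :: real
  assumes "closed K" "\<And>x i. x \<in> K \<Longrightarrow> \<bar>x i\<bar> \<le> R"
  shows "compact (K :: (nat \<Rightarrow> real) set)"
proof -
  have "compactin (product_topology (\<lambda>i. euclideanreal) (UNIV::nat set)) (PiE UNIV (\<lambda>i. {-R..R}))"
    by (subst compactin_PiE) auto
  then have c: "compact (PiE UNIV (\<lambda>i::nat. {-R..R}))"
    by (simp add: euclidean_product_topology)
  have "K \<subseteq> PiE UNIV (\<lambda>i. {-R..R})"
  proof
    fix x assume "x \<in> K"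
    then have "\<bar>x i\<bar> \<le> R" for i by (rule assms(2))
    then show "x \<in> PiE UNIV (\<lambda>i. {-R..R})" by (auto simp: abs_le_iff minus_le_iff)
  qed
  then show ?thesis using closed_Int_compact[OF assms(1) c] by (simp add: inf.absorb1)
qed

text \<open>A cube serves instead of the round sphere because after scaling by \<open>N\<close> each
  point has a coordinate \<open>N\<close> or \<open>-N\<close>. All lattice points at coordinate
  distance less than 1 share it, so the vertices stay on the surface.\<close>

definition cube_surface :: "nat \<Rightarrow> (nat \<Rightarrow> real) set" where
  "cube_surface m = {x. (\<forall>i>m. x i = 0) \<and> maxabs m x = 1}"

lemma cube_surface_subset_punctured: "cube_surface m \<subseteq> punctured m"
proof
  fix x assume x: "x \<in> cube_surface m"
  have "maxabs m (\<lambda>i. 0) = 0" by (induction m) auto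
  then show "x \<in> punctured m" using x by (auto simp: cube_surface_def punctured_def)
qed

lemma compact_cube_surface: "compact (cube_surface m)"
proof (rule compact_coordinate_box)
  have "cube_surface m = (\<Inter>i\<in>{m<..}. {x. x i = 0}) \<inter> {x. maxabs m x = 1}"
    by (auto simp: cube_surface_def)
  then show "closed (cube_surface m)"
    by (auto intro!: closed_Int closed_INT closed_Collect_eq continuous_intros)
  show "\<bar>x i\<bar> \<le> 1" if "x \<in> cube_surface m" for x i
    using that maxabs_upper[of i m x] by (cases "i \<le> m") (auto simp: cube_surface_def)
qed

text \<open>The metric on functions weights the coordinates by powers of 1/2 with total weight
  2.\<close>

lemma dist_fun_le:
  fixes x y :: "nat \<Rightarrow> real"
  assumes "\<And>i. dist (x i) (y i) \<le> e"
  shows "dist x y \<le> 2 * e"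
proof -
  have s: "summable (\<lambda>n. (1/2)^n * e)"
    by (intro summable_mult2 summable_geometric) auto
  have le: "(1/2) ^ n * min (dist (x (from_nat n)) (y (from_nat n))) 1 \<le> (1/2)^n * e" for n
    using assms[of "from_nat n"] by (intro mult_left_mono) auto
  have "dist x y \<le> suminf (\<lambda>n. (1/2)^n * e)"
    unfolding dist_fun_def
    by (intro suminf_le le s summable_comparison_test'[OF s, of 0]) (use le in auto)
  also have "\<dots> = 2 * e"
    by (subst suminf_mult2[symmetric]) (auto simp: suminf_geometric)
  finally show ?thesis .
qed

text \<open>On the diagonal the inner product is the squared norm of \<open>F\<close>, which has a
  positive minimum \<open>q (a, a)\<close> on the compact cube surface; uniform continuity extends
  positivity to nearby pairs.\<close>

lemma uniform_inner_positive:
  assumes F: "continuous_on (cube_surface m) F" "F ` cube_surface m \<subseteq> punctured m"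
  obtains \<eta> where "\<eta> > 0"
    "\<And>x y. x \<in> cube_surface m \<Longrightarrow> y \<in> cube_surface m \<Longrightarrow> (\<And>i. \<bar>x i - y i\<bar> \<le> \<eta>) \<Longrightarrow>
       0 < (\<Sum>i\<le>m. F x i * F y i)"
proof -
  let ?K = "cube_surface m"
  define q where "q = (\<lambda>z. \<Sum>i\<le>m. F (fst z) i * F (snd z) i)"
  have c: "continuous_on ?K (\<lambda>x. F x i)" for i
    by (rule continuous_on_product_then_coordinatewise[OF F(1)])
  have "continuous_on (?K \<times> ?K) q"
    unfolding q_def
    by (intro continuous_intros continuous_on_compose2[OF c continuous_on_fst[OF continuous_on_id]]
        continuous_on_compose2[OF c continuous_on_snd[OF continuous_on_id]]) auto
  then have uc: "uniformly_continuous_on (?K \<times> ?K) q"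
    by (intro compact_uniformly_continuous compact_Times compact_cube_surface)
  have ne: "?K \<noteq> {}"
  proof -
    have "maxabs m (\<lambda>i. if i = 0 then 1 else 0) = 1" by (induction m) auto
    then have "(\<lambda>i. if i = 0 then 1 else 0) \<in> ?K" by (auto simp: cube_surface_def)
    then show ?thesis by auto
  qed
  have "continuous_on ?K (\<lambda>x. q (x, x))"
    unfolding q_def fst_conv snd_conv by (intro continuous_intros c)
  then obtain a where a: "a \<in> ?K" "\<And>x. x \<in> ?K \<Longrightarrow> q (a, a) \<le> q (x, x)"
    using continuous_attains_inf[OF compact_cube_surface ne] by blast
  have "F a \<in> punctured m" using a(1) F(2) by auto
  then have pos: "0 < q (a, a)" using punctured_sum_pos by (auto simp: q_def power2_eq_square)
  obtain d where d: "d > 0" "\<forall>z\<in>?K \<times> ?K. \<forall>w\<in>?K \<times> ?K. dist w z < d \<longrightarrow> dist (q w) (q z) < q (a, a)"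
    using uc[unfolded uniformly_continuous_on_def, rule_format, OF pos] by (elim exE conjE)
  show thesis
  \<comment> \<open>Coordinate distance \<open>d / 4\<close> means distance at most
    \<open>d / 2\<close> in the function metric, strictly below \<open>d\<close>.\<close>
  proof (rule that[of "d / 4"])
    fix x y assume xy: "x \<in> ?K" "y \<in> ?K" "\<And>i. \<bar>x i - y i\<bar> \<le> d / 4"
    have "dist x y \<le> 2 * (d / 4)"
      using xy(3) by (intro dist_fun_le) (auto simp: dist_real_def)
    then have "dist (x, x) (x, y) < d" using d(1) by (simp add: dist_Pair_Pair)
    moreover have "(x, y) \<in> ?K \<times> ?K" "(x, x) \<in> ?K \<times> ?K" using xy by auto
    ultimately have "dist (q (x, x)) (q (x, y)) < q (a, a)" using d(2) by blast
    then have "0 < q (x, y)" using a(2)[OF xy(1)] by (auto simp: dist_real_def)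
    then show "0 < (\<Sum>i\<le>m. F x i * F y i)" by (simp add: q_def)
  qed (use d in auto)
qed

text \<open>The piecewise linear hat function of the Freudenthal--Kuhn triangulation at \<open>v\<close> is the positive
  part of \<open>1 - max\<^sub>i (z\<^sub>i - v\<^sub>i)\<^sup>+ - max\<^sub>j (v\<^sub>j - z\<^sub>j)\<^sup>+\<close>.  The product below has the same support and
  the same symmetry under \<open>-1\<close>.\<close>

definition kuhn_hat :: "nat \<Rightarrow> (nat \<Rightarrow> real) \<Rightarrow> (nat \<Rightarrow> real) \<Rightarrow> real" where
  "kuhn_hat m v z = (\<Prod>i\<le>m. \<Prod>j\<le>m. max 0 (1 - max 0 (z i - v i) - max 0 (v j - z j)))"

lemma kuhn_hat_nonneg: "0 \<le> kuhn_hat m v z"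
  by (auto simp: kuhn_hat_def intro!: prod_nonneg)

lemma kuhn_hat_pos_iff:
  "0 < kuhn_hat m v z \<longleftrightarrow> (\<forall>i\<le>m. \<forall>j\<le>m. max 0 (z i - v i) + max 0 (v j - z j) < 1)"
proof
  assume h: "0 < kuhn_hat m v z"
  show "\<forall>i\<le>m. \<forall>j\<le>m. max 0 (z i - v i) + max 0 (v j - z j) < 1"
  proof (rule ccontr)
    assume "\<not> ?thesis"
    then obtain i j where "i \<le> m" "j \<le> m" "max 0 (1 - max 0 (z i - v i) - max 0 (v j - z j)) = 0"
      by (auto simp: not_less)
    then have "kuhn_hat m v z = 0" unfolding kuhn_hat_def
      by (intro prod_zero[OF _ bexI[of _ i]] prod_zero[OF _ bexI[of _ j]]) auto
    then show False using h by simp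
  qed
next
  assume "\<forall>i\<le>m. \<forall>j\<le>m. max 0 (z i - v i) + max 0 (v j - z j) < 1"
  then show "0 < kuhn_hat m v z" unfolding kuhn_hat_def
    by (intro prod_pos) (auto simp: less_max_iff_disj algebra_simps)
qed

text \<open>Negation exchanges the upward and downward excesses, hence the roles of \<open>i\<close>
  and \<open>j\<close>, under which the double product is symmetric.\<close>

lemma kuhn_hat_uminus: "kuhn_hat m (\<lambda>i. - v i) (\<lambda>i. - z i) = kuhn_hat m v z"
proof -
  have "max 0 (1 - max 0 (- z i - - v i) - max 0 (- v j - - z j)) = max 0 (1 - max 0 (z j - v j) - max 0 (v i - z i))"
    for i j by linarith
  then show ?thesis unfolding kuhn_hat_def by (subst prod.swap) simp
qed

lemma kuhn_hat_posD:
  assumes "0 < kuhn_hat m v z" "i \<le> m"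
  shows "\<bar>v i - z i\<bar> < 1"
proof -
  have "max 0 (z i - v i) + max 0 (v i - z i) < 1" using assms unfolding kuhn_hat_pos_iff by blast
  then show ?thesis by linarith
qed

definition integer_box :: "nat \<Rightarrow> nat \<Rightarrow> (nat \<Rightarrow> real) set" where
  "integer_box m N = {v. (\<forall>i>m. v i = 0) \<and> (\<forall>i\<le>m. v i \<in> \<int> \<and> \<bar>v i\<bar> \<le> real N)}"

lemma finite_integer_box: "finite (integer_box m N)"
proof (rule finite_subset)
  show "integer_box m N \<subseteq> (\<lambda>f i. if i \<le> m then real_of_int (f i) else 0) ` (PiE {..m} (\<lambda>_. {- int N..int N}))"
  proof
    fix v assume v: "v \<in> integer_box m N"
    define f where "f = (\<lambda>i\<in>{..m}. \<lfloor>v i\<rfloor>)"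
    have "real_of_int \<lfloor>v i\<rfloor> = v i" if "i \<le> m" for i
      using v that by (auto simp: integer_box_def)
    then have "v = (\<lambda>i. if i \<le> m then real_of_int (f i) else 0)"
      using v by (auto simp: integer_box_def f_def)
    moreover have "f \<in> PiE {..m} (\<lambda>_. {- int N..int N})"
    proof (rule PiE_I)
      fix i assume "i \<in> {..m}"
      then have "\<bar>v i\<bar> \<le> real N" using v by (auto simp: integer_box_def)
      then show "f i \<in> {- int N..int N}" using \<open>i \<in> {..m}\<close>
        by (auto simp: f_def le_floor_iff floor_le_iff)
    qed (auto simp: f_def)
    ultimately show "v \<in> (\<lambda>f i. if i \<le> m then real_of_int (f i) else 0) ` (PiE {..m} (\<lambda>_. {- int N..int N}))"
      by blast
  qed
qed (auto intro!: finite_PiE)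

text \<open>The lattice points whose hat functions are positive at \<open>z\<close> form a chain, so that the sum of
  the coordinates separates them.\<close>

lemma card_active_le:
  assumes z: "z m \<in> \<int>" and k: "k < m" "z k \<in> \<int>"
  shows "card {v \<in> integer_box m N. 0 < kuhn_hat m v z} \<le> m"
proof -
  define V where "V = {v \<in> integer_box m N. 0 < kuhn_hat m v z}"
  define s where "s = (\<lambda>v::nat \<Rightarrow> real. \<Sum>j\<le>m. \<lfloor>v j\<rfloor> - \<lfloor>z j\<rfloor>)"
  have int: "v j = real_of_int \<lfloor>v j\<rfloor>" if "v \<in> V" "j \<le> m" for v j
    using that by (auto simp: V_def integer_box_def)
  have near: "\<bar>v j - z j\<bar> < 1" if "v \<in> V" "j \<le> m" for v j
    using that kuhn_hat_posD by (auto simp: V_def)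
  have d: "\<lfloor>v j\<rfloor> - \<lfloor>z j\<rfloor> \<in> {0, 1}" "z j \<in> \<int> \<Longrightarrow> \<lfloor>v j\<rfloor> - \<lfloor>z j\<rfloor> = 0" if "v \<in> V" "j \<le> m" for v j
  proof -
    define a where "a = \<lfloor>v j\<rfloor>"
    have "\<bar>real_of_int a - z j\<bar> < 1" using near[OF that] int[OF that] by (simp add: a_def)
    then show "\<lfloor>v j\<rfloor> - \<lfloor>z j\<rfloor> \<in> {0, 1}" unfolding a_def[symmetric] by (simp, linarith)
    assume "z j \<in> \<int>"
    then obtain b where b: "z j = real_of_int b" by (auto elim: Ints_cases)
    have "\<bar>real_of_int a - real_of_int b\<bar> < 1" using \<open>\<bar>real_of_int a - z j\<bar> < 1\<close> b by simp
    then have "a = b" by linarith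
    then show "\<lfloor>v j\<rfloor> - \<lfloor>z j\<rfloor> = 0" by (simp add: a_def[symmetric] b)
  qed
  \<comment> \<open>For incomparable \<open>v\<close> and \<open>w\<close>, let \<open>a\<close> and
    \<open>b\<close> be the fractional parts of \<open>z i\<close> and \<open>z j\<close>.
    Positivity of the hat at \<open>v\<close> gives \<open>b < a\<close>, positivity at
    \<open>w\<close> gives \<open>a < b\<close>.\<close>
  have chain: "(\<forall>j\<le>m. v j \<le> w j) \<or> (\<forall>j\<le>m. w j \<le> v j)" if v: "v \<in> V" and w: "w \<in> V" for v w
  proof (rule ccontr)
    assume "\<not> ?thesis"
    then obtain i j where ij: "i \<le> m" "j \<le> m" "v i > w i" "w j > v j" by (auto simp: not_le)
    have "\<lfloor>w i\<rfloor> < \<lfloor>v i\<rfloor>" using ij int[OF v, of i] int[OF w, of i] by linarith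
    then have i: "\<lfloor>v i\<rfloor> = \<lfloor>z i\<rfloor> + 1" "\<lfloor>w i\<rfloor> = \<lfloor>z i\<rfloor>" using d(1)[OF v ij(1)] d(1)[OF w ij(1)] by auto
    have "\<lfloor>v j\<rfloor> < \<lfloor>w j\<rfloor>" using ij int[OF v, of j] int[OF w, of j] by linarith
    then have j: "\<lfloor>w j\<rfloor> = \<lfloor>z j\<rfloor> + 1" "\<lfloor>v j\<rfloor> = \<lfloor>z j\<rfloor>" using d(1)[OF v ij(2)] d(1)[OF w ij(2)] by auto
    have "max 0 (z j - v j) + max 0 (v i - z i) < 1" "max 0 (z i - w i) + max 0 (w j - z j) < 1"
      using v w ij by (auto simp: V_def kuhn_hat_pos_iff)
    moreover have "v i = w i + 1" "w j = v j + 1"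
      using i j int[OF v ij(1)] int[OF w ij(1)] int[OF v ij(2)] int[OF w ij(2)] by auto
    ultimately show False by (auto simp: max_def split: if_splits)
  qed
  have inj: "inj_on s V"
  proof (rule inj_onI)
    have le: "v = w" if v: "v \<in> V" and w: "w \<in> V" and s: "s v = s w" and le: "\<forall>j\<le>m. v j \<le> w j" for v w
    proof -
      have "(\<Sum>j\<le>m. \<lfloor>w j\<rfloor> - \<lfloor>v j\<rfloor>) = 0" using s by (simp add: s_def sum_subtractf)
      moreover have "0 \<le> \<lfloor>w j\<rfloor> - \<lfloor>v j\<rfloor>" if "j \<in> {..m}" for j using le that by (simp add: floor_mono)
      ultimately have "\<forall>j\<in>{..m}. \<lfloor>w j\<rfloor> - \<lfloor>v j\<rfloor> = 0" by (subst (asm) sum_nonneg_eq_0_iff) auto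
      then have "v j = w j" if "j \<le> m" for j using int[OF v that] int[OF w that] that by simp
      moreover have "v j = w j" if "\<not> j \<le> m" for j using v w that by (auto simp: V_def integer_box_def)
      ultimately show ?thesis by blast
    qed
    fix v w assume "v \<in> V" "w \<in> V" "s v = s w"
    then show "v = w" using chain[of v w] le[of v w] le[of w v] by auto
  qed
  \<comment> \<open>The coordinates \<open>k\<close> and \<open>m\<close>, where \<open>z\<close> is
    an integer, contribute 0. The other \<open>m - 1\<close> contribute 0 or 1 each, which leaves
    \<open>m\<close> possible sums.\<close>
  have range: "s v \<in> {0..int m - 1}" if v: "v \<in> V" for v
  proof -
    have "s v = (\<Sum>j\<in>{..m} - {k, m}. \<lfloor>v j\<rfloor> - \<lfloor>z j\<rfloor>)"
      unfolding s_def using z k d(2)[OF v] by (intro sum.mono_neutral_right) auto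
    moreover have "\<dots> \<le> (\<Sum>j\<in>{..m} - {k, m}. 1)"
      using d(1)[OF v] by (intro sum_mono) force
    moreover have "0 \<le> (\<Sum>j\<in>{..m} - {k, m}. \<lfloor>v j\<rfloor> - \<lfloor>z j\<rfloor>)"
      using d(1)[OF v] by (intro sum_nonneg) force
    moreover have "card ({..m} - {k, m}) = m - 1" using k by (subst card_Diff_subset) auto
    ultimately show ?thesis using k by (simp add: of_nat_diff)
  qed
  have "card V = card (s ` V)" by (rule card_image[OF inj, symmetric])
  also have "\<dots> \<le> card {0..int m - 1}" using range by (intro card_mono) auto
  finally show ?thesis by (simp add: V_def)
qed

lemma normalise_scale:
  assumes "c > 0" "x \<in> unit_sphere m"
  shows "normalise m (\<lambda>i. c * x i) = x"
proof -
  have "(\<Sum>j\<le>m. (c * x j)\<^sup>2) = c\<^sup>2"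
    using assms by (simp add: power_mult_distrib unit_sphere_def flip: sum_distrib_left)
  then show ?thesis using assms by (simp add: normalise_def)
qed

text \<open>A Kuhn-type approximation of \<open>f\<close> on the surface of a cube sends the equator into finitely many
  hyperplanes, because at most \<open>m\<close> vertices are active at a point of the equator.\<close>

lemma equatorial_approximation:
  assumes f: "continuous_on (unit_sphere m) f" "f ` unit_sphere m \<subseteq> punctured m"
    and fodd: "\<And>x. x \<in> unit_sphere m \<Longrightarrow> f (\<lambda>i. - x i) = (\<lambda>i. - f x i)"
  obtains H \<W> where
    "continuous_on (unit_sphere m) H"
    "\<And>x i. x \<in> unit_sphere m \<Longrightarrow> i > m \<Longrightarrow> H x i = 0"
    "\<And>x. x \<in> unit_sphere m \<Longrightarrow> H (\<lambda>i. - x i) = (\<lambda>i. - H x i)"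
    "\<And>x. x \<in> unit_sphere m \<Longrightarrow> 0 < (\<Sum>i\<le>m. H x i * f x i)"
    "finite \<W>" "\<And>W. W \<in> \<W> \<Longrightarrow> finite W \<and> card W \<le> m"
    "\<And>x. x \<in> unit_sphere m \<Longrightarrow> x m = 0 \<Longrightarrow>
       \<exists>W\<in>\<W>. \<forall>c. (\<forall>w\<in>W. (\<Sum>i\<le>m. c i * w i) = 0) \<longrightarrow> (\<Sum>i\<le>m. c i * H x i) = 0"
proof -
  let ?S = "unit_sphere m" and ?K = "cube_surface m"
  \<comment> \<open>\<open>F\<close> is \<open>f\<close> read on the cube surface; the central
    projection \<open>p\<close> below returns to that surface, so that
    \<open>F (p x) = f x\<close>.\<close>
  define F where "F = (\<lambda>y. f (normalise m y))"
  have KP: "?K \<subseteq> punctured m" by (rule cube_surface_subset_punctured)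
  have nK: "normalise m y \<in> ?S" if "y \<in> ?K" for y
    using that KP normalise_in_sphere by blast
  have contn: "continuous_on ?K (normalise m)"
    using continuous_on_normalise[OF continuous_on_id, of ?K m] KP by simp
  have FP: "F y \<in> punctured m" if "y \<in> ?K" for y using nK[OF that] f(2) by (auto simp: F_def)
  have Fc: "continuous_on ?K F"
    unfolding F_def by (rule continuous_on_compose2[OF f(1) contn]) (use nK in auto)
  have Fodd: "F (\<lambda>i. - y i) = (\<lambda>i. - F y i)" if "y \<in> ?K" for y
    unfolding F_def normalise_uminus by (rule fodd[OF nK[OF that]])
  obtain \<eta> where \<eta>: "\<eta> > 0" and Fpos: "\<And>x y. x \<in> ?K \<Longrightarrow> y \<in> ?K \<Longrightarrow>
      (\<And>i. \<bar>x i - y i\<bar> \<le> \<eta>) \<Longrightarrow> 0 < (\<Sum>i\<le>m. F x i * F y i)"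
    using uniform_inner_positive[OF Fc image_subsetI[OF FP]] by blast
  obtain N0 where N0: "inverse (real (Suc N0)) < \<eta>" using reals_Archimedean[OF \<eta>] by auto
  define N where "N = Suc N0"
  have N: "N > 0" "1 / real N \<le> \<eta>" using N0 by (auto simp: N_def inverse_eq_divide)
  define p where "p = (\<lambda>x i. x i / maxabs m x)"
  have mp: "0 < maxabs m x" if "x \<in> ?S" for x
    using that unit_sphere_subset_punctured maxabs_pos by blast
  have pK: "p x \<in> ?K" if x: "x \<in> ?S" for x
  proof -
    have "maxabs m (\<lambda>i. (1 / maxabs m x) * x i) = (1 / maxabs m x) * maxabs m x"
      using mp[OF x] by (intro maxabs_scale) auto
    then have "maxabs m (p x) = 1" using mp[OF x] by (simp add: p_def)
    then show ?thesis using x by (simp add: cube_surface_def p_def unit_sphere_def)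
  qed
  have np: "F (p x) = f x" if x: "x \<in> ?S" for x
    using normalise_scale[of "1 / maxabs m x" x m] mp[OF x] x by (simp add: F_def p_def)
  have pm: "p (\<lambda>i. - x i) = (\<lambda>i. - p x i)" for x by (simp add: p_def maxabs_uminus)
  have pc: "continuous_on ?S (\<lambda>x. p x i)" for i
    unfolding p_def using mp by (intro continuous_intros continuous_on_maxabs) force
  define z where "z = (\<lambda>x i. real N * p x i)"
  define L where "L = integer_box m N"
  have finL: "finite L" unfolding L_def by (rule finite_integer_box)
  define s where "s = (\<lambda>(v::nat \<Rightarrow> real) i. v i / real N)"
  have zint: "\<exists>i\<le>m. z x i \<in> \<int> \<and> \<bar>z x i\<bar> = real N" if x: "x \<in> ?S" for x
  proof -
    obtain i where i: "i \<le> m" "maxabs m x = \<bar>x i\<bar>" using maxabs_attained by blast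
    have "\<bar>p x i\<bar> = 1" using mp[OF x] i by (simp add: p_def)
    then have "p x i = 1 \<or> p x i = -1" by linarith
    then show ?thesis using i(1) by (intro exI[of _ i]) (auto simp: z_def)
  qed
  \<comment> \<open>Some coordinate of \<open>z x\<close> is \<open>N\<close> or \<open>-N\<close>.
    An active vertex differs from \<open>z x\<close> by less than 1 there, hence not at all, so
    active vertices lie on the scaled surface.\<close>
  have sK: "s v \<in> ?K" and sd: "\<bar>s v i - p x i\<bar> \<le> \<eta>"
    if x: "x \<in> ?S" and v: "v \<in> L" "0 < kuhn_hat m v (z x)" for x v i
  proof -
    have "maxabs m (s v) \<le> 1"
    proof -
      obtain j where j: "j \<le> m" "maxabs m (s v) = \<bar>s v j\<bar>" using maxabs_attained by blast
      then show ?thesis using v(1) N by (auto simp: L_def integer_box_def s_def)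
    qed
    moreover have "1 \<le> maxabs m (s v)"
    proof -
      obtain j where j: "j \<le> m" "z x j \<in> \<int>" "\<bar>z x j\<bar> = real N" using zint[OF x] by blast
      have "\<bar>v j - z x j\<bar> < 1" by (rule kuhn_hat_posD[OF v(2) j(1)])
      moreover have "v j - z x j \<in> \<int>" using v(1) j by (auto simp: L_def integer_box_def)
      ultimately have "v j = z x j" by (auto elim!: Ints_cases simp flip: of_int_abs)
      then have "\<bar>s v j\<bar> = 1" using j(3) N by (simp add: s_def abs_divide)
      then show ?thesis using maxabs_upper[OF j(1), of "s v"] by simp
    qed
    ultimately show "s v \<in> ?K" using v(1) by (simp add: cube_surface_def s_def L_def integer_box_def)
    show "\<bar>s v i - p x i\<bar> \<le> \<eta>"
    proof (cases "i \<le> m")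
      case True
      have "s v i - p x i = (v i - z x i) / real N" using N by (simp add: s_def z_def field_simps)
      then have "\<bar>s v i - p x i\<bar> = \<bar>v i - z x i\<bar> / real N" by simp
      also have "\<dots> \<le> 1 / real N" using kuhn_hat_posD[OF v(2) True] by (intro divide_right_mono) auto
      finally show ?thesis using N by simp
    next
      case False
      then show ?thesis using v(1) x \<eta> by (simp add: s_def p_def L_def integer_box_def unit_sphere_def)
    qed
  qed
  define H where "H = (\<lambda>x i. \<Sum>v\<in>L. kuhn_hat m v (z x) * F (s v) i)"
  \<comment> \<open>\<open>H x\<close> lies in the span of the values at the vertices active at
    \<open>x\<close>. On the equator these are at most \<open>m\<close> in number, and only finitely
    many such sets exist because \<open>L\<close> is finite.\<close>
  define \<W> where "\<W> = (\<lambda>V. (\<lambda>v. F (s v)) ` V) ` {V. V \<subseteq> L \<and> card V \<le> m}"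
  have hat0: "kuhn_hat m v (z x) = 0 \<or> 0 < kuhn_hat m v (z x)" for v x
    using kuhn_hat_nonneg[of m v "z x"] by auto
  show thesis
  proof (rule that[of H \<W>])
    have "continuous_on ?S (\<lambda>x. kuhn_hat m v (z x))" for v
      unfolding kuhn_hat_def z_def by (intro continuous_intros pc)
    then show "continuous_on ?S H"
      unfolding H_def by (intro continuous_on_coordinatewise_then_product continuous_intros)
  next
    fix x i assume x: "x \<in> ?S" and i: "i > m"
    have "kuhn_hat m v (z x) * F (s v) i = 0" if v: "v \<in> L" for v
      using hat0[of v x] FP[OF sK[OF x v]] i by (auto simp: punctured_def)
    then show "H x i = 0" unfolding H_def by (rule sum.neutral[rule_format])
  next
    fix x assume x: "x \<in> ?S"
    have Lm: "(\<lambda>i. - v i) \<in> L" if "v \<in> L" for v using that by (auto simp: L_def integer_box_def)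
    have zm: "z (\<lambda>i. - x i) = (\<lambda>i. - z x i)" by (simp add: z_def pm)
    show "H (\<lambda>i. - x i) = (\<lambda>i. - H x i)"
    proof
      fix i
      have "H (\<lambda>i. - x i) i = (\<Sum>v\<in>L. kuhn_hat m (\<lambda>i. - v i) (\<lambda>i. - z x i) * F (s (\<lambda>i. - v i)) i)"
        unfolding H_def zm
        by (rule sum.reindex_bij_witness[of _ "\<lambda>v i. - v i" "\<lambda>v i. - v i"]) (auto intro: Lm)
      also have "\<dots> = (\<Sum>v\<in>L. - (kuhn_hat m v (z x) * F (s v) i))"
      proof (rule sum.cong)
        fix v assume v: "v \<in> L"
        have "s (\<lambda>i. - v i) = (\<lambda>i. - s v i)" by (simp add: s_def)
        then show "kuhn_hat m (\<lambda>i. - v i) (\<lambda>i. - z x i) * F (s (\<lambda>i. - v i)) i = - (kuhn_hat m v (z x) * F (s v) i)"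
          using hat0[of v x] Fodd[OF sK[OF x v]] by (auto simp: kuhn_hat_uminus)
      qed simp
      finally show "H (\<lambda>i. - x i) i = - H x i" by (simp add: H_def sum_negf)
    qed
  next
    fix x assume x: "x \<in> ?S"
    \<comment> \<open>Rounding down always gives an active vertex: no coordinate of \<open>u\<close>
      up to \<open>m\<close> exceeds that of \<open>z x\<close>, and each falls short by less than
      1. It makes the weighted sum strictly positive.\<close>
    define u where "u = (\<lambda>i. if i \<le> m then real_of_int \<lfloor>z x i\<rfloor> else 0)"
    have pb: "\<bar>p x i\<bar> \<le> 1" if "i \<le> m" for i
      using maxabs_upper[OF that, of "p x"] pK[OF x] by (simp add: cube_surface_def)
    have zb: "\<bar>z x i\<bar> \<le> real N" if "i \<le> m" for i
      using pb[OF that] N by (simp add: z_def abs_mult)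
    have uL: "u \<in> L"
    proof -
      have "\<bar>real_of_int \<lfloor>z x i\<rfloor>\<bar> \<le> real N" if "i \<le> m" for i
      proof -
        have "- real N \<le> z x i" "z x i \<le> real N" using zb[OF that] by auto
        then have "- int N \<le> \<lfloor>z x i\<rfloor>" "\<lfloor>z x i\<rfloor> \<le> int N" by (simp_all add: le_floor_iff floor_le_iff)
        then show ?thesis by linarith
      qed
      then show ?thesis by (simp add: u_def L_def integer_box_def)
    qed
    have u: "0 < kuhn_hat m u (z x)"
      unfolding kuhn_hat_pos_iff
    proof (intro allI impI)
      fix i j assume "i \<le> m" "j \<le> m"
      then show "max 0 (z x i - u i) + max 0 (u j - z x j) < 1"
        unfolding u_def by simp linarith
    qed
    define q where "q = (\<lambda>v. \<Sum>i\<le>m. F (s v) i * f x i)"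
    have q: "0 < q v" if "v \<in> L" "0 < kuhn_hat m v (z x)" for v
      unfolding q_def np[OF x, symmetric] using sK[OF x that] sd[OF x that] pK[OF x] by (intro Fpos) auto
    have "0 < (\<Sum>v\<in>L. kuhn_hat m v (z x) * q v)"
    proof (rule sum_pos2[OF finL uL])
      show "0 < kuhn_hat m u (z x) * q u" using u q[OF uL u] by simp
      show "0 \<le> kuhn_hat m v (z x) * q v" if "v \<in> L" for v
        using hat0[of v x] q[OF that] by (auto intro: less_imp_le)
    qed
    also have "\<dots> = (\<Sum>v\<in>L. \<Sum>i\<le>m. kuhn_hat m v (z x) * F (s v) i * f x i)"
      by (simp add: q_def sum_distrib_left mult.assoc)
    also have "\<dots> = (\<Sum>i\<le>m. H x i * f x i)"
      by (subst sum.swap) (simp add: H_def sum_distrib_right)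
    finally show "0 < (\<Sum>i\<le>m. H x i * f x i)" .
  next
    show "finite \<W>" unfolding \<W>_def using finL by simp
  next
    fix W assume "W \<in> \<W>"
    then obtain V where V: "V \<subseteq> L" "card V \<le> m" "W = (\<lambda>v. F (s v)) ` V" by (auto simp: \<W>_def)
    have "finite V" using V finL finite_subset by blast
    then show "finite W \<and> card W \<le> m" using V card_image_le le_trans by blast
  next
    fix x assume x: "x \<in> ?S" and xm: "x m = 0"
    define V where "V = {v \<in> L. 0 < kuhn_hat m v (z x)}"
    obtain k where k: "k \<le> m" "z x k \<in> \<int>" "\<bar>z x k\<bar> = real N" using zint[OF x] by blast
    have zm: "z x m = 0" by (simp add: z_def p_def xm)
    \<comment> \<open>Coordinate \<open>m\<close> is 0 while coordinate \<open>k\<close> is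
      \<open>N\<close> or \<open>-N\<close>, so these are two different integer coordinates, as the
      count of active vertices requires.\<close>
    then have "k < m" using k N by (cases "k = m") auto
    then have cV: "card V \<le> m" unfolding V_def L_def using k zm by (intro card_active_le) auto
    show "\<exists>W\<in>\<W>. \<forall>c. (\<forall>w\<in>W. (\<Sum>i\<le>m. c i * w i) = 0) \<longrightarrow> (\<Sum>i\<le>m. c i * H x i) = 0"
    proof (intro bexI[of _ "(\<lambda>v. F (s v)) ` V"] allI impI)
      show "(\<lambda>v. F (s v)) ` V \<in> \<W>" unfolding \<W>_def using cV by (auto simp: V_def)
      fix c assume c: "\<forall>w\<in>(\<lambda>v. F (s v)) ` V. (\<Sum>i\<le>m. c i * w i) = 0"
      have "(\<Sum>i\<le>m. c i * H x i) = (\<Sum>i\<le>m. \<Sum>v\<in>L. kuhn_hat m v (z x) * (c i * F (s v) i))"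
        by (simp add: H_def sum_distrib_left mult_ac)
      also have "\<dots> = (\<Sum>v\<in>L. kuhn_hat m v (z x) * (\<Sum>i\<le>m. c i * F (s v) i))"
        by (subst sum.swap) (simp add: sum_distrib_left)
      also have "\<dots> = 0"
      proof (rule sum.neutral, rule ballI)
        fix v assume "v \<in> L"
        then show "kuhn_hat m v (z x) * (\<Sum>i\<le>m. c i * F (s v) i) = 0"
          using hat0[of v x] c by (auto simp: V_def)
      qed
      finally show "(\<Sum>i\<le>m. c i * H x i) = 0" .
    qed
  qed
qed

text \<open>A direction \<open>y\<close> that the approximation of \<open>f\<close> avoids on the equator is sheared to the pole.
  The last coordinate can then be deformed to 0 on the equator, and the degree modulo 2 passes to the
  lower dimensional sphere.\<close>

theorem odd_map_odd_degree:
  assumes "continuous_on (unit_sphere m) f" "f ` unit_sphere m \<subseteq> punctured m"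
    and "\<And>x. x \<in> unit_sphere m \<Longrightarrow> f (\<lambda>i. - x i) = (\<lambda>i. - f x i)"
  shows "odd (punctured_degree m f)"
  using assms
proof (induction m arbitrary: f)
  case 0
  then show ?case by (intro punctured_degree_0)
next
  case (Suc l)
  define m where "m = Suc l"
  let ?S = "unit_sphere m"
  note f = Suc.prems[folded m_def]
  obtain H \<W> where Hc: "continuous_on ?S H"
    and H0: "\<And>x i. x \<in> ?S \<Longrightarrow> i > m \<Longrightarrow> H x i = 0"
    and Hodd: "\<And>x. x \<in> ?S \<Longrightarrow> H (\<lambda>i. - x i) = (\<lambda>i. - H x i)"
    and Hf: "\<And>x. x \<in> ?S \<Longrightarrow> 0 < (\<Sum>i\<le>m. H x i * f x i)"
    and W: "finite \<W>" "\<And>W. W \<in> \<W> \<Longrightarrow> finite W \<and> card W \<le> m"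
    and HW: "\<And>x. x \<in> ?S \<Longrightarrow> x m = 0 \<Longrightarrow>
       \<exists>W\<in>\<W>. \<forall>c. (\<forall>w\<in>W. (\<Sum>i\<le>m. c i * w i) = 0) \<longrightarrow> (\<Sum>i\<le>m. c i * H x i) = 0"
    using equatorial_approximation[OF f(1,2,3)] by blast
  have HP: "H x \<in> punctured m" if "x \<in> ?S" for x
  proof -
    have "H x \<noteq> (\<lambda>i. 0)" using Hf[OF that] by auto
    then show ?thesis using H0[OF that] by (simp add: punctured_def)
  qed
  have "\<forall>W\<in>\<W>. \<exists>c. (\<exists>i\<le>m. c i \<noteq> 0) \<and> (\<forall>w\<in>W. (\<Sum>i\<le>m. c i * w i) = 0)"
    using W(2) exists_annihilator by blast
  then obtain c where c: "\<And>W. W \<in> \<W> \<Longrightarrow> \<exists>i\<le>m. c W i \<noteq> (0::real)"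
      "\<And>W w. W \<in> \<W> \<Longrightarrow> w \<in> W \<Longrightarrow> (\<Sum>i\<le>m. c W i * w i) = 0"
    by metis
  text \<open>The moment curve meets every hyperplane in finitely many points.\<close>
  have "finite {t. (\<Sum>i\<le>m. c W i * t ^ (m - i)) = 0}" if "W \<in> \<W>" for W
  proof -
    obtain i where "i \<le> m" "c W i \<noteq> 0" using c(1)[OF \<open>W \<in> \<W>\<close>] by auto
    then have "\<exists>i\<le>m. c W (m - i) \<noteq> 0" by (intro exI[of _ "m - i"]) auto
    then have "finite {t. (\<Sum>i\<le>m. c W (m - i) * t ^ i) = 0}" by (subst polyfun_finite_roots) auto
    moreover have "(\<Sum>i\<le>m. c W (m - i) * t ^ i) = (\<Sum>i\<le>m. c W i * t ^ (m - i))" for t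
      by (rule sum.reindex_bij_witness[of _ "\<lambda>i. m - i" "\<lambda>i. m - i"]) auto
    ultimately show ?thesis by simp
  qed
  then have "finite (\<Union>W\<in>\<W>. {t. (\<Sum>i\<le>m. c W i * t ^ (m - i)) = 0})" using W(1) by auto
  then obtain t where t: "t \<notin> (\<Union>W\<in>\<W>. {t. (\<Sum>i\<le>m. c W i * t ^ (m - i)) = 0})"
    using ex_new_if_finite infinite_UNIV_char_0 by blast
  \<comment> \<open>The exponents are reversed to make the last coordinate of \<open>y\<close> equal
    to 1, which the shear \<open>h1\<close> uses to clear multiples of \<open>y\<close>.\<close>
  define y where "y = (\<lambda>i. t ^ (m - i))"
  have ym: "y m = 1" by (simp add: y_def)
  \<comment> \<open>By the choice of \<open>t\<close>, some \<open>c V\<close> annihilates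
    \<open>H x\<close> but not \<open>y\<close>. So if \<open>H x\<close> were on the line through
    \<open>y\<close>, it would be 0.\<close>
  have Hy: "\<not> (\<forall>i\<le>m. H x i = r * y i)" if x: "x \<in> ?S" "x m = 0" for x r
  proof
    assume r: "\<forall>i\<le>m. H x i = r * y i"
    obtain V where V: "V \<in> \<W>" "\<And>c. (\<forall>w\<in>V. (\<Sum>i\<le>m. c i * w i) = 0) \<Longrightarrow> (\<Sum>i\<le>m. c i * H x i) = 0"
      using HW[OF x] by blast
    have "(\<Sum>i\<le>m. c V i * H x i) = 0" using V c(2) by blast
    also have "(\<Sum>i\<le>m. c V i * H x i) = r * (\<Sum>i\<le>m. c V i * y i)"
      using r by (simp add: sum_distrib_left mult_ac)
    finally have "r = 0" using t V(1) by (auto simp: y_def)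
    then have "H x = (\<lambda>i. 0)" using r H0[OF x(1)] by (auto simp: fun_eq_iff) (metis not_le)
    then show False using Hf[OF x(1)] by simp
  qed
  have Hi: "continuous_on ?S (\<lambda>x. H x i)" for i
    by (rule continuous_on_product_then_coordinatewise[OF Hc])
  have Hsnd: "continuous_on ({0..1::real} \<times> ?S) (\<lambda>z. H (snd z) i)" for i
    by (rule continuous_on_compose2[OF Hi continuous_on_snd[OF continuous_on_id]]) auto
  have csnd: "continuous_on ({0..1::real} \<times> ?S) (\<lambda>z. snd z i)" for i
    by (rule continuous_on_compose2[OF continuous_on_component continuous_on_snd[OF continuous_on_id]]) auto

  \<comment> \<open>At \<open>s = 1\<close> the coordinates below \<open>m\<close> all vanish
    exactly when \<open>H x\<close> is a multiple of \<open>y\<close>: the line through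
    \<open>y\<close> has been sheared to the polar axis.\<close>
  define h1 where "h1 = (\<lambda>(s::real, x) i. if i < m then H x i - s * H x m * y i else H x i)"
  have h1c: "continuous_on ({0..1} \<times> ?S) h1"
  proof (intro continuous_on_coordinatewise_then_product)
    fix i
    show "continuous_on ({0..1} \<times> ?S) (\<lambda>z. h1 z i)"
      unfolding h1_def split_def by (cases "i < m") (simp_all, intro continuous_intros Hsnd, rule Hsnd)
  qed
  have h1P: "h1 (s, x) \<in> punctured m" if x: "x \<in> ?S" for s x
  proof -
    have "h1 (s, x) \<noteq> (\<lambda>i. 0)"
    proof
      assume z: "h1 (s, x) = (\<lambda>i. 0)"
      have "H x m = 0" using fun_cong[OF z, of m] by (simp add: h1_def)
      then have "H x i = 0" for i using fun_cong[OF z, of i] unfolding h1_def split_conv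
        by (cases "i < m") simp_all
      then have "(\<Sum>i\<le>m. H x i * f x i) = 0" by simp
      then show False using Hf[OF x] by simp
    qed
    then show ?thesis using H0[OF x] by (auto simp: punctured_def h1_def)
  qed
  define G where "G = (\<lambda>x. h1 (1, x))"
  have Gz: "x m \<noteq> 0 \<and> G x m \<noteq> 0" if x: "x \<in> ?S" and z: "\<And>i. i < m \<Longrightarrow> G x i = 0" for x
  proof -
    have H: "\<forall>i\<le>m. H x i = H x m * y i"
    proof (intro allI impI)
      fix i assume "i \<le> m"
      then consider "i < m" | "i = m" by linarith
      then show "H x i = H x m * y i"
      proof cases
        case 1
        have "G x i = H x i - H x m * y i" using 1 by (simp add: G_def h1_def)
        then show ?thesis using z[OF 1] by linarith
      qed (simp add: ym)
    qed
    have "x m \<noteq> 0" using notE[OF Hy[OF x] H] by (rule notI)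
    moreover have "H x m \<noteq> 0"
    proof
      assume "H x m = 0"
      then have "H x i = 0" if "i \<le> m" for i using H[rule_format, OF that] by simp
      then have "(\<Sum>i\<le>m. H x i * f x i) = 0" by simp
      then show False using Hf[OF x] by simp
    qed
    ultimately show ?thesis by (simp add: G_def h1_def)
  qed
  \<comment> \<open>The factor of the last coordinate ends at \<open>\<bar>x m\<bar>\<close>. It
    vanishes only on the equator, where the other coordinates of \<open>G x\<close> are not all 0 by
    \<open>Gz\<close>, and it is even in \<open>x\<close>, so the end map is still odd.\<close>
  define h2 where "h2 = (\<lambda>(s::real, x) i. if i = m then G x m * (1 - s + s * \<bar>x m\<bar>) else G x i)"
  have Gsnd: "continuous_on ({0..1} \<times> ?S) (\<lambda>z. G (snd z) i)" for i
  proof -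
    have "continuous_on ?S (\<lambda>x. G x i)"
      unfolding G_def h1_def split_def
      by (cases "i < m") (simp_all, intro continuous_intros Hi, rule Hi)
    then show ?thesis
      by (rule continuous_on_compose2[OF _ continuous_on_snd[OF continuous_on_id]]) auto
  qed
  have h2c: "continuous_on ({0..1} \<times> ?S) h2"
  proof (intro continuous_on_coordinatewise_then_product)
    fix i
    show "continuous_on ({0..1} \<times> ?S) (\<lambda>z. h2 z i)"
      unfolding h2_def split_def
      by (cases "i = m") (simp_all, intro continuous_intros Gsnd csnd, rule Gsnd)
  qed
  have h2P: "h2 (s, x) \<in> punctured m" if x: "x \<in> ?S" and s: "0 \<le> s" "s \<le> 1" for s x
  proof -
    have "h2 (s, x) \<noteq> (\<lambda>i. 0)"
    proof
      assume z: "h2 (s, x) = (\<lambda>i. 0)"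
      have "G x i = 0" if "i < m" for i using fun_cong[OF z, of i] that by (simp add: h2_def)
      then have n: "x m \<noteq> 0" "G x m \<noteq> 0" using Gz[OF x] by auto
      have "0 < 1 - s + s * \<bar>x m\<bar>" using n s by (cases "s = 1") (auto intro: add_pos_nonneg)
      then show False using fun_cong[OF z, of m] n by (simp add: h2_def)
    qed
    moreover have "G x i = 0" if "i > m" for i using H0[OF x that] that by (simp add: G_def h1_def)
    ultimately show ?thesis by (auto simp: punctured_def h2_def)
  qed
  define g where "g = (\<lambda>x. h2 (1, x))"
  have gc: "continuous_on ?S g"
  proof -
    have "continuous_on ?S (\<lambda>x. (1::real, x))" by (intro continuous_intros)
    then show ?thesis unfolding g_def by (rule continuous_on_compose2[OF h2c]) auto
  qed
  have gP: "g ` ?S \<subseteq> punctured m" using h2P by (auto simp: g_def)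
  have godd: "g (\<lambda>i. - x i) = (\<lambda>i. - g x i)" if "x \<in> ?S" for x
    unfolding g_def h2_def G_def h1_def split_conv Hodd[OF that] by (rule ext) simp
  have g0: "g x m = 0" if "x m = 0" for x using that by (simp add: g_def h2_def)

  have "punctured_degree m f = punctured_degree m H"
    using f H0 Hf Hc by (intro punctured_degree_straight_line) auto
  also have "\<dots> = punctured_degree m (\<lambda>x. h1 (0, x))"
    by (intro punctured_degree_cong) (auto simp: h1_def)
  also have "\<dots> = punctured_degree m (\<lambda>x. h1 (1, x))"
    by (intro punctured_degree_homotopic h1c) (use h1P in auto)
  also have "\<dots> = punctured_degree m (\<lambda>x. h2 (0, x))"
    by (intro punctured_degree_cong) (auto simp: h2_def G_def)
  also have "\<dots> = punctured_degree m (\<lambda>x. h2 (1, x))"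
    by (intro punctured_degree_homotopic h2c) (use h2P in auto)
  finally have 1: "punctured_degree m f = punctured_degree m g" by (simp add: g_def)
  have 2: "even (punctured_degree m g - punctured_degree (m - 1) g)"
    using godd g0 by (intro punctured_degree_step gc gP) (simp_all add: m_def)
  have sub: "x \<in> ?S" "x m = 0" if "x \<in> unit_sphere l" for x
    using that by (auto simp: unit_sphere_def m_def)
  have 3: "odd (punctured_degree l g)"
  proof (rule Suc.IH)
    show "continuous_on (unit_sphere l) g" using gc by (rule continuous_on_subset) (use sub in auto)
    show "g ` unit_sphere l \<subseteq> punctured l"
    proof safe
      fix x assume x: "x \<in> unit_sphere l"
      have "g x \<in> punctured m" "g x m = 0" using gP g0 sub[OF x] by auto
      then show "g x \<in> punctured l"
        by (auto simp: punctured_def m_def) (metis Suc_lessI)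
    qed
    show "g (\<lambda>i. - x i) = (\<lambda>i. - g x i)" if "x \<in> unit_sphere l" for x using godd sub[OF that] by auto
  qed
  show ?case using 1 2 3 by (simp add: m_def)
qed

text \<open>If \<open>g\<close> had no zero, its normalisation would be an odd self-map of the
  sphere with values in the equator. Missing the pole \<open>e\<close>, it would have degree 0,
  which is even.\<close>

theorem Borsuk_Ulam:
  assumes g: "continuous_on (unit_sphere m) g"
    and odd: "\<And>x. x \<in> unit_sphere m \<Longrightarrow> g (\<lambda>i. - x i) = (\<lambda>i. - g x i)"
    and 0: "\<And>x i. x \<in> unit_sphere m \<Longrightarrow> i \<ge> m \<Longrightarrow> g x i = (0::real)"
  obtains x where "x \<in> unit_sphere m" "g x = (\<lambda>i. 0)"
proof (rule ccontr)
  assume "\<not> thesis"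
  then have P: "g ` unit_sphere m \<subseteq> punctured m" using that 0 by (auto simp: punctured_def)
  define e where "e = (\<lambda>i. if i = m then 1 else 0 :: real)"
  have "(\<Sum>i\<le>m. (e i)\<^sup>2) = (\<Sum>i\<le>m. if i = m then 1 else 0)"
    by (rule sum.cong) (auto simp: e_def)
  then have e: "e \<in> unit_sphere m" by (simp add: e_def unit_sphere_def)
  have "e \<notin> (\<lambda>x. normalise m (g x)) ` unit_sphere m"
  proof
    assume "e \<in> (\<lambda>x. normalise m (g x)) ` unit_sphere m"
    then obtain x where "x \<in> unit_sphere m" "e = normalise m (g x)" by blast
    then have "e m = 0" using 0 by (simp add: normalise_def)
    then show False by (simp add: e_def)
  qed
  with e have ne: "(\<lambda>x. normalise m (g x)) ` topspace (nsphere m) \<noteq> topspace (nsphere m)"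
    unfolding topspace_nsphere_eq by metis
  have "continuous_map (nsphere m) (nsphere m) (\<lambda>x. normalise m (g x))"
    unfolding nsphere_eq using continuous_on_normalise[OF g P] P normalise_in_sphere by auto
  then have "punctured_degree m g = 0"
    unfolding punctured_degree_def using ne by (rule Brouwer_degree2_nonsurjective)
  then show False using odd_map_odd_degree[OF g P odd] by simp
qed

subsection \<open>Calculus of smooth functions\<close>

lemma Ck_on_cong:
  fixes f g :: "'a::real_normed_vector \<Rightarrow> 'b::real_normed_vector"
  assumes "open U"
  shows "(\<And>x. x \<in> U \<Longrightarrow> f x = g x) \<Longrightarrow> Ck_on k f U \<Longrightarrow> Ck_on k g U"
proof (induction k arbitrary: f g)
  case 0
  have "continuous_on U f = continuous_on U g" by (rule continuous_on_cong[OF refl 0(1)])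
  then show ?case using 0(2) by simp
next
  case (Suc k)
  have d: "(g has_derivative frechet_derivative f (at x)) (at x)" if x: "x \<in> U" for x
  proof (rule has_derivative_transform_within_open[OF _ \<open>open U\<close> x])
    show "(f has_derivative frechet_derivative f (at x)) (at x)"
      using Suc.prems(2) x by (simp add: frechet_derivative_works[symmetric])
  qed (use Suc.prems in auto)
  have e: "frechet_derivative f (at x) = frechet_derivative g (at x)" if "x \<in> U" for x
    using d[OF that] by (rule frechet_derivative_at)
  have "Ck_on k (\<lambda>x. frechet_derivative g (at x) v) U" for v
  proof (rule Suc.IH)
    show "Ck_on k (\<lambda>x. frechet_derivative f (at x) v) U" using Suc.prems(2) by simp
  qed (simp add: e)
  moreover have "\<forall>x\<in>U. g differentiable (at x)" using d differentiableI by blast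
  ultimately show ?case by simp
qed

text \<open>Allows an explicit derivative in place of \<open>frechet_derivative\<close>; openness of
  \<open>U\<close> lets \<open>Ck_on_cong\<close> replace one by the other.\<close>

lemma Ck_on_SucI:
  assumes "open U" and d: "\<And>x. x \<in> U \<Longrightarrow> (f has_derivative D x) (at x)"
    and D: "\<And>v. Ck_on k (\<lambda>x. D x v) U"
  shows "Ck_on (Suc k) f U"
proof -
  have "D x = frechet_derivative f (at x)" if "x \<in> U" for x
    using d[OF that] by (rule frechet_derivative_at)
  then have "Ck_on k (\<lambda>x. frechet_derivative f (at x) v) U" for v
    by (intro Ck_on_cong[OF \<open>open U\<close> _ D]) simp
  moreover have "\<forall>x\<in>U. f differentiable (at x)" using d differentiableI by blast
  ultimately show ?thesis by simp
qed

lemma Ck_on_has_derivative: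
  "Ck_on (Suc k) f U \<Longrightarrow> x \<in> U \<Longrightarrow> (f has_derivative frechet_derivative f (at x)) (at x)"
  by (simp add: frechet_derivative_works[symmetric])

lemma Ck_on_SucD: "Ck_on (Suc k) f U \<Longrightarrow> Ck_on k f U"
proof (induction k arbitrary: f)
  case 0
  then show ?case
    by (simp add: continuous_at_imp_continuous_on differentiable_imp_continuous_within)
qed simp

lemma Ck_on_const: "Ck_on k (\<lambda>x. c) U"
proof (induction k arbitrary: c)
  case (Suc k)
  have "frechet_derivative (\<lambda>x::'a. c) (at x) = (\<lambda>_. 0)" for x
    by (rule frechet_derivative_at[symmetric]) (rule has_derivative_const)
  then show ?case using Suc by simp
qed auto

lemma Ck_on_linear:
  assumes "bounded_linear L" "open U"
  shows "Ck_on k f U \<Longrightarrow> Ck_on k (\<lambda>x. L (f x)) U"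
proof (induction k arbitrary: f)
  case 0
  then show ?case using assms(1) by (simp add: bounded_linear.continuous_on)
next
  case (Suc k)
  show ?case
  proof (rule Ck_on_SucI[OF \<open>open U\<close>])
    show "((\<lambda>x. L (f x)) has_derivative (\<lambda>v. L (frechet_derivative f (at x) v))) (at x)" if "x \<in> U" for x
      by (rule bounded_linear.has_derivative[OF assms(1) Ck_on_has_derivative[OF Suc.prems that]])
  qed (use Suc in auto)
qed

lemma Ck_on_add:
  assumes "open U"
  shows "Ck_on k f U \<Longrightarrow> Ck_on k g U \<Longrightarrow> Ck_on k (\<lambda>x. f x + g x) U"
proof (induction k arbitrary: f g)
  case 0
  then show ?case by (simp add: continuous_on_add)
next
  case (Suc k)
  show ?case
  proof (rule Ck_on_SucI[OF \<open>open U\<close>])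
    show "((\<lambda>x. f x + g x) has_derivative
        (\<lambda>v. frechet_derivative f (at x) v + frechet_derivative g (at x) v)) (at x)" if "x \<in> U" for x
      by (intro has_derivative_add Ck_on_has_derivative[OF Suc.prems(1) that] Ck_on_has_derivative[OF Suc.prems(2) that])
  qed (use Suc in auto)
qed

lemma Ck_on_mult:
  fixes f g :: "'a::real_normed_vector \<Rightarrow> 'b::real_normed_algebra"
  assumes "open U"
  shows "Ck_on k f U \<Longrightarrow> Ck_on k g U \<Longrightarrow> Ck_on k (\<lambda>x. f x * g x) U"
proof (induction k arbitrary: f g)
  case 0
  then show ?case by (simp add: continuous_on_mult)
next
  case (Suc k)
  show ?case
  proof (rule Ck_on_SucI[OF \<open>open U\<close>])
    show "((\<lambda>x. f x * g x) has_derivative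
        (\<lambda>v. f x * frechet_derivative g (at x) v + frechet_derivative f (at x) v * g x)) (at x)" if "x \<in> U" for x
      by (intro has_derivative_mult Ck_on_has_derivative[OF Suc.prems(1) that] Ck_on_has_derivative[OF Suc.prems(2) that])
    show "Ck_on k (\<lambda>x. f x * frechet_derivative g (at x) v + frechet_derivative f (at x) v * g x) U" for v
      by (intro Ck_on_add[OF \<open>open U\<close>] Suc.IH Ck_on_SucD[OF Suc.prems(1)] Ck_on_SucD[OF Suc.prems(2)])
        (use Suc.prems in auto)
  qed
qed

text \<open>For a fixed direction the derivative is again a function composed with the same affine
  map, so the induction closes. This special case stands in for the general chain rule.\<close>

lemma Ck_on_affine:
  assumes L: "bounded_linear L" and "open U"
  shows "Ck_on k g UNIV \<Longrightarrow> Ck_on k (\<lambda>t. g (a + L t)) U"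
proof (induction k arbitrary: g)
  case 0
  then show ?case
    by (auto intro!: continuous_on_compose2[of UNIV g] continuous_intros bounded_linear.continuous_on[OF L])
next
  case (Suc k)
  show ?case
  proof (rule Ck_on_SucI[OF \<open>open U\<close>])
    show "((\<lambda>t. g (a + L t)) has_derivative (\<lambda>s. frechet_derivative g (at (a + L t)) (L s))) (at t)" for t
    proof (rule has_derivative_compose[where f="\<lambda>t. a + L t"])
      show "((\<lambda>t. a + L t) has_derivative L) (at t)"
        using has_derivative_add[OF has_derivative_const bounded_linear_imp_has_derivative[OF L]] by simp
    qed (rule Ck_on_has_derivative[OF Suc.prems], simp)
    show "Ck_on k (\<lambda>t. frechet_derivative g (at (a + L t)) (L s)) U" for s
      using Suc.prems by (intro Suc.IH[of "\<lambda>x. frechet_derivative g (at x) (L s)"]) simp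
  qed
qed

lemma Ck_on_subset: "Ck_on k f U \<Longrightarrow> V \<subseteq> U \<Longrightarrow> Ck_on k f V"
  by (induction k arbitrary: f) (auto intro: continuous_on_subset)

lemma smooth_on_subset: "smooth_on U f \<Longrightarrow> V \<subseteq> U \<Longrightarrow> smooth_on V f"
  by (auto simp: smooth_on_def intro: Ck_on_subset)

lemma smooth_on_const: "smooth_on U (\<lambda>x. c)"
  by (simp add: smooth_on_def Ck_on_const)

lemma smooth_on_linear: "bounded_linear L \<Longrightarrow> open U \<Longrightarrow> smooth_on U f \<Longrightarrow> smooth_on U (\<lambda>x. L (f x))"
  by (simp add: smooth_on_def Ck_on_linear)

lemma smooth_on_add: "open U \<Longrightarrow> smooth_on U f \<Longrightarrow> smooth_on U g \<Longrightarrow> smooth_on U (\<lambda>x. f x + g x)"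
  by (simp add: smooth_on_def Ck_on_add)

lemma smooth_on_mult:
  "open U \<Longrightarrow> smooth_on U f \<Longrightarrow> smooth_on U g \<Longrightarrow> smooth_on U (\<lambda>x. f x * g x :: 'b::real_normed_algebra)"
  by (simp add: smooth_on_def Ck_on_mult)

lemma smooth_on_affine: "bounded_linear L \<Longrightarrow> open U \<Longrightarrow> smooth_on UNIV g \<Longrightarrow> smooth_on U (\<lambda>t. g (a + L t))"
  by (simp add: smooth_on_def Ck_on_affine)

lemma smooth_on_id: "smooth_on U (\<lambda>x. x)"
  unfolding smooth_on_def
proof
  fix k show "Ck_on k (\<lambda>x. x) U"
    by (cases k) (auto simp: Ck_on_const)
qed

lemma smooth_on_sum:
  "open U \<Longrightarrow> (\<And>i. i \<in> I \<Longrightarrow> smooth_on U (f i)) \<Longrightarrow> smooth_on U (\<lambda>x. \<Sum>i\<in>I. f i x)"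
  by (induction I rule: infinite_finite_induct) (auto intro!: smooth_on_const smooth_on_add)

lemma smooth_on_prod:
  fixes f :: "'i \<Rightarrow> 'a::real_normed_vector \<Rightarrow> 'b::{real_normed_algebra, comm_ring_1}"
  shows "open U \<Longrightarrow> (\<And>i. i \<in> I \<Longrightarrow> smooth_on U (f i)) \<Longrightarrow> smooth_on U (\<lambda>x. \<Prod>i\<in>I. f i x)"
  by (induction I rule: infinite_finite_induct) (auto intro!: smooth_on_const smooth_on_mult)

lemma smooth_on_has_derivative:
  "smooth_on U f \<Longrightarrow> x \<in> U \<Longrightarrow> (f has_derivative frechet_derivative f (at x)) (at x)"
  using Ck_on_has_derivative[of 0] unfolding smooth_on_def by blast

lemma smooth_on_continuous: "smooth_on U f \<Longrightarrow> continuous_on U f"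
  unfolding smooth_on_def by (metis Ck_on.simps(1))

lemma smooth_on_continuous_derivative:
  "smooth_on U f \<Longrightarrow> continuous_on U (\<lambda>x. frechet_derivative f (at x) v)"
  unfolding smooth_on_def using Ck_on.simps(2)[of 0 f U] by auto


subsection \<open>Smooth cutoff functions\<close>

text \<open>The family is closed under differentiation, \<open>P\<close> being replaced by
  \<open>X^2 (P - P')\<close>, which makes smoothness a plain induction.\<close>

definition flat_poly_exp :: "real poly \<Rightarrow> real \<Rightarrow> real" where
  "flat_poly_exp P x = (if x > 0 then poly P (1 / x) * exp (- 1 / x) else 0)"

lemma poly_div_exp_tendsto_0: "((\<lambda>s. poly P s / exp s) \<longlongrightarrow> 0) at_top" for P :: "real poly"
proof -
  have "((\<lambda>s. \<Sum>i\<le>Polynomial.degree P. Polynomial.coeff P i * (s ^ i / exp s)) \<longlongrightarrow> (\<Sum>i\<le>Polynomial.degree P. Polynomial.coeff P i * 0)) at_top"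
    by (intro tendsto_intros tendsto_power_div_exp_0)
  then show ?thesis by (simp add: poly_altdef sum_divide_distrib)
qed

lemma flat_poly_exp_deriv:
  "(flat_poly_exp P has_real_derivative flat_poly_exp ([:0, 0, 1:] * (P - pderiv P)) x) (at x)"
proof -
  consider "x > 0" | "x < 0" | "x = 0" by linarith
  then show ?thesis
  proof cases
    case 1
    have "((\<lambda>x. poly P (1 / x) * exp (- 1 / x)) has_real_derivative
        flat_poly_exp ([:0, 0, 1:] * (P - pderiv P)) x) (at x)"
      using 1 by (auto simp: flat_poly_exp_def field_simps power2_eq_square intro!: derivative_eq_intros)
    then show ?thesis
      by (rule has_field_derivative_transform_within_open[OF _ open_greaterThan[of 0]])
        (use 1 in \<open>auto simp: flat_poly_exp_def\<close>)
  next
    case 2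
    have "((\<lambda>x. 0) has_real_derivative flat_poly_exp ([:0, 0, 1:] * (P - pderiv P)) x) (at x)"
      using 2 by (simp add: flat_poly_exp_def)
    then show ?thesis
      by (rule has_field_derivative_transform_within_open[OF _ open_lessThan[of 0]])
        (use 2 in \<open>auto simp: flat_poly_exp_def\<close>)
  next
    case 3
    \<comment> \<open>The right difference quotient at 0 is \<open>P(1/h) exp(-1/h) / h\<close>; the
      factor \<open>1/h\<close> is absorbed by \<open>pCons 0 P\<close>, which multiplies by the
      variable.\<close>
    have "((\<lambda>s. poly (pCons 0 P) s / exp s) \<longlongrightarrow> 0) at_top" by (rule poly_div_exp_tendsto_0)
    then have "((\<lambda>h. poly (pCons 0 P) (inverse h) / exp (inverse h)) \<longlongrightarrow> 0) (at_right 0)"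
      by (rule filterlim_compose[OF _ filterlim_inverse_at_top_right])
    then have "((\<lambda>h. (flat_poly_exp P h - flat_poly_exp P 0) / (h - 0)) \<longlongrightarrow> 0) (at_right 0)"
      by (rule Lim_transform_eventually)
        (auto simp: flat_poly_exp_def eventually_at_right_field exp_minus inverse_eq_divide intro!: exI[of _ 1])
    moreover have "((\<lambda>h. (flat_poly_exp P h - flat_poly_exp P 0) / (h - 0)) \<longlongrightarrow> 0) (at_left 0)"
      by (rule tendsto_eventually) (auto simp: flat_poly_exp_def eventually_at_left_field intro!: exI[of _ "-1"])
    ultimately have "((\<lambda>h. (flat_poly_exp P h - flat_poly_exp P 0) / (h - 0)) \<longlongrightarrow> 0) (at 0)"
      by (simp add: filterlim_split_at_real)
    then show ?thesis using 3 by (simp add: has_field_derivative_iff flat_poly_exp_def)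
  qed
qed

lemma smooth_flat_poly_exp: "smooth_on UNIV (flat_poly_exp P)"
  unfolding smooth_on_def
proof
  fix k show "Ck_on k (flat_poly_exp P) UNIV"
  proof (induction k arbitrary: P)
    case 0
    have "continuous_on UNIV (flat_poly_exp P)"
      by (rule DERIV_continuous_on) (rule flat_poly_exp_deriv)
    then show ?case by simp
  next
    case (Suc k)
    show ?case
    proof (rule Ck_on_SucI)
      show "(flat_poly_exp P has_derivative (\<lambda>v. flat_poly_exp ([:0, 0, 1:] * (P - pderiv P)) x * v)) (at x)" for x
        using flat_poly_exp_deriv[of P x] by (simp add: has_field_derivative_def)
      show "Ck_on k (\<lambda>x. flat_poly_exp ([:0, 0, 1:] * (P - pderiv P)) x * v) UNIV" for v
        by (intro Ck_on_mult Ck_on_const Suc) simp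
    qed simp
  qed
qed

definition flat_exp :: "real \<Rightarrow> real" where "flat_exp x = (if x > 0 then exp (- 1 / x) else 0)"

definition flat_exp' :: "real \<Rightarrow> real" where "flat_exp' x = (if x > 0 then exp (- 1 / x) / x\<^sup>2 else 0)"

lemma flat_exp_eq: "flat_exp = flat_poly_exp 1"
  by (auto simp: flat_exp_def flat_poly_exp_def)

lemma smooth_flat_exp: "smooth_on UNIV flat_exp"
  unfolding flat_exp_eq by (rule smooth_flat_poly_exp)

lemma flat_exp_deriv: "(flat_exp has_real_derivative flat_exp' x) (at x)"
proof -
  have "flat_poly_exp ([:0, 0, 1:] * (1 - pderiv 1)) x = flat_exp' x"
    by (simp add: flat_exp'_def flat_poly_exp_def power2_eq_square)
  then show ?thesis using flat_poly_exp_deriv[of 1 x] by (simp add: flat_exp_eq)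
qed

lemma flat_exp_bounds: "0 \<le> flat_exp x" "flat_exp x \<le> 1" "0 \<le> flat_exp' x" "flat_exp' x \<le> 2"
proof -
  show "0 \<le> flat_exp x" "flat_exp x \<le> 1" "0 \<le> flat_exp' x" by (auto simp: flat_exp_def flat_exp'_def)
  show "flat_exp' x \<le> 2"
  proof (cases "x > 0")
    case True
    \<comment> \<open>The bound 2 comes from \<open>s^2 / 2 \<le> exp s\<close> at
      \<open>s = 1 / x\<close>.\<close>
    have "(1 / x)\<^sup>2 / 2 \<le> exp (1 / x)"
      using exp_lower_Taylor_quadratic[of "1 / x"] True by (smt (verit) zero_le_divide_1_iff)
    then have "(1 / x)\<^sup>2 / exp (1 / x) \<le> 2" by (subst pos_divide_le_eq) auto
    also have "(1 / x)\<^sup>2 / exp (1 / x) = flat_exp' x"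
      using True by (simp add: flat_exp'_def power_divide exp_minus field_simps)
    finally show ?thesis .
  qed (simp add: flat_exp'_def)
qed

text \<open>In units of the cell side the cell is [0, 1]. The bump lives on (-2, 3) and has no
  plateau: a lower bound on [-1, 2], the cell with its neighbours, is all that the denominators
  require.\<close>

definition cutoff1 :: "real \<Rightarrow> real" where "cutoff1 s = flat_exp (s + 2) * flat_exp (3 - s)"

definition cutoff1' :: "real \<Rightarrow> real" where
  "cutoff1' s = flat_exp' (s + 2) * flat_exp (3 - s) - flat_exp (s + 2) * flat_exp' (3 - s)"

lemma cutoff1_deriv: "(cutoff1 has_real_derivative cutoff1' s) (at s)"
proof -
  have "((\<lambda>s. flat_exp (s + 2) * flat_exp (3 - s)) has_real_derivative cutoff1' s) (at s)"
    unfolding cutoff1'_def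
    by (rule derivative_eq_intros DERIV_chain'[OF _ flat_exp_deriv] refl | simp)+
  then show ?thesis by (simp add: cutoff1_def[abs_def])
qed

lemma smooth_cutoff1: "smooth_on UNIV cutoff1"
proof -
  have "smooth_on UNIV (\<lambda>s. flat_exp (2 + s) * flat_exp (3 + - s))"
    by (intro smooth_on_mult smooth_on_affine[OF _ _ smooth_flat_exp, where L="\<lambda>s. s"]
        smooth_on_affine[OF _ _ smooth_flat_exp, where L="\<lambda>s. - s"] bounded_linear_minus bounded_linear_ident) auto
  then show ?thesis by (simp add: cutoff1_def[abs_def] add.commute)
qed

lemma cutoff1_bounds: "0 \<le> cutoff1 s" "cutoff1 s \<le> 1" "\<bar>cutoff1' s\<bar> \<le> 4"
proof -
  show "0 \<le> cutoff1 s" "cutoff1 s \<le> 1"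
    using flat_exp_bounds by (auto simp: cutoff1_def intro: mult_le_one)
  have "\<bar>flat_exp' (s + 2) * flat_exp (3 - s)\<bar> \<le> 2 * 1" "\<bar>flat_exp (s + 2) * flat_exp' (3 - s)\<bar> \<le> 1 * 2"
    unfolding abs_mult by (intro mult_mono; use flat_exp_bounds in auto)+
  then show "\<bar>cutoff1' s\<bar> \<le> 4" unfolding cutoff1'_def by linarith
qed

lemma cutoff1_lower: "-1 \<le> s \<Longrightarrow> s \<le> 2 \<Longrightarrow> exp (-2) \<le> cutoff1 s"
proof -
  assume s: "-1 \<le> s" "s \<le> 2"
  have "exp (-1) \<le> flat_exp (s + 2)" "exp (-1) \<le> flat_exp (3 - s)"
    using s by (auto simp: flat_exp_def field_simps)
  then have "exp (-1) * exp (-1) \<le> cutoff1 s"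
    unfolding cutoff1_def by (intro mult_mono) (auto simp: flat_exp_bounds)
  then show ?thesis by (simp flip: exp_add)
qed

lemma cutoff1_outside: "s \<le> -2 \<or> 3 \<le> s \<Longrightarrow> cutoff1 s = 0 \<and> cutoff1' s = 0"
  by (auto simp: cutoff1_def cutoff1'_def flat_exp_def flat_exp'_def)

definition cube_cutoff :: "real \<Rightarrow> real ^ 'n \<Rightarrow> real ^ 'n \<Rightarrow> real" where
  "cube_cutoff r z x = (\<Prod>i\<in>UNIV. cutoff1 (x $ i / r - z $ i))"

definition gradient :: "('a::euclidean_space \<Rightarrow> real) \<Rightarrow> 'a \<Rightarrow> 'a" where
  "gradient f x = (\<Sum>b\<in>Basis. frechet_derivative f (at x) b *\<^sub>R b)"

lemma gradient_inner:
  assumes "(f has_derivative D) (at x)"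
  shows "gradient f x \<bullet> v = D v"
proof -
  have D: "frechet_derivative f (at x) = D" using frechet_derivative_at[OF assms] by simp
  have "D v = D (\<Sum>b\<in>Basis. (v \<bullet> b) *\<^sub>R b)" by (simp add: euclidean_representation)
  also have "\<dots> = (\<Sum>b\<in>Basis. (v \<bullet> b) * D b)"
    using has_derivative_linear[OF assms] by (simp add: linear_sum linear_scale)
  also have "\<dots> = gradient f x \<bullet> v"
    by (simp add: gradient_def D inner_sum_left) (simp add: inner_commute mult.commute)
  finally show ?thesis by simp
qed

lemma gradient_eqI:
  assumes "(f has_derivative D) (at x)" "\<And>v. w \<bullet> v = D v"
  shows "gradient f x = w"
  using gradient_inner[OF assms(1)] assms(2) by (metis vector_eq_rdot)

lemma smooth_cube_cutoff: "smooth_on UNIV (cube_cutoff r z)"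
proof -
  have "smooth_on UNIV (\<lambda>x. \<Prod>i\<in>UNIV. cutoff1 (- z $ i + x $ i / r))"
  proof (intro smooth_on_prod smooth_on_affine smooth_cutoff1)
    show "bounded_linear (\<lambda>x::real ^ 'a. x $ i / r)" for i
      by (rule bounded_linear_compose[OF bounded_linear_divide bounded_linear_vec_nth])
  qed auto
  then show ?thesis by (simp add: cube_cutoff_def[abs_def])
qed

lemma cube_cutoff_nonneg: "0 \<le> cube_cutoff r z x"
  by (simp add: cube_cutoff_def prod_nonneg cutoff1_bounds)

lemma cube_cutoff_lower:
  fixes x z :: "real ^ 'n"
  assumes "\<And>i. -1 \<le> x $ i / r - z $ i" "\<And>i. x $ i / r - z $ i \<le> 2"
  shows "exp (-2) ^ CARD('n) \<le> cube_cutoff r z x"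
proof -
  have "(\<Prod>i\<in>(UNIV::'n set). exp (-2)) \<le> cube_cutoff r z x"
    unfolding cube_cutoff_def using assms by (intro prod_mono) (auto intro: cutoff1_lower)
  then show ?thesis by simp
qed

lemma cube_cutoff_derivative:
  fixes x z :: "real ^ 'n"
  shows "(cube_cutoff r z has_derivative
    (\<lambda>v. \<Sum>i\<in>UNIV. (v $ i / r * cutoff1' (x $ i / r - z $ i)) * (\<Prod>j\<in>UNIV - {i}. cutoff1 (x $ j / r - z $ j)))) (at x)"
  unfolding cube_cutoff_def[abs_def]
proof (rule has_derivative_prod)
  fix i
  have "bounded_linear (\<lambda>x::real ^ 'n. x $ i / r)"
    by (rule bounded_linear_compose[OF bounded_linear_divide bounded_linear_vec_nth])
  from has_derivative_diff[OF bounded_linear_imp_has_derivative[OF this] has_derivative_const[of "z $ i"]]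
  have "((\<lambda>x. x $ i / r - z $ i) has_derivative (\<lambda>v. v $ i / r)) (at x)" by simp
  from has_derivative_compose[OF this, of cutoff1 "(*) (cutoff1' (x $ i / r - z $ i))"]
    cutoff1_deriv[of "x $ i / r - z $ i"]
  show "((\<lambda>x. cutoff1 (x $ i / r - z $ i)) has_derivative (\<lambda>v. v $ i / r * cutoff1' (x $ i / r - z $ i))) (at x)"
    by (simp add: has_field_derivative_def mult.commute)
qed

text \<open>Testing the derivative on the gradient itself gives its squared norm as a sum of
  \<open>CARD('n)\<close> terms. Each is at most \<open>4 / r\<close> times the norm, because one
  factor is differentiated and the others are at most 1.\<close>

lemma norm_gradient_cube_cutoff:
  fixes x z :: "real ^ 'n"
  assumes "r > 0"
  shows "norm (gradient (cube_cutoff r z) x) \<le> 4 * real CARD('n) / r"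
proof -
  let ?g = "gradient (cube_cutoff r z) x"
  have "?g \<bullet> ?g = (\<Sum>i\<in>UNIV. (?g $ i / r * cutoff1' (x $ i / r - z $ i)) * (\<Prod>j\<in>UNIV - {i}. cutoff1 (x $ j / r - z $ j)))"
    by (rule gradient_inner[OF cube_cutoff_derivative])
  also have "\<dots> \<le> (\<Sum>i\<in>(UNIV::'n set). norm ?g / r * 4 * 1)"
  proof (rule sum_mono)
    fix i :: 'n
    let ?c = "cutoff1' (x $ i / r - z $ i)" and ?p = "\<Prod>j\<in>UNIV - {i}. cutoff1 (x $ j / r - z $ j)"
    have "?g $ i / r * ?c * ?p \<le> \<bar>?g $ i / r * ?c * ?p\<bar>" by (rule abs_ge_self)
    also have "\<dots> = \<bar>?g $ i / r\<bar> * \<bar>?c\<bar> * \<bar>?p\<bar>" by (simp only: abs_mult)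
    also have "\<dots> \<le> norm ?g / r * 4 * 1"
    proof (intro mult_mono)
      show "\<bar>?g $ i / r\<bar> \<le> norm ?g / r" using assms component_le_norm_cart[of ?g i] by (simp add: divide_right_mono)
      show "\<bar>?p\<bar> \<le> 1" unfolding abs_prod by (intro prod_le_1) (auto simp: cutoff1_bounds)
    qed (use assms cutoff1_bounds in auto)
    finally show "?g $ i / r * ?c * ?p \<le> norm ?g / r * 4 * 1" .
  qed
  finally have "norm ?g * norm ?g \<le> norm ?g * (4 * real CARD('n) / r)"
    by (simp add: dot_square_norm power2_eq_square mult_ac)
  then have "norm ?g \<le> 4 * real CARD('n) / r" if "norm ?g > 0"
    using that by (rule mult_left_le_imp_le)
  then show ?thesis using assms by (cases "norm ?g > 0") auto
qed

lemma cube_cutoff_outside: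
  fixes x z :: "real ^ 'n"
  assumes "x $ i / r - z $ i \<le> -2 \<or> 3 \<le> x $ i / r - z $ i"
  shows "cube_cutoff r z x = 0" "gradient (cube_cutoff r z) x = 0"
proof -
  note c = cutoff1_outside[OF assms]
  show "cube_cutoff r z x = 0" unfolding cube_cutoff_def using c by (intro prod_zero) auto
  show "gradient (cube_cutoff r z) x = 0"
  proof (rule gradient_eqI[OF cube_cutoff_derivative])
    fix v
    have "v $ j / r * cutoff1' (x $ j / r - z $ j) * (\<Prod>l\<in>UNIV - {j}. cutoff1 (x $ l / r - z $ l)) = 0" for j
    proof (cases "j = i")
      case False
      then have "(\<Prod>l\<in>UNIV - {j}. cutoff1 (x $ l / r - z $ l)) = 0" using c by (intro prod_zero) auto
      then show ?thesis by simp
    qed (use c in simp)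
    then show "0 \<bullet> v = (\<Sum>j\<in>UNIV. v $ j / r * cutoff1' (x $ j / r - z $ j) * (\<Prod>l\<in>UNIV - {j}. cutoff1 (x $ l / r - z $ l)))"
      by (simp only: sum.neutral_const inner_zero_left)
  qed
qed

subsection \<open>Gradients on a hypersurface\<close>

text \<open>\<open>g\<close> is defined on the whole space and constant along \<open>e\<close>, so
  that no separate space for the remaining coordinates is needed.\<close>

definition graph_chart :: "'a::euclidean_space set \<Rightarrow> 'a \<Rightarrow> real \<Rightarrow> 'a \<Rightarrow> ('a \<Rightarrow> real) \<Rightarrow> bool" where
  "graph_chart S x r e g \<longleftrightarrow> r > 0 \<and> norm e = 1 \<and> smooth_on UNIV g \<and> (\<forall>y t. g (y + t *\<^sub>R e) = g y) \<and>
     S \<inter> ball x r = {y \<in> ball x r. g y = y \<bullet> e}"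

definition smooth_hypersurface :: "'a::euclidean_space set \<Rightarrow> bool" where
  "smooth_hypersurface S \<longleftrightarrow> (\<forall>x\<in>S. \<exists>r e g. graph_chart S x r e g)"

text \<open>In the ball, \<open>g y < y \<bullet> e\<close> is an open condition that holds inside
  \<open>\<Omega>\<close>, and the reverse strict inequality an open condition that holds outside,
  so only the graph can be frontier. Conversely, a graph point moved slightly along \<open>e\<close>
  enters \<open>\<Omega>\<close>.\<close>

lemma smooth_boundary_imp_hypersurface:
  assumes "smooth_boundary \<Omega>"
  shows "smooth_hypersurface (frontier \<Omega>)"
  unfolding smooth_hypersurface_def
proof
  fix x assume "x \<in> frontier \<Omega>"
  then obtain r e g where r: "r > 0" and e: "norm e = 1" and g: "smooth_on UNIV g"
    and inv: "\<And>y t. g (y + t *\<^sub>R e) = g y"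
    and eq: "\<Omega> \<inter> ball x r = {y \<in> ball x r. (g y :: real) < y \<bullet> e}"
    using assms[unfolded smooth_boundary_def, rule_format, OF \<open>x \<in> frontier \<Omega>\<close>]
    by (elim exE conjE) (rule that; simp)
  note cg = smooth_on_continuous[OF g]
  have mem: "z \<in> \<Omega> \<longleftrightarrow> g z < z \<bullet> e" if "z \<in> ball x r" for z
    using that eq by blast
  have ee: "e \<bullet> e = 1" using e by (simp add: norm_eq_1)
  have "y \<in> frontier \<Omega> \<longleftrightarrow> g y = y \<bullet> e" if y: "y \<in> ball x r" for y
  proof
    assume fr: "y \<in> frontier \<Omega>"
    show "g y = y \<bullet> e"
    proof (rule ccontr)
      assume "g y \<noteq> y \<bullet> e"
      then consider "g y < y \<bullet> e" | "g y > y \<bullet> e" by linarith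
      then show False
      proof cases
        case 1
        have "open ({y. g y < y \<bullet> e} \<inter> ball x r)"
          by (intro open_Int open_Collect_less cg continuous_intros open_ball)
        moreover have "{y. g y < y \<bullet> e} \<inter> ball x r \<subseteq> \<Omega>" using mem by blast
        ultimately have "y \<in> interior \<Omega>" using 1 y by (intro interiorI[of "{y. g y < y \<bullet> e} \<inter> ball x r"]) auto
        then show False using fr by (simp add: frontier_def)
      next
        case 2
        have o: "open ({y. g y > y \<bullet> e} \<inter> ball x r)"
          by (intro open_Int open_Collect_less cg continuous_intros open_ball)
        have "\<Omega> \<inter> ({y. g y > y \<bullet> e} \<inter> ball x r) = {}"
        proof (rule equals0I)
          fix z assume "z \<in> \<Omega> \<inter> ({y. g y > y \<bullet> e} \<inter> ball x r)"
          then have "g z > z \<bullet> e" "g z < z \<bullet> e" using mem[of z] by blast+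
          then show False by simp
        qed
        moreover have "y \<in> {y. g y > y \<bullet> e} \<inter> ball x r" using 2 y by auto
        ultimately have "y \<notin> closure \<Omega>" using open_Int_closure_eq_empty[OF o, of \<Omega>] by auto
        then show False using fr by (simp add: frontier_def)
      qed
    qed
  next
    assume gy: "g y = y \<bullet> e"
    have "y \<notin> \<Omega>" using mem[OF y] gy by simp
    then have "y \<notin> interior \<Omega>" using interior_subset by auto
    moreover have "y \<in> closure \<Omega>"
      unfolding closure_approachable
    proof (intro allI impI)
      fix d :: real assume d: "d > 0"
      define s where "s = min (d / 2) ((r - dist x y) / 2)"
      have s: "s > 0" "s < d" "s < r - dist x y" using d y by (auto simp: s_def min_def)
      have "dist x (y + s *\<^sub>R e) \<le> dist x y + s"
        using dist_triangle[of x "y + s *\<^sub>R e" y] s(1) e by (simp add: dist_norm)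
      then have "y + s *\<^sub>R e \<in> ball x r" using s(3) by simp
      moreover have "g (y + s *\<^sub>R e) < (y + s *\<^sub>R e) \<bullet> e" using inv gy s(1) ee by (simp add: inner_add_left)
      ultimately have "y + s *\<^sub>R e \<in> \<Omega>" using eq by blast
      then show "\<exists>z\<in>\<Omega>. dist z y < d" using s e by (intro bexI[of _ "y + s *\<^sub>R e"]) (auto simp: dist_norm)
    qed
    ultimately show "y \<in> frontier \<Omega>" by (simp add: frontier_def)
  qed
  then have "frontier \<Omega> \<inter> ball x r = {y \<in> ball x r. g y = y \<bullet> e}" by blast
  then have "graph_chart (frontier \<Omega>) x r e g" using r e g inv by (simp add: graph_chart_def)
  then show "\<exists>r e g. graph_chart (frontier \<Omega>) x r e g" by blast
qed

lemma gradient_eq_frechet: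
  assumes "smooth_on UNIV f"
  shows "gradient f x \<bullet> v = frechet_derivative f (at x) v"
  by (rule gradient_inner[OF smooth_on_has_derivative[OF assms UNIV_I]])

lemma continuous_on_gradient: "smooth_on UNIV f \<Longrightarrow> continuous_on UNIV (gradient f)"
  unfolding gradient_def[abs_def]
  by (intro continuous_on_sum continuous_on_scaleR continuous_on_const smooth_on_continuous_derivative)

context
  fixes S :: "'a::euclidean_space set" and x e :: 'a and r :: real and g :: "'a \<Rightarrow> real"
  assumes chart: "graph_chart S x r e g"
begin

text \<open>The gradient of \<open>y \<bullet> e - g y\<close>, whose zero set is \<open>S\<close>
  in the chart; it is not scaled to unit length.\<close>

abbreviation (input) chart_normal :: "'a \<Rightarrow> 'a" where "chart_normal y \<equiv> e - gradient g y"

lemma chart_e: "e \<bullet> e = 1" and chart_smooth: "smooth_on UNIV g" and chart_inv: "g (y + t *\<^sub>R e) = g y"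
  using chart by (auto simp: graph_chart_def norm_eq_1)

lemma chart_S: "y \<in> ball x r \<Longrightarrow> y \<in> S \<longleftrightarrow> g y = y \<bullet> e"
  using chart by (auto simp: graph_chart_def)

text \<open>Since \<open>g\<close> is constant along \<open>e\<close>, its gradient is orthogonal to
  \<open>e\<close>. In particular the normal does not vanish.\<close>

lemma chart_normal_e: "chart_normal y \<bullet> e = 1"
proof -
  have "((\<lambda>t. g (y + t *\<^sub>R e)) has_derivative (\<lambda>s. frechet_derivative g (at (y + 0 *\<^sub>R e)) (s *\<^sub>R e))) (at 0)"
    by (rule has_derivative_compose[where f="\<lambda>t. y + t *\<^sub>R e", OF _ smooth_on_has_derivative[OF chart_smooth UNIV_I]])
      (auto intro!: derivative_eq_intros)
  moreover have "((\<lambda>t::real. g (y + t *\<^sub>R e)) has_derivative (\<lambda>s. 0)) (at 0)"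
    by (simp add: chart_inv)
  ultimately have "(\<lambda>s. frechet_derivative g (at (y + 0 *\<^sub>R e)) (s *\<^sub>R e)) = (\<lambda>s. 0)"
    by (rule has_derivative_unique)
  from fun_cong[OF this, of 1] have "gradient g y \<bullet> e = 0"
    by (simp add: gradient_eq_frechet[OF chart_smooth])
  then show ?thesis by (simp add: inner_diff_left chart_e)
qed

lemma chart_normal_nonzero: "chart_normal y \<noteq> 0"
proof
  assume "chart_normal y = 0"
  then show False using chart_normal_e[of y] by simp
qed

lemma curve_orthogonal_normal:
  assumes y: "y \<in> ball x r" and c: "smooth_curve_at S y c v"
  shows "v \<bullet> chart_normal y = 0"
proof -
  obtain d where d: "d > 0" "c ` {-d<..<d} \<subseteq> S" and c0: "c 0 = y" and v: "(c has_vector_derivative v) (at 0)"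
    using c unfolding smooth_curve_at_def by auto
  have cd: "(c has_derivative (\<lambda>s. s *\<^sub>R v)) (at 0)" using v by (simp add: has_vector_derivative_def)
  have "isCont c 0" using cd has_derivative_continuous by blast
  then obtain d' where d': "d' > 0" "\<And>t. dist t 0 < d' \<Longrightarrow> dist (c t) (c 0) < r - dist x y"
    using \<open>isCont c 0\<close>[unfolded continuous_at_eps_delta, rule_format, of "r - dist x y"] y by auto
  have zero: "g (c t) - c t \<bullet> e = 0" if "t \<in> {- min d d'<..<min d d'}" for t
  proof -
    have "dist (c t) y < r - dist x y" using d'(2)[of t] that by (auto simp: c0 dist_real_def)
    then have "c t \<in> ball x r" using dist_triangle[of x "c t" y] by (simp add: dist_commute)
    moreover have "c t \<in> S" using d(2) that by auto
    ultimately show ?thesis using chart_S by auto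
  qed
  have "((\<lambda>t. g (c t)) has_derivative (\<lambda>s. frechet_derivative g (at (c 0)) (s *\<^sub>R v))) (at 0)"
    by (rule has_derivative_compose[OF cd smooth_on_has_derivative[OF chart_smooth UNIV_I]])
  then have "((\<lambda>t. g (c t) - c t \<bullet> e) has_derivative (\<lambda>s. frechet_derivative g (at (c 0)) (s *\<^sub>R v) - (s *\<^sub>R v) \<bullet> e)) (at 0)"
    by (intro has_derivative_diff has_derivative_inner_left cd)
  moreover have "((\<lambda>t. g (c t) - c t \<bullet> e) has_derivative (\<lambda>s. 0)) (at 0)"
  proof (rule has_derivative_transform_within_open[of "\<lambda>t. 0"])
    show "open {- min d d'<..<min d d'}" "0 \<in> {- min d d'<..<min d d'}" using d d' by auto
    show "0 = g (c t) - c t \<bullet> e" if "t \<in> {- min d d'<..<min d d'}" for t using zero[OF that] by simp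
  qed simp
  ultimately have "(\<lambda>s. frechet_derivative g (at (c 0)) (s *\<^sub>R v) - (s *\<^sub>R v) \<bullet> e) = (\<lambda>s. 0)"
    by (rule has_derivative_unique)
  from fun_cong[OF this, of 1] have "gradient g y \<bullet> v = v \<bullet> e"
    by (simp add: gradient_eq_frechet[OF chart_smooth] c0)
  then show ?thesis by (simp add: inner_diff_right inner_commute)
qed

lemma orthogonal_normal_curve:
  assumes y: "y \<in> S" "y \<in> ball x r" and v: "v \<bullet> chart_normal y = 0"
  shows "\<exists>c. smooth_curve_at S y c v"
proof -
  define l where "l = (\<lambda>t::real. y + t *\<^sub>R v)"
  \<comment> \<open>The line \<open>l\<close> is lifted to the graph along \<open>e\<close>, which
    leaves \<open>g\<close> unchanged. The lift has derivative
    \<open>- (v \<bullet> chart_normal y) = 0\<close> at 0, so the velocity is still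
    \<open>v\<close>.\<close>
  define c where "c = (\<lambda>t. l t + (g (l t) + - (l t \<bullet> e)) *\<^sub>R e)"
  have sl: "smooth_on UNIV l"
    unfolding l_def by (intro smooth_on_affine[OF _ _ smooth_on_id] bounded_linear_scaleR_left) auto
  have sc: "smooth_on UNIV c"
  proof -
    have 1: "smooth_on UNIV (\<lambda>t. g (l t))"
      unfolding l_def by (intro smooth_on_affine[OF _ _ chart_smooth] bounded_linear_scaleR_left) auto
    have 2: "smooth_on UNIV (\<lambda>t. - (l t \<bullet> e))"
      by (rule smooth_on_linear[OF bounded_linear_minus[OF bounded_linear_inner_left] open_UNIV sl])
    show ?thesis unfolding c_def
      by (intro smooth_on_add sl smooth_on_linear[OF bounded_linear_scaleR_left, where f="\<lambda>t. g (l t) + - (l t \<bullet> e)"] 1 2 open_UNIV)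
  qed
  have c0: "c 0 = y" using chart_S[OF y(2)] y(1) by (simp add: c_def l_def)
  have cS: "c t \<in> S" if "c t \<in> ball x r" for t
    using chart_S[OF that] by (simp add: c_def chart_inv inner_add_left chart_e)
  have "continuous_on UNIV c" by (rule smooth_on_continuous[OF sc])
  then have "isCont c 0" by (simp add: continuous_on_eq_continuous_at)
  then obtain d where d: "d > 0" "\<And>t. dist t 0 < d \<Longrightarrow> dist (c t) (c 0) < r - dist x y"
    using \<open>isCont c 0\<close>[unfolded continuous_at_eps_delta, rule_format, of "r - dist x y"] y by auto
  have "c t \<in> S" if "t \<in> {-d<..<d}" for t
  proof (rule cS)
    have "dist (c t) y < r - dist x y" using d(2)[of t] that by (auto simp: c0 dist_real_def)
    then show "c t \<in> ball x r" using dist_triangle[of x "c t" y] by (simp add: dist_commute)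
  qed
  moreover have "(c has_vector_derivative v) (at 0)"
  proof -
    have dl: "(l has_derivative (\<lambda>s. s *\<^sub>R v)) (at 0)"
      unfolding l_def by (auto intro!: derivative_eq_intros)
    have dg: "((\<lambda>t. g (l t)) has_derivative (\<lambda>s. frechet_derivative g (at (l 0)) (s *\<^sub>R v))) (at 0)"
      by (rule has_derivative_compose[OF dl smooth_on_has_derivative[OF chart_smooth UNIV_I]])
    have "(c has_derivative (\<lambda>s. s *\<^sub>R v + (frechet_derivative g (at (l 0)) (s *\<^sub>R v) + - ((s *\<^sub>R v) \<bullet> e)) *\<^sub>R e)) (at 0)"
      unfolding c_def
      by (intro has_derivative_add has_derivative_scaleR_left has_derivative_minus has_derivative_inner_left dl dg)
    moreover have "frechet_derivative g (at (l 0)) (s *\<^sub>R v) + - ((s *\<^sub>R v) \<bullet> e) = 0" for s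
      using v by (simp add: gradient_eq_frechet[OF chart_smooth, symmetric] l_def inner_diff_right inner_commute)
    ultimately show ?thesis by (simp add: has_vector_derivative_def)
  qed
  ultimately have "smooth_curve_at S y c v"
    using d(1) c0 smooth_on_subset[OF sc, of "{-d<..<d}"] unfolding smooth_curve_at_def by auto
  then show ?thesis by blast
qed

lemma tangent_space_chart:
  "y \<in> S \<Longrightarrow> y \<in> ball x r \<Longrightarrow> tangent_space S y = {v. v \<bullet> chart_normal y = 0}"
  unfolding tangent_space_def using curve_orthogonal_normal orthogonal_normal_curve by blast

text \<open>The tangent space is the orthogonal complement of the normal, so the tangential
  projection of the ambient gradient is a candidate. Another candidate differs from it by a tangent
  vector orthogonal to all tangent vectors, itself included, which justifies the definite
  description.\<close>

lemma surface_grad_chart: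
  assumes y: "y \<in> S" "y \<in> ball x r" and u: "smooth_on UNIV u"
  shows "surface_grad S u y = gradient u y -
    (gradient u y \<bullet> chart_normal y / (chart_normal y \<bullet> chart_normal y)) *\<^sub>R chart_normal y" (is "_ = ?w")
proof -
  let ?N = "chart_normal y"
  have NN: "?N \<bullet> ?N \<noteq> 0" using chart_normal_nonzero by simp
  have T: "v \<in> tangent_space S y \<longleftrightarrow> v \<bullet> ?N = 0" for v using tangent_space_chart[OF y] by simp
  have wN: "?w \<bullet> ?N = 0" using NN by (simp add: inner_diff_left)
  have wv: "?w \<bullet> v = gradient u y \<bullet> v" if "v \<bullet> ?N = 0" for v
  proof -
    have "?N \<bullet> v = 0" using that by (subst inner_commute)
    moreover have "?w \<bullet> v = gradient u y \<bullet> v - (gradient u y \<bullet> ?N / (?N \<bullet> ?N)) * (?N \<bullet> v)"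
      by (simp only: inner_diff_left[of "gradient u y"] inner_scaleR_left)
    ultimately show ?thesis by simp
  qed
  have deriv: "((\<lambda>t. u (c t)) has_real_derivative gradient u y \<bullet> v) (at 0)" if "smooth_curve_at S y c v" for c v
  proof -
    have c: "c 0 = y" "(c has_derivative (\<lambda>s. s *\<^sub>R v)) (at 0)"
      using that by (auto simp: smooth_curve_at_def has_vector_derivative_def)
    have "((\<lambda>t. u (c t)) has_derivative (\<lambda>s. frechet_derivative u (at (c 0)) (s *\<^sub>R v))) (at 0)"
      by (rule has_derivative_compose[OF c(2) smooth_on_has_derivative[OF u UNIV_I]])
    then show ?thesis
      by (simp add: gradient_eq_frechet[OF u, symmetric] c(1) has_field_derivative_def mult.commute[of _ "gradient u y \<bullet> v"])
  qed
  show ?thesis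
    unfolding surface_grad_def
  proof (rule the_equality)
    show "?w \<in> tangent_space S y \<and> (\<forall>c v. smooth_curve_at S y c v \<longrightarrow> ((\<lambda>t. u (c t)) has_real_derivative ?w \<bullet> v) (at 0))"
      using T wN deriv wv curve_orthogonal_normal[OF y(2)] by auto
  next
    fix w
    assume w: "w \<in> tangent_space S y \<and> (\<forall>c v. smooth_curve_at S y c v \<longrightarrow> ((\<lambda>t. u (c t)) has_real_derivative w \<bullet> v) (at 0))"
    have e: "w \<bullet> v = ?w \<bullet> v" if v: "v \<bullet> ?N = 0" for v
    proof -
      obtain c where c: "smooth_curve_at S y c v" using orthogonal_normal_curve[OF y v] by blast
      have "w \<bullet> v = gradient u y \<bullet> v" using DERIV_unique deriv[OF c] w c by blast
      then show ?thesis using wv[OF v] by simp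
    qed
    have "(w - ?w) \<bullet> ?N = 0" using w T wN by (simp add: inner_diff_left)
    then have "w \<bullet> (w - ?w) = ?w \<bullet> (w - ?w)" by (rule e)
    then have "(w - ?w) \<bullet> (w - ?w) = 0" by (simp only: inner_diff_left[of w] right_minus_eq)
    then show "w = ?w" by simp
  qed
qed

text \<open>Pythagoras: the normal part removed by the projection is orthogonal to what
  remains.\<close>

lemma surface_grad_chart_norm_le:
  assumes "y \<in> S" "y \<in> ball x r" "smooth_on UNIV u"
  shows "norm (surface_grad S u y) \<le> norm (gradient u y)"
proof -
  let ?N = "chart_normal y" and ?w = "surface_grad S u y" and ?G = "gradient u y"
  have NN: "?N \<bullet> ?N \<noteq> 0" using chart_normal_nonzero by simp
  define t where "t = ?G \<bullet> ?N / (?N \<bullet> ?N)"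
  have w: "?w = ?G - t *\<^sub>R ?N" using surface_grad_chart[OF assms] by (simp add: t_def)
  have wN: "?w \<bullet> ?N = 0" unfolding w using NN by (simp add: inner_diff_left t_def)
  have G: "?G = ?w + t *\<^sub>R ?N" using w by simp
  have "?G \<bullet> ?G = ?w \<bullet> ?w + t\<^sup>2 * (?N \<bullet> ?N)"
    unfolding G inner_add_left inner_add_right inner_scaleR_left inner_scaleR_right
    using wN by (simp add: inner_commute power2_eq_square)
  then have "?w \<bullet> ?w \<le> ?G \<bullet> ?G" by simp
  then show ?thesis by (simp add: norm_le)
qed

lemma continuous_on_chart_formula:
  assumes "smooth_on UNIV u"
  shows "continuous_on UNIV (\<lambda>y. gradient u y -
    (gradient u y \<bullet> chart_normal y / (chart_normal y \<bullet> chart_normal y)) *\<^sub>R chart_normal y)"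
  using chart_normal_nonzero
  by (intro continuous_intros continuous_on_gradient assms chart_smooth) auto

end

lemma gradient_linear_combination:
  fixes u :: "nat \<Rightarrow> 'a::euclidean_space \<Rightarrow> real"
  assumes "\<And>j. j < k \<Longrightarrow> smooth_on UNIV (u j)"
  shows "gradient (\<lambda>x. \<Sum>j<k. a j * u j x) x = (\<Sum>j<k. a j *\<^sub>R gradient (u j) x)"
proof (rule gradient_eqI)
  show "((\<lambda>x. \<Sum>j<k. a j * u j x) has_derivative (\<lambda>v. \<Sum>j<k. a j * frechet_derivative (u j) (at x) v)) (at x)"
    using assms by (intro has_derivative_sum has_derivative_mult_right smooth_on_has_derivative[of UNIV]) auto
  show "(\<Sum>j<k. a j *\<^sub>R gradient (u j) x) \<bullet> v = (\<Sum>j<k. a j * frechet_derivative (u j) (at x) v)" for v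
    using assms by (simp add: inner_sum_left gradient_eq_frechet)
qed

lemma smooth_linear_combination:
  fixes u :: "nat \<Rightarrow> 'a::euclidean_space \<Rightarrow> real"
  assumes "\<And>j. j < k \<Longrightarrow> smooth_on UNIV (u j)"
  shows "smooth_on UNIV (\<lambda>x. \<Sum>j<k. a j * u j x)"
  using assms by (intro smooth_on_sum smooth_on_mult smooth_on_const) auto

text \<open>The chart formula is linear in the ambient gradient, which the definite description does
  not show.\<close>

lemma surface_grad_linear_combination:
  fixes u :: "nat \<Rightarrow> 'a::euclidean_space \<Rightarrow> real"
  assumes S: "smooth_hypersurface S" "x \<in> S" and u: "\<And>j. j < k \<Longrightarrow> smooth_on UNIV (u j)"
  shows "surface_grad S (\<lambda>x. \<Sum>j<k. a j * u j x) x = (\<Sum>j<k. a j *\<^sub>R surface_grad S (u j) x)"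
proof -
  obtain r e g where ch: "graph_chart S x r e g" using S unfolding smooth_hypersurface_def by blast
  then have x: "x \<in> ball x r" by (simp add: graph_chart_def)
  define N where "N = e - gradient g x"
  have f: "surface_grad S w x = gradient w x - (gradient w x \<bullet> N / (N \<bullet> N)) *\<^sub>R N" if "smooth_on UNIV w" for w
    using surface_grad_chart[OF ch S(2) x that] by (simp add: N_def)
  have "surface_grad S (\<lambda>x. \<Sum>j<k. a j * u j x) x =
     (\<Sum>j<k. a j *\<^sub>R gradient (u j) x) - ((\<Sum>j<k. a j *\<^sub>R gradient (u j) x) \<bullet> N / (N \<bullet> N)) *\<^sub>R N"
    using f[OF smooth_linear_combination[of k u a]] gradient_linear_combination[of k u a x] u by simp
  also have "\<dots> = (\<Sum>j<k. a j *\<^sub>R (gradient (u j) x - (gradient (u j) x \<bullet> N / (N \<bullet> N)) *\<^sub>R N))"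
    by (simp add: inner_sum_left sum_divide_distrib scaleR_sum_left sum_subtractf scaleR_diff_right)
  also have "\<dots> = (\<Sum>j<k. a j *\<^sub>R surface_grad S (u j) x)" using f u by simp
  finally show ?thesis .
qed

lemma norm_surface_grad_le:
  assumes "smooth_hypersurface S" "x \<in> S" "smooth_on UNIV u"
  shows "norm (surface_grad S u x) \<le> norm (gradient u x)"
proof -
  obtain r e g where ch: "graph_chart S x r e g" using assms unfolding smooth_hypersurface_def by blast
  then have x: "x \<in> ball x r" by (simp add: graph_chart_def)
  show ?thesis by (rule surface_grad_chart_norm_le[OF ch assms(2) x assms(3)])
qed

text \<open>The formula from the chart at \<open>x\<close> is continuous on the whole space and
  agrees with \<open>surface_grad\<close> on \<open>S\<close> near \<open>x\<close>.\<close>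

lemma continuous_on_surface_grad:
  assumes "smooth_hypersurface S" and u: "smooth_on UNIV u"
  shows "continuous_on S (surface_grad S u)"
  unfolding continuous_on_eq_continuous_within
proof
  fix x assume x: "x \<in> S"
  then obtain r e g where ch: "graph_chart S x r e g" using assms unfolding smooth_hypersurface_def by blast
  then have r: "r > 0" by (simp add: graph_chart_def)
  have "continuous (at x within S) (\<lambda>y. gradient u y -
      (gradient u y \<bullet> (e - gradient g y) / ((e - gradient g y) \<bullet> (e - gradient g y))) *\<^sub>R (e - gradient g y))"
    using continuous_on_chart_formula[OF ch u] by (simp add: continuous_on_eq_continuous_at continuous_at_imp_continuous_within)
  then show "continuous (at x within S) (surface_grad S u)"
  proof (rule continuous_transform_within[OF _ r x])
    fix y assume "y \<in> S" "dist y x < r"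
    then show "gradient u y - (gradient u y \<bullet> (e - gradient g y) / ((e - gradient g y) \<bullet> (e - gradient g y))) *\<^sub>R (e - gradient g y)
       = surface_grad S u y"
      using surface_grad_chart[OF ch _ _ u] by (simp add: dist_commute)
  qed
qed

subsection \<open>Compact smooth hypersurfaces have finite area\<close>

text \<open>Cells of mesh \<open>1 / N\<close> in the coordinates \<open>T\<close> number at most a
  multiple of \<open>N ^ m\<close> and have diameter at most a multiple of \<open>1 / N\<close>, so
  the sum of the gauges is bounded independently of \<open>N\<close>, hence of
  \<open>\<delta>\<close>.\<close>

lemma hausdorff_outer_finite_of_coordinates:
  fixes A :: "'a::euclidean_space set" and T :: "'a \<Rightarrow> 'j \<Rightarrow> real"
  assumes J: "finite J" "card J = m"
    and M: "\<And>y l. y \<in> A \<Longrightarrow> l \<in> J \<Longrightarrow> \<bar>T y l\<bar> \<le> M" "0 \<le> M"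
    and C: "\<And>y y'. y \<in> A \<Longrightarrow> y' \<in> A \<Longrightarrow> dist y y' \<le> C * (\<Sum>l\<in>J. \<bar>T y l - T y' l\<bar>)" "0 \<le> C"
  shows "hausdorff_outer m A < \<infinity>"
proof -
  define B where "B = unit_ball_vol (real m) * ((2 * M + 5) * (C * real m / 2)) ^ m"
  have "hausdorff_pre m \<delta> A \<le> ennreal B" if \<delta>: "\<delta> > 0" for \<delta>
  proof -
    obtain N0 :: nat where N0: "C * real m / \<delta> < real N0" using reals_Archimedean2 by blast
    define N where "N = real (Suc N0)"
    have N: "N \<ge> 1" by (simp add: N_def)
    have "C * real m < real N0 * \<delta>" using N0 \<delta> by (simp add: pos_divide_less_eq)
    also have "\<dots> \<le> \<delta> * N" using \<delta> by (simp add: N_def)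
    finally have CN: "C * real m / N \<le> \<delta>" using N by (simp add: pos_divide_le_eq)
    \<comment> \<open>\<open>K\<close> bounds all cell indices, and
      \<open>2 * K + 1 \<le> 2 * M * N + 3\<close>, which the 5 in \<open>B\<close> absorbs since
      \<open>N \<ge> 1\<close>.\<close>
    define K where "K = \<lceil>M * N\<rceil>"
    have "0 \<le> M * N" using M(2) N by simp
    then have K0: "0 \<le> K" unfolding K_def by linarith
    define I where "I = PiE J (\<lambda>_. {-K..K})"
    have finI: "finite I" unfolding I_def using J by (intro finite_PiE) auto
    have cardI: "real (card I) = (2 * real_of_int K + 1) ^ m"
      using K0 J by (simp add: I_def card_PiE)
    define cell where "cell = (\<lambda>f. {y \<in> A. \<forall>l\<in>J. \<lfloor>N * T y l\<rfloor> = f l})"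
    have cd: "norm (y - y') \<le> C * real m / N" if "y \<in> cell f" "y' \<in> cell f" for f y y'
    proof -
      have "\<bar>T y l - T y' l\<bar> \<le> 1 / N" if l: "l \<in> J" for l
      proof -
        have "\<lfloor>N * T y l\<rfloor> = \<lfloor>N * T y' l\<rfloor>" using \<open>y \<in> cell f\<close> \<open>y' \<in> cell f\<close> l by (simp add: cell_def)
        then have "\<bar>N * T y l - N * T y' l\<bar> \<le> 1" by linarith
        then have "N * \<bar>T y l - T y' l\<bar> \<le> 1" using N by (simp add: abs_mult flip: right_diff_distrib)
        then show ?thesis using N by (simp add: pos_le_divide_eq mult.commute)
      qed
      then have "(\<Sum>l\<in>J. \<bar>T y l - T y' l\<bar>) \<le> (\<Sum>l\<in>J. 1 / N)" by (intro sum_mono)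
      then have "C * (\<Sum>l\<in>J. \<bar>T y l - T y' l\<bar>) \<le> C * (real m * (1 / N))" using J C(2) by (intro mult_left_mono) auto
      moreover have "norm (y - y') \<le> C * (\<Sum>l\<in>J. \<bar>T y l - T y' l\<bar>)"
        using C(1)[of y y'] that by (simp add: cell_def dist_norm)
      ultimately show ?thesis by simp
    qed
    have diam: "diameter (cell f) \<le> C * real m / N" for f
      using cd C(2) N by (intro diameter_le) auto
    have bdd: "bounded (cell f)" for f
    proof (cases "cell f = {}")
      case False
      then obtain y where "y \<in> cell f" by auto
      then show ?thesis unfolding bounded_def dist_norm using cd by blast
    qed simp
    define g where "g = unit_ball_vol (real m) * (C * real m / N / 2) ^ m"
    have gauge: "hausdorff_gauge m (cell f) \<le> ennreal g" for f
      unfolding hausdorff_gauge_def g_def using diam[of f] diameter_ge_0[OF bdd[of f]]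
      by (auto intro!: ennreal_leI mult_left_mono power_mono)
    obtain h where h: "bij_betw h {0..<card I} I" using ex_bij_betw_nat_finite[OF finI] by blast
    define D where "D = (\<lambda>i. if i < card I then cell (h i) else {})"
    have "A \<subseteq> (\<Union>i. D i)"
    proof
      fix y assume y: "y \<in> A"
      define f where "f = (\<lambda>l\<in>J. \<lfloor>N * T y l\<rfloor>)"
      have "f \<in> I" unfolding I_def
      proof (rule PiE_I)
        fix l assume l: "l \<in> J"
        have "\<bar>N * T y l\<bar> \<le> M * N" using M(1)[OF y l] N by (simp add: abs_mult mult.commute)
        moreover have "M * N \<le> real_of_int K" by (simp add: K_def)
        ultimately have "- real_of_int K \<le> N * T y l" "N * T y l \<le> real_of_int K" by linarith+
        then have "- K \<le> \<lfloor>N * T y l\<rfloor>" "\<lfloor>N * T y l\<rfloor> \<le> K" by linarith+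
        then show "f l \<in> {-K..K}" using l by (simp add: f_def)
      qed (simp add: f_def)
      then have "f \<in> h ` {0..<card I}" using h by (simp add: bij_betw_def)
      then obtain i where i: "i < card I" "h i = f" by auto
      have "y \<in> cell f" using y by (simp add: cell_def f_def)
      then show "y \<in> (\<Union>i. D i)" using i by (intro UN_I[of i]) (auto simp: D_def)
    qed
    then have "hausdorff_pre m \<delta> A \<le> suminf (\<lambda>i. hausdorff_gauge m (D i))"
    proof (rule hausdorff_pre_lower)
      show "bounded (D i)" "diameter (D i) \<le> \<delta>" for i
        using bdd order_trans[OF diam CN] \<delta> by (auto simp: D_def)
    qed
    also have "\<dots> = (\<Sum>i<card I. hausdorff_gauge m (D i))"
      by (rule suminf_finite) (auto simp: D_def)
    also have "\<dots> \<le> (\<Sum>i<card I. ennreal g)" by (intro sum_mono) (auto simp: D_def gauge)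
    also have "\<dots> = ennreal (real (card I) * g)"
      by (simp add: ennreal_mult' ennreal_of_nat_eq_real_of_nat)
    also have "\<dots> \<le> ennreal B"
    proof (rule ennreal_leI)
      have "real_of_int K \<le> M * N + 1" unfolding K_def by linarith
      then have "2 * real_of_int K + 1 \<le> (2 * M + 5) * N" using N by (simp add: algebra_simps)
      then have "real (card I) \<le> ((2 * M + 5) * N) ^ m"
        unfolding cardI using K0 by (intro power_mono) auto
      then have "real (card I) * g \<le> ((2 * M + 5) * N) ^ m * g"
        using C(2) N by (intro mult_right_mono) (auto simp: g_def)
      also have "\<dots> = unit_ball_vol (real m) * (((2 * M + 5) * N) * (C * real m / N / 2)) ^ m"
        unfolding g_def power_mult_distrib by (simp only: mult_ac)
      also have "((2 * M + 5) * N) * (C * real m / N / 2) = (2 * M + 5) * (C * real m / 2)"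
        using N by (simp add: field_simps)
      finally show "real (card I) * g \<le> B" by (simp add: B_def)
    qed
    finally show ?thesis .
  qed
  then have "hausdorff_outer m A \<le> ennreal B"
    unfolding hausdorff_outer_def by (intro SUP_least) auto
  then show ?thesis by (rule order.strict_trans1) simp
qed

lemma hausdorff_outer_finite_UN:
  assumes "finite D"
  shows "(\<And>x. x \<in> D \<Longrightarrow> hausdorff_outer m (A x) < \<infinity>) \<Longrightarrow> hausdorff_outer m (\<Union>x\<in>D. A x) < \<infinity>"
  using assms
proof (induction D)
  case (insert x D)
  have "hausdorff_outer m (A x \<union> (\<Union>x\<in>D. A x)) \<le> hausdorff_outer m (A x) + hausdorff_outer m (\<Union>x\<in>D. A x)"
    by (rule hausdorff_outer_Un_le)
  also have "\<dots> < \<infinity>" using insert by simp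
  finally show ?case by simp
qed simp

text \<open>The projection \<open>P\<close> along \<open>e\<close> has a Lipschitz inverse on the
  graph piece, because \<open>g\<close> has bounded gradient on a ball. As \<open>P y\<close> is
  orthogonal to \<open>e\<close>, one basis coordinate \<open>i\<close> with
  \<open>e \<bullet> i \<noteq> 0\<close> is redundant, which leaves \<open>DIM('a) - 1\<close>
  coordinates.\<close>

lemma chart_hausdorff_finite:
  fixes S :: "'a::euclidean_space set"
  assumes chart: "graph_chart S x r e g"
  shows "hausdorff_outer (DIM('a) - 1) (S \<inter> ball x r) < \<infinity>"
proof -
  define P where "P = (\<lambda>y. y - (y \<bullet> e) *\<^sub>R e)"
  have ee: "e \<bullet> e = 1" and e: "norm e = 1" using chart by (auto simp: graph_chart_def norm_eq_1)
  have r: "r > 0" using chart by (simp add: graph_chart_def)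
  note gs = chart_smooth[OF chart]
  have Pd: "P y - P z = P (y - z)" for y z by (simp add: P_def inner_diff_left scaleR_diff_left)
  have Pe: "P y \<bullet> e = 0" for y by (simp add: P_def inner_diff_left ee)
  have Pn: "norm (P y) \<le> norm y" for y
  proof -
    have "P y \<bullet> P y = y \<bullet> y - (y \<bullet> e)\<^sup>2"
      by (simp add: P_def inner_diff_left inner_diff_right ee inner_commute power2_eq_square)
    then show ?thesis by (simp add: norm_le)
  qed
  have gP: "g (P y) = g y" for y using chart_inv[OF chart, of y "- (y \<bullet> e)"] by (simp add: P_def)
  have "bounded (gradient g ` cball (P x) r)"
    by (intro compact_imp_bounded compact_continuous_image compact_cball
        continuous_on_subset[OF continuous_on_gradient[OF gs]]) auto
  then obtain B where "\<forall>z\<in>cball (P x) r. norm (gradient g z) \<le> B"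
    unfolding bounded_iff by blast
  then have B: "norm (gradient g z) \<le> B" if "z \<in> cball (P x) r" for z using that by blast
  have B0: "0 \<le> B" using order_trans[OF norm_ge_zero B[of "P x"]] r by simp
  have lip: "\<bar>g z - g z'\<bar> \<le> B * norm (z - z')" if "z \<in> cball (P x) r" "z' \<in> cball (P x) r" for z z'
  proof -
    have "norm (g z - g z') \<le> B * norm (z - z')"
    proof (rule differentiable_bound[OF convex_cball _ _ that])
      show "(g has_derivative frechet_derivative g (at y)) (at y within cball (P x) r)" for y
        by (rule has_derivative_at_withinI[OF smooth_on_has_derivative[OF gs UNIV_I]])
      show "onorm (frechet_derivative g (at y)) \<le> B" if "y \<in> cball (P x) r" for y
      proof (rule onorm_bound[OF B0])
        fix v
        have "norm (frechet_derivative g (at y) v) \<le> norm (gradient g y) * norm v"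
          using Cauchy_Schwarz_ineq2[of "gradient g y" v] by (simp add: gradient_eq_frechet[OF gs])
        also have "\<dots> \<le> B * norm v" using B[OF that] by (intro mult_right_mono) auto
        finally show "norm (frechet_derivative g (at y) v) \<le> B * norm v" .
      qed
    qed
    then show ?thesis by simp
  qed
  have "e \<noteq> 0" using e by auto
  then obtain i where i: "i \<in> Basis" "e \<bullet> i \<noteq> 0" using euclidean_all_zero_iff by blast
  define J where "J = (Basis :: 'a set) - {i}"
  have J: "finite J" "card J = DIM('a) - 1" using i by (auto simp: J_def card_Diff_singleton)
  have Bas: "(\<Sum>b\<in>Basis. f b) = f i + (\<Sum>b\<in>J. f b)" for f :: "'a \<Rightarrow> real"
    unfolding J_def using i(1) by (intro sum.remove) auto
  define q where "q = 1 + 1 / \<bar>e \<bullet> i\<bar>"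
  have w: "norm w \<le> q * (\<Sum>l\<in>J. \<bar>w \<bullet> l\<bar>)" if we: "w \<bullet> e = 0" for w
  proof -
    have "0 = (\<Sum>b\<in>Basis. (w \<bullet> b) * (e \<bullet> b))" using we euclidean_inner[of w e] by simp
    then have "(w \<bullet> i) * (e \<bullet> i) = - (\<Sum>l\<in>J. (w \<bullet> l) * (e \<bullet> l))" unfolding Bas by simp
    then have "\<bar>w \<bullet> i\<bar> * \<bar>e \<bullet> i\<bar> = \<bar>\<Sum>l\<in>J. (w \<bullet> l) * (e \<bullet> l)\<bar>" by (simp flip: abs_mult)
    also have "\<dots> \<le> (\<Sum>l\<in>J. \<bar>(w \<bullet> l) * (e \<bullet> l)\<bar>)" by (rule sum_abs)
    also have "\<dots> \<le> (\<Sum>l\<in>J. \<bar>w \<bullet> l\<bar>)"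
    proof (rule sum_mono)
      fix l assume "l \<in> J"
      then have "\<bar>e \<bullet> l\<bar> \<le> 1" using Basis_le_norm[of l e] e by (simp add: J_def)
      then show "\<bar>(w \<bullet> l) * (e \<bullet> l)\<bar> \<le> \<bar>w \<bullet> l\<bar>" by (simp add: abs_mult mult_left_le)
    qed
    finally have "\<bar>w \<bullet> i\<bar> \<le> (\<Sum>l\<in>J. \<bar>w \<bullet> l\<bar>) / \<bar>e \<bullet> i\<bar>" using i by (simp add: pos_le_divide_eq)
    then have "(\<Sum>b\<in>Basis. \<bar>w \<bullet> b\<bar>) \<le> q * (\<Sum>l\<in>J. \<bar>w \<bullet> l\<bar>)"
      unfolding Bas q_def by (simp add: ring_distribs)
    then show ?thesis using norm_le_l1[of w] by linarith
  qed
  show ?thesis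
  proof (rule hausdorff_outer_finite_of_coordinates[OF J, of _ "\<lambda>y l. P y \<bullet> l" "norm x + r" "(1 + B) * q"])
    fix y l assume y: "y \<in> S \<inter> ball x r" and l: "l \<in> J"
    have "\<bar>P y \<bullet> l\<bar> \<le> norm (P y)" using l by (intro Basis_le_norm) (simp add: J_def)
    also have "\<dots> \<le> norm y" by (rule Pn)
    also have "\<dots> \<le> norm x + r" using y norm_triangle_sub[of y x] by (simp add: dist_norm norm_minus_commute)
    finally show "\<bar>P y \<bullet> l\<bar> \<le> norm x + r" .
  next
    show "0 \<le> norm x + r" using r by simp
    show "0 \<le> (1 + B) * q" using B0 by (simp add: q_def)
  next
    fix y y' assume y: "y \<in> S \<inter> ball x r" and y': "y' \<in> S \<inter> ball x r"
    have ball: "P z \<in> cball (P x) r" if "z \<in> S \<inter> ball x r" for z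
      using Pn[of "x - z"] that by (simp add: dist_norm Pd)
    have ge: "g z = z \<bullet> e" if "z \<in> S \<inter> ball x r" for z using chart_S[OF chart, of z] that by blast
    have "\<bar>y \<bullet> e - y' \<bullet> e\<bar> \<le> B * norm (P y - P y')"
      using lip[OF ball[OF y] ball[OF y']] unfolding gP ge[OF y] ge[OF y'] .
    moreover have "dist y y' \<le> norm (P y - P y') + \<bar>y \<bullet> e - y' \<bullet> e\<bar>"
    proof -
      have eq: "y - y' = (P y - P y') + (y \<bullet> e - y' \<bullet> e) *\<^sub>R e" by (simp add: P_def scaleR_diff_left)
      have "norm (y - y') \<le> norm (P y - P y') + norm ((y \<bullet> e - y' \<bullet> e) *\<^sub>R e)"
        by (subst eq) (rule norm_triangle_ineq)
      then show ?thesis by (simp add: dist_norm e)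
    qed
    ultimately have "dist y y' \<le> (1 + B) * norm (P y - P y')" by (simp add: algebra_simps)
    also have "\<dots> \<le> (1 + B) * (q * (\<Sum>l\<in>J. \<bar>(P y - P y') \<bullet> l\<bar>))"
      using B0 Pe by (intro mult_left_mono w) (auto simp: inner_diff_left)
    finally show "dist y y' \<le> (1 + B) * q * (\<Sum>l\<in>J. \<bar>P y \<bullet> l - P y' \<bullet> l\<bar>)"
      by (simp only: mult.assoc inner_diff_left)
  qed
qed

lemma hypersurface_hausdorff_finite:
  fixes S :: "'a::euclidean_space set"
  assumes "smooth_hypersurface S" "compact S"
  shows "hausdorff_outer (DIM('a) - 1) S < \<infinity>"
proof -
  have "\<forall>x\<in>S. \<exists>r. \<exists>e g. graph_chart S x r e g" using assms(1) unfolding smooth_hypersurface_def .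
  from bchoice[OF this] obtain \<rho> where "\<forall>x\<in>S. \<exists>e g. graph_chart S x (\<rho> x) e g" by (elim exE)
  then have \<rho>: "\<exists>e g. graph_chart S x (\<rho> x) e g" if "x \<in> S" for x using that by blast
  have pos: "\<rho> x > 0" and fin: "hausdorff_outer (DIM('a) - 1) (S \<inter> ball x (\<rho> x)) < \<infinity>" if x: "x \<in> S" for x
  proof -
    obtain e g where ch: "graph_chart S x (\<rho> x) e g" using \<rho>[OF x] by blast
    show "\<rho> x > 0" using ch by (simp add: graph_chart_def)
    show "hausdorff_outer (DIM('a) - 1) (S \<inter> ball x (\<rho> x)) < \<infinity>" by (rule chart_hausdorff_finite[OF ch])
  qed
  have cover: "S \<subseteq> (\<Union>x\<in>S. ball x (\<rho> x))"
  proof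
    fix x assume "x \<in> S"
    then show "x \<in> (\<Union>x\<in>S. ball x (\<rho> x))" using pos by (intro UN_I[of x]) simp_all
  qed
  obtain D where D: "D \<subseteq> S" "finite D" "S \<subseteq> (\<Union>x\<in>D. ball x (\<rho> x))"
    using compactE_image[OF assms(2) open_ball cover] by blast
  have "S \<subseteq> (\<Union>x\<in>D. S \<inter> ball x (\<rho> x))" using D(3) by blast
  then have "hausdorff_outer (DIM('a) - 1) S \<le> hausdorff_outer (DIM('a) - 1) (\<Union>x\<in>D. S \<inter> ball x (\<rho> x))"
    by (rule hausdorff_outer_mono)
  also have "\<dots> < \<infinity>" using D fin by (intro hausdorff_outer_finite_UN) auto
  finally show ?thesis .
qed

lemma sets_surface_measure: "sets (surface_measure S) = sets (restrict_space borel S)"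
  unfolding surface_measure_def sets_restrict_space sets_hausdorff_measure ..

lemma space_surface_measure [simp]: "space (surface_measure S) = S"
  by (simp add: surface_measure_def space_restrict_space)

lemma emeasure_surface_measure:
  fixes S :: "'a::euclidean_space set"
  assumes "closed S" "A \<in> sets borel" "A \<subseteq> S"
  shows "emeasure (surface_measure S) A = hausdorff_outer (DIM('a) - 1) A"
  unfolding surface_measure_def using assms
  by (subst emeasure_restrict_space) (auto simp: emeasure_hausdorff_measure borel_closed)

lemma finite_surface_measure:
  fixes S :: "'a::euclidean_space set"
  assumes "smooth_hypersurface S" "compact S"
  shows "finite_measure (surface_measure S)"
proof
  have "closed S" using assms(2) compact_imp_closed by blast
  then show "emeasure (surface_measure S) (space (surface_measure S)) \<noteq> \<infinity>"
    using hypersurface_hausdorff_finite[OF assms] by (simp add: emeasure_surface_measure borel_closed)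
qed

subsection \<open>Test functions with disjoint supports\<close>

text \<open>Under the hypothesis at most one summand is nonzero, and both sides reduce to
  it.\<close>

lemma norm_sum_powr_disjoint:
  fixes v :: "nat \<Rightarrow> 'b::real_normed_vector"
  assumes "\<And>i j. i < k \<Longrightarrow> j < k \<Longrightarrow> i \<noteq> j \<Longrightarrow> v i = 0 \<or> v j = 0"
  shows "norm (\<Sum>j<k. v j) powr p = (\<Sum>j<k. norm (v j) powr p)"
proof (cases "\<exists>j<k. v j \<noteq> 0")
  case True
  then obtain j where j: "j < k" "v j \<noteq> 0" by blast
  have z: "v i = 0" if "i \<in> {..<k} - {j}" for i using assms[of i j] that j by auto
  have "(\<Sum>i<k. v i) = v j + (\<Sum>i\<in>{..<k} - {j}. v i)" using j by (intro sum.remove) auto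
  also have "(\<Sum>i\<in>{..<k} - {j}. v i) = 0" using z by (rule sum.neutral[rule_format])
  finally have 1: "(\<Sum>i<k. v i) = v j" by simp
  have "(\<Sum>i<k. norm (v i) powr p) = norm (v j) powr p + (\<Sum>i\<in>{..<k} - {j}. norm (v i) powr p)"
    using j by (intro sum.remove) auto
  also have "(\<Sum>i\<in>{..<k} - {j}. norm (v i) powr p) = 0" by (rule sum.neutral) (simp add: z)
  finally show ?thesis using 1 by simp
qed simp

lemma in_Lp_continuous:
  fixes S :: "'a::euclidean_space set" and f :: "'a \<Rightarrow> 'b::euclidean_space"
  assumes S: "smooth_hypersurface S" "compact S" and f: "continuous_on S f" and p: "p > 0"
  shows "in_Lp p (surface_measure S) f"
proof -
  interpret finite_measure "surface_measure S" by (rule finite_surface_measure[OF S])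
  have f': "f \<in> borel_measurable (surface_measure S)"
    using borel_measurable_continuous_on_restrict[OF f]
    unfolding measurable_cong_sets[OF sets_surface_measure refl] .
  have "bounded (f ` S)" by (intro compact_imp_bounded compact_continuous_image f S)
  then obtain B where B: "\<forall>x\<in>S. norm (f x) \<le> B" unfolding bounded_iff by blast
  have "integrable (surface_measure S) (\<lambda>x. norm (f x) powr p)"
  proof (rule integrable_const_bound[of _ "B powr p"])
    show "AE x in surface_measure S. norm (norm (f x) powr p) \<le> B powr p"
      using B p by (intro AE_I2) (simp add: powr_mono2)
    show "(\<lambda>x. norm (f x) powr p) \<in> borel_measurable (surface_measure S)"
      using f' by measurable
  qed
  with f' show ?thesis by (simp add: in_Lp_def)
qed

text \<open>Disjointness is imposed on values and gradients at each point, so that both p-th power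
  integrals of a linear combination split into sums with the same weights.\<close>

locale test_functions =
  fixes S :: "'a::euclidean_space set" and u :: "nat \<Rightarrow> 'a \<Rightarrow> real" and k :: nat and p \<Lambda> :: real
  assumes S: "smooth_hypersurface S" "compact S" and p: "p > 1"
    and u: "\<And>j. j < k \<Longrightarrow> smooth_on UNIV (u j)"
    and disj: "\<And>x i j. x \<in> S \<Longrightarrow> i < k \<Longrightarrow> j < k \<Longrightarrow> i \<noteq> j \<Longrightarrow>
       (u i x = 0 \<and> gradient (u i) x = 0) \<or> (u j x = 0 \<and> gradient (u j) x = 0)"
    and pos: "\<And>j. j < k \<Longrightarrow> 0 < (LINT x|surface_measure S. \<bar>u j x\<bar> powr p)"
    and ray: "\<And>j. j < k \<Longrightarrow> (LINT x|surface_measure S. norm (surface_grad S (u j) x) powr p)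
       \<le> \<Lambda> * (LINT x|surface_measure S. \<bar>u j x\<bar> powr p)"
begin

abbreviation "M \<equiv> surface_measure S"

definition value_energy :: "nat \<Rightarrow> real" where
  "value_energy j = (LINT x|M. \<bar>u j x\<bar> powr p)"

definition gradient_energy :: "nat \<Rightarrow> real" where
  "gradient_energy j = (LINT x|M. norm (surface_grad S (u j) x) powr p)"

text \<open>The second component is the combination of the gradients rather than the gradient of the
  combination. The two agree on \<open>S\<close>, and this form is linear in \<open>a\<close> at
  every point of the space.\<close>

definition combination :: "(nat \<Rightarrow> real) \<Rightarrow> 'a sobolev" where
  "combination a = (\<lambda>x. \<Sum>j<k. a j * u j x, \<lambda>x. \<Sum>j<k. a j *\<^sub>R surface_grad S (u j) x)"

lemma value_energy_pos: "j < k \<Longrightarrow> 0 < value_energy j"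
  unfolding value_energy_def by (rule pos)

lemma gradient_energy_nonneg: "0 \<le> gradient_energy j"
  unfolding gradient_energy_def by (rule Bochner_Integration.integral_nonneg) simp

lemma in_Lp_u: "j < k \<Longrightarrow> in_Lp p M (u j)"
  using p by (intro in_Lp_continuous S continuous_on_subset[OF smooth_on_continuous[OF u]]) auto

lemma in_Lp_surface_grad: "j < k \<Longrightarrow> in_Lp p M (surface_grad S (u j))"
  using p by (intro in_Lp_continuous S continuous_on_surface_grad u) auto

lemma value_pointwise:
  assumes "x \<in> S"
  shows "\<bar>fst (combination a) x\<bar> powr p = (\<Sum>j<k. \<bar>a j\<bar> powr p * \<bar>u j x\<bar> powr p)"
proof -
  have "norm (\<Sum>j<k. a j * u j x) powr p = (\<Sum>j<k. norm (a j * u j x) powr p)"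
    using disj[OF assms] by (intro norm_sum_powr_disjoint) auto
  then show ?thesis by (simp add: combination_def abs_mult powr_mult)
qed

lemma gradient_pointwise:
  assumes x: "x \<in> S"
  shows "norm (snd (combination a) x) powr p = (\<Sum>j<k. \<bar>a j\<bar> powr p * norm (surface_grad S (u j) x) powr p)"
proof -
  have z: "surface_grad S (u j) x = 0" if "gradient (u j) x = 0" "j < k" for j
    using norm_surface_grad_le[OF S(1) x u[OF that(2)]] that(1) by simp
  have "norm (\<Sum>j<k. a j *\<^sub>R surface_grad S (u j) x) powr p = (\<Sum>j<k. norm (a j *\<^sub>R surface_grad S (u j) x) powr p)"
  proof (rule norm_sum_powr_disjoint)
    fix i j assume ij: "i < k" "j < k" "i \<noteq> j"
    show "a i *\<^sub>R surface_grad S (u i) x = 0 \<or> a j *\<^sub>R surface_grad S (u j) x = 0"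
      using disj[OF x ij] z[OF _ ij(1)] z[OF _ ij(2)] by auto
  qed
  then show ?thesis by (simp add: combination_def powr_mult)
qed

lemma value_integral:
  shows "integrable M (\<lambda>x. \<bar>fst (combination a) x\<bar> powr p)" (is ?A)
    and "(LINT x|M. \<bar>fst (combination a) x\<bar> powr p) = (\<Sum>j<k. \<bar>a j\<bar> powr p * value_energy j)" (is ?B)
proof -
  have i: "integrable M (\<lambda>x. \<bar>a j\<bar> powr p * \<bar>u j x\<bar> powr p)" if "j < k" for j
    using in_Lp_u[OF that] by (intro integrable_mult_right) (simp add: in_Lp_def)
  have "integrable M (\<lambda>x. \<Sum>j<k. \<bar>a j\<bar> powr p * \<bar>u j x\<bar> powr p)"
    by (intro Bochner_Integration.integrable_sum i) simp
  then show ?A by (rule Bochner_Integration.integrable_cong[THEN iffD1, rotated -1]) (simp_all add: value_pointwise)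
  have "(LINT x|M. \<bar>fst (combination a) x\<bar> powr p) = (LINT x|M. (\<Sum>j<k. \<bar>a j\<bar> powr p * \<bar>u j x\<bar> powr p))"
    by (rule Bochner_Integration.integral_cong) (simp_all add: value_pointwise)
  also have "\<dots> = (\<Sum>j<k. LINT x|M. \<bar>a j\<bar> powr p * \<bar>u j x\<bar> powr p)"
    by (rule Bochner_Integration.integral_sum, rule i) simp
  finally show ?B by (simp add: value_energy_def)
qed

lemma gradient_integral:
  shows "integrable M (\<lambda>x. norm (snd (combination a) x) powr p)" (is ?A)
    and "(LINT x|M. norm (snd (combination a) x) powr p) = (\<Sum>j<k. \<bar>a j\<bar> powr p * gradient_energy j)" (is ?B)
proof -
  have i: "integrable M (\<lambda>x. \<bar>a j\<bar> powr p * norm (surface_grad S (u j) x) powr p)" if "j < k" for j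
    using in_Lp_surface_grad[OF that] by (intro integrable_mult_right) (simp add: in_Lp_def)
  have "integrable M (\<lambda>x. \<Sum>j<k. \<bar>a j\<bar> powr p * norm (surface_grad S (u j) x) powr p)"
    by (intro Bochner_Integration.integrable_sum i) simp
  then show ?A by (rule Bochner_Integration.integrable_cong[THEN iffD1, rotated -1]) (simp_all add: gradient_pointwise)
  have "(LINT x|M. norm (snd (combination a) x) powr p) = (LINT x|M. (\<Sum>j<k. \<bar>a j\<bar> powr p * norm (surface_grad S (u j) x) powr p))"
    by (rule Bochner_Integration.integral_cong) (simp_all add: gradient_pointwise)
  also have "\<dots> = (\<Sum>j<k. LINT x|M. \<bar>a j\<bar> powr p * norm (surface_grad S (u j) x) powr p)"
    by (rule Bochner_Integration.integral_sum, rule i) simp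
  finally show ?B by (simp add: gradient_energy_def)
qed

lemma sobolev_norm_combination:
  "sobolev_norm p S (combination a) = (\<Sum>j<k. \<bar>a j\<bar> powr p * (value_energy j + gradient_energy j)) powr (1 / p)"
  by (simp add: sobolev_norm_def value_integral(2) gradient_integral(2) distrib_left sum.distrib)

text \<open>The first component is smooth, so the constant sequence approximates it; on
  \<open>S\<close> its gradient is the second component.\<close>

lemma combination_in_sobolev: "combination a \<in> sobolev_space p S"
proof -
  let ?U = "\<lambda>x. \<Sum>j<k. a j * u j x" and ?G = "\<lambda>x. \<Sum>j<k. a j *\<^sub>R surface_grad S (u j) x"
  have sU: "smooth_on UNIV ?U" by (rule smooth_linear_combination) (rule u)
  have U: "in_Lp p M ?U"
    using p by (intro in_Lp_continuous S continuous_on_subset[OF smooth_on_continuous[OF sU]]) auto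
  have G: "in_Lp p M ?G"
    using p by (intro in_Lp_continuous S continuous_on_sum continuous_on_scaleR continuous_on_const
        continuous_on_surface_grad u) auto
  have gU: "in_Lp p M (surface_grad S ?U)"
    using p by (intro in_Lp_continuous S continuous_on_surface_grad sU) auto
  have "smooth_fun S ?U"
    unfolding smooth_fun_def using sU by (intro ballI exI[of _ UNIV] exI[of _ ?U]) simp
  moreover have "Lp_norm p M (\<lambda>x. ?U x - ?U x) = 0" by (simp add: Lp_norm_def)
  moreover have "Lp_norm p M (\<lambda>x. surface_grad S ?U x - ?G x) = 0"
  proof -
    have "(LINT x|M. norm (surface_grad S ?U x - ?G x) powr p) = (LINT x|M. 0)"
      by (rule Bochner_Integration.integral_cong) (simp_all add: surface_grad_linear_combination[OF S(1) _ u])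
    then show ?thesis by (simp add: Lp_norm_def)
  qed
  ultimately show ?thesis
    unfolding sobolev_space_def combination_def using U G gU
    by (simp, intro exI[of _ "\<lambda>_. ?U"]) simp
qed

lemma combination_diff: "combination b - combination a = combination (\<lambda>j. b j - a j)"
  by (simp add: combination_def minus_prod_def fun_eq_iff sum_subtractf left_diff_distrib scaleR_diff_left)

lemma combination_uminus: "combination (\<lambda>j. - a j) = - combination a"
  by (simp add: combination_def uminus_prod_def fun_eq_iff sum_negf)

lemma continuous_combination_norm:
  "continuous_on UNIV (\<lambda>b. sobolev_norm p S (combination (\<lambda>j. b j - a j)))"
proof -
  have c: "continuous_on UNIV (\<lambda>b::nat \<Rightarrow> real. \<bar>b j - a j\<bar> powr p)" for j
    using p by (intro continuous_on_powr' continuous_intros) auto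
  show ?thesis
    unfolding sobolev_norm_combination
  proof (rule continuous_on_powr')
    show "continuous_on UNIV (\<lambda>b. \<Sum>j<k. \<bar>b j - a j\<bar> powr p * (value_energy j + gradient_energy j))"
      by (intro continuous_on_sum continuous_on_mult continuous_on_const c)
    show "\<forall>b\<in>UNIV. 0 \<le> (\<Sum>j<k. \<bar>b j - a j\<bar> powr p * (value_energy j + gradient_energy j)) \<and>
      ((\<Sum>j<k. \<bar>b j - a j\<bar> powr p * (value_energy j + gradient_energy j)) = 0 \<longrightarrow> 0 < 1 / p)"
    proof (intro ballI conjI impI sum_nonneg mult_nonneg_nonneg)
      fix j assume "j \<in> {..<k}"
      then show "0 \<le> value_energy j + gradient_energy j"
        using value_energy_pos[of j] gradient_energy_nonneg[of j] by simp
    qed (use p in auto)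
  qed (rule continuous_on_const)
qed

text \<open>The Sobolev distance of two combinations is an explicit continuous function of the
  coefficients, by \<open>sobolev_norm_combination\<close>.\<close>

lemma continuous_map_combination:
  "continuous_map (top_of_set T) (sobolev_topology p S) combination"
  unfolding continuous_map_def topspace_sobolev_topology
proof (intro conjI allI impI)
  show "combination \<in> topspace (top_of_set T) \<rightarrow> sobolev_space p S" using combination_in_sobolev by simp
  fix U assume U: "openin (sobolev_topology p S) U"
  have "open {a. combination a \<in> U}"
  proof (subst open_subopen, intro ballI)
    fix a assume "a \<in> {a. combination a \<in> U}"
    then obtain \<epsilon> where \<epsilon>: "\<epsilon> > 0" "\<And>z. z \<in> sobolev_space p S \<Longrightarrow> sobolev_norm p S (z - combination a) < \<epsilon> \<Longrightarrow> z \<in> U"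
      using U unfolding openin_sobolev_topology by blast
    let ?V = "{b. sobolev_norm p S (combination (\<lambda>j. b j - a j)) < \<epsilon>}"
    have "open ?V" by (intro open_Collect_less continuous_combination_norm continuous_on_const)
    moreover have "a \<in> ?V" using \<epsilon>(1) p by (simp add: sobolev_norm_combination)
    moreover have "?V \<subseteq> {a. combination a \<in> U}"
    proof
      fix b assume "b \<in> ?V"
      then show "b \<in> {a. combination a \<in> U}"
        using \<epsilon>(2)[OF combination_in_sobolev, of b] by (simp add: combination_diff)
    qed
    ultimately show "\<exists>V. open V \<and> a \<in> V \<and> V \<subseteq> {a. combination a \<in> U}" by (intro exI[of _ ?V] conjI)
  qed
  then show "openin (top_of_set T) {a \<in> topspace (top_of_set T). combination a \<in> U}"
    unfolding openin_open by (intro exI[of _ "{a. combination a \<in> U}"]) auto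
qed

section \<open>Genus, compactness and Rayleigh quotients of the span\<close>

definition coefficients :: "(nat \<Rightarrow> real) set" where
  "coefficients = {a. (\<forall>i\<ge>k. a i = 0) \<and> a \<noteq> (\<lambda>i. 0)}"

lemma coefficients_energy_pos:
  assumes "a \<in> coefficients"
  shows "0 < (\<Sum>j<k. \<bar>a j\<bar> powr p * value_energy j)"
proof -
  have "\<exists>j. a j \<noteq> 0" and z: "\<And>j. j \<ge> k \<Longrightarrow> a j = 0" using assms by (auto simp: coefficients_def)
  then obtain j where j: "a j \<noteq> 0" by blast
  then have "j < k" using z[of j] by (meson not_le)
  show ?thesis
  proof (rule sum_pos2[of _ j])
    show "0 < \<bar>a j\<bar> powr p * value_energy j" using j value_energy_pos[OF \<open>j < k\<close>] by simp
    show "0 \<le> \<bar>a i\<bar> powr p * value_energy i" if "i \<in> {..<k}" for i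
      using value_energy_pos[of i] that by simp
  qed (use \<open>j < k\<close> in auto)
qed

text \<open>An odd map from the span to \<open>\<real>^l\<close> without 0, composed with
  \<open>combination\<close>, would be an odd map without zeros on the sphere of dimension
  \<open>k - 1\<close>. \<open>Borsuk_Ulam\<close> excludes this for \<open>l < k\<close>.\<close>

lemma combination_genus: "krasnoselskii_genus (sobolev_topology p S) (combination ` coefficients) \<ge> enat k"
  unfolding krasnoselskii_genus_def
proof (rule Inf_greatest)
  let ?F = "combination ` coefficients"
  fix z assume "z \<in> {enat l | l. \<exists>f. continuous_map (subtopology (sobolev_topology p S) ?F)
                            (subtopology (Euclidean_space l) (- {\<lambda>i. 0})) f \<and>
                          (\<forall>w\<in>?F. f (- w) = (\<lambda>i. - f w i))}"
  then obtain l f where z: "z = enat l"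
    and f: "continuous_map (subtopology (sobolev_topology p S) ?F) (subtopology (Euclidean_space l) (- {\<lambda>i. 0})) f"
    and fodd: "\<forall>w\<in>?F. f (- w) = (\<lambda>i. - f w i)"
    unfolding mem_Collect_eq by (elim exE conjE)
  show "enat k \<le> z"
  proof (rule ccontr)
    assume "\<not> enat k \<le> z"
    then have lk: "l < k" using z by simp
    \<comment> \<open>The unit sphere of \<open>k\<close> coefficients has dimension
      \<open>k - 1\<close>, and \<open>l \<le> m\<close> makes the coordinates from \<open>m\<close>
      on vanish, as \<open>Borsuk_Ulam\<close> requires.\<close>
    define m where "m = k - 1"
    have km: "k = Suc m" using lk by (simp add: m_def)
    have ik: "i \<ge> k \<longleftrightarrow> i > m" for i unfolding km by (rule Suc_le_eq)
    have "coefficients = punctured m" unfolding coefficients_def punctured_def ik ..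
    then have sub: "unit_sphere m \<subseteq> coefficients" using unit_sphere_subset_punctured[of m] by simp
    have "continuous_map (top_of_set (unit_sphere m)) (subtopology (sobolev_topology p S) ?F) combination"
      unfolding continuous_map_in_subtopology
      using continuous_map_combination[of "unit_sphere m"] sub by (intro conjI) auto
    from this f have c: "continuous_map (top_of_set (unit_sphere m)) (subtopology (Euclidean_space l) (- {\<lambda>i. 0})) (f \<circ> combination)"
      by (rule continuous_map_compose)
    have im: "f (combination a) \<in> topspace (Euclidean_space l) - {\<lambda>i. 0}" if "a \<in> unit_sphere m" for a
    proof -
      have "(f \<circ> combination) a \<in> topspace (subtopology (Euclidean_space l) (- {\<lambda>i. 0}))"
        by (rule subsetD[OF continuous_map_image_subset_topspace[OF c] imageI]) (simp add: that)
      then show ?thesis by simp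
    qed
    have "continuous_map (top_of_set (unit_sphere m)) (Euclidean_space l) (f \<circ> combination)"
      using c by (rule continuous_map_into_fulltopology)
    then have "continuous_map (top_of_set (unit_sphere m)) (powertop_real UNIV) (f \<circ> combination)"
      unfolding Euclidean_space_def by (rule continuous_map_into_fulltopology)
    then have "continuous_on (unit_sphere m) (f \<circ> combination)"
      by (simp add: euclidean_product_topology)
    then obtain a where "a \<in> unit_sphere m" "(f \<circ> combination) a = (\<lambda>i. 0)"
    proof (rule Borsuk_Ulam)
      fix a assume a: "a \<in> unit_sphere m"
      show "(f \<circ> combination) (\<lambda>i. - a i) = (\<lambda>i. - (f \<circ> combination) a i)"
        unfolding comp_def combination_uminus by (rule fodd[rule_format, OF imageI[OF subsetD[OF sub a]]])
      show "(f \<circ> combination) a i = 0" if "i \<ge> m" for i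
        using im[OF a] that lk km by (auto simp: topspace_Euclidean_space)
    qed
    then show False using im[of a] by simp
  qed
qed

text \<open>The elements of unit L^p norm are the image of the coefficient set \<open>K\<close>,
  which is closed, and bounded because every \<open>value_energy\<close> is positive.\<close>

lemma combination_in_genus_family: "combination ` coefficients \<in> genus_family k p S"
proof -
  let ?F = "combination ` coefficients"
  have p0: "1 / p \<noteq> 0" using p by simp
  have nz: "sobolev_norm p S (combination a) \<noteq> 0" if "a \<in> coefficients" for a
  proof -
    have "(\<Sum>j<k. \<bar>a j\<bar> powr p * value_energy j) \<le> (\<Sum>j<k. \<bar>a j\<bar> powr p * (value_energy j + gradient_energy j))"
      using gradient_energy_nonneg by (intro sum_mono mult_left_mono) auto
    then show ?thesis using coefficients_energy_pos[OF that] by (simp add: sobolev_norm_combination)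
  qed
  have "compactin (sobolev_topology p S) (?F \<inter> {w. Lp_norm p M (fst w) = 1})"
  proof -
    define K where "K = {a. (\<forall>i\<ge>k. a i = 0) \<and> (\<Sum>j<k. \<bar>a j\<bar> powr p * value_energy j) = 1}"
    have KC: "a \<in> coefficients" if "a \<in> K" for a
    proof -
      have "a \<noteq> (\<lambda>i. 0)" using that p by (auto simp: K_def)
      then show ?thesis using that by (simp add: K_def coefficients_def)
    qed
    have N: "Lp_norm p M (fst (combination a)) = (\<Sum>j<k. \<bar>a j\<bar> powr p * value_energy j) powr (1 / p)" for a
      by (simp add: Lp_norm_def value_integral(2))
    have one: "X powr (1 / p) = 1 \<longleftrightarrow> X = 1" if "0 < X" for X :: real
    proof
      assume "X powr (1 / p) = 1"
      then have "(X powr (1 / p)) powr p = 1" by simp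
      then show "X = 1" using that p by (simp add: powr_powr)
    qed simp
    have "?F \<inter> {w. Lp_norm p M (fst w) = 1} = combination ` K"
    proof (rule subset_antisym; rule subsetI)
      fix w assume "w \<in> ?F \<inter> {w. Lp_norm p M (fst w) = 1}"
      then obtain a where a: "a \<in> coefficients" "w = combination a" "Lp_norm p M (fst (combination a)) = 1" by auto
      then have "a \<in> K" using one[OF coefficients_energy_pos[OF a(1)]] by (simp add: K_def N coefficients_def)
      then show "w \<in> combination ` K" using a by blast
    next
      fix w assume "w \<in> combination ` K"
      then obtain a where a: "a \<in> K" "w = combination a" by blast
      then have "Lp_norm p M (fst (combination a)) = 1" by (simp add: N K_def)
      then show "w \<in> ?F \<inter> {w. Lp_norm p M (fst w) = 1}" using a KC by simp
    qed
    moreover have "compact K"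
    proof (rule compact_coordinate_box)
      have "continuous_on UNIV (\<lambda>a::nat \<Rightarrow> real. \<bar>a j\<bar> powr p)" for j
        using p by (intro continuous_on_powr' continuous_intros) auto
      then have "continuous_on UNIV (\<lambda>a. \<Sum>j<k. \<bar>a j\<bar> powr p * value_energy j)"
        by (intro continuous_on_sum continuous_on_mult continuous_on_const)
      moreover have "K = (\<Inter>i\<in>{k..}. {a. a i = 0}) \<inter> {a. (\<Sum>j<k. \<bar>a j\<bar> powr p * value_energy j) = 1}"
        by (auto simp: K_def)
      ultimately show "closed K"
        by (auto intro!: closed_Int closed_INT closed_Collect_eq continuous_on_component continuous_on_const)
    next
      fix a i assume a: "a \<in> K"
      define R where "R = (\<Sum>j<k. (1 / value_energy j) powr (1 / p))"
      have R: "(1 / value_energy j) powr (1 / p) \<le> R" if "j < k" for j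
        unfolding R_def using that by (intro member_le_sum) auto
      show "\<bar>a i\<bar> \<le> (\<Sum>j<k. (1 / value_energy j) powr (1 / p))"
      proof (cases "i < k")
        case True
        have "\<bar>a i\<bar> powr p * value_energy i \<le> (\<Sum>j<k. \<bar>a j\<bar> powr p * value_energy j)"
          using True value_energy_pos by (intro member_le_sum mult_nonneg_nonneg) (auto intro: less_imp_le)
        also have "\<dots> = 1" using a by (simp add: K_def)
        finally have "\<bar>a i\<bar> powr p \<le> 1 / value_energy i"
          using value_energy_pos[OF True] by (simp add: pos_le_divide_eq)
        then have "(\<bar>a i\<bar> powr p) powr (1 / p) \<le> (1 / value_energy i) powr (1 / p)"
          using p by (intro powr_mono2) auto
        then have "\<bar>a i\<bar> \<le> (1 / value_energy i) powr (1 / p)" using p by (simp add: powr_powr)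
        then show ?thesis using R[OF True] by (simp add: R_def)
      next
        case False
        then show ?thesis using a by (auto simp: K_def intro!: sum_nonneg)
      qed
    qed
    ultimately show ?thesis
      using image_compactin[OF _ continuous_map_combination[of UNIV], of K] by simp
  qed
  moreover have "uminus ` ?F = ?F"
  proof -
    have m: "(\<lambda>i. - a i) \<in> coefficients" if "a \<in> coefficients" for a
      using that unfolding coefficients_def fun_eq_iff by simp
    have F: "- w \<in> ?F" if w: "w \<in> ?F" for w
    proof -
      obtain a where a: "a \<in> coefficients" "w = combination a" using w by blast
      show ?thesis unfolding a(2) combination_uminus[symmetric] by (rule imageI[OF m[OF a(1)]])
    qed
    show ?thesis
    proof (rule subset_antisym)
      show "uminus ` ?F \<subseteq> ?F" using F by blast
      show "?F \<subseteq> uminus ` ?F"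
      proof
        fix w assume "w \<in> ?F"
        then show "w \<in> uminus ` ?F" using F[of w] by (intro image_eqI[of _ _ "- w"]) (simp_all add: prod_eq_iff fun_eq_iff)
      qed
    qed
  qed
  moreover have "?F \<subseteq> sobolev_space p S - {w. sobolev_norm p S w = 0}"
    using combination_in_sobolev nz by (intro image_subsetI) simp
  ultimately show ?thesis
    unfolding genus_family_def mem_Collect_eq using combination_genus by (intro conjI)
qed

text \<open>Numerator and denominator are sums with common weights, so the quotient inherits the
  bound on the individual quotients.\<close>

lemma rayleigh_combination:
  assumes "a \<in> coefficients"
  shows "rayleigh_quotient p S (combination a) \<le> ennreal \<Lambda>"
proof -
  let ?c = "\<Sum>j<k. \<bar>a j\<bar> powr p * value_energy j" and ?d = "\<Sum>j<k. \<bar>a j\<bar> powr p * gradient_energy j"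
  have c: "(\<integral>\<^sup>+x. ennreal (\<bar>fst (combination a) x\<bar> powr p) \<partial>M) = ennreal ?c"
    unfolding value_integral(2)[symmetric] by (rule nn_integral_eq_integral[OF value_integral(1)]) simp
  have d: "(\<integral>\<^sup>+x. ennreal (norm (snd (combination a) x) powr p) \<partial>M) = ennreal ?d"
    unfolding gradient_integral(2)[symmetric] by (rule nn_integral_eq_integral[OF gradient_integral(1)]) simp
  have "?d \<le> (\<Sum>j<k. \<bar>a j\<bar> powr p * (\<Lambda> * value_energy j))"
    using ray by (intro sum_mono mult_left_mono) (auto simp: value_energy_def gradient_energy_def)
  also have "\<dots> = \<Lambda> * ?c" by (simp add: sum_distrib_left mult_ac)
  finally have "?d / ?c \<le> \<Lambda>" using coefficients_energy_pos[OF assms] by (simp add: pos_divide_le_eq)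
  moreover have "0 \<le> ?d" using gradient_energy_nonneg by (intro sum_nonneg) simp
  ultimately show ?thesis
    unfolding rayleigh_quotient_def c d using coefficients_energy_pos[OF assms]
    by (simp add: divide_ennreal ennreal_leI)
qed

theorem variational_eigenvalue_le: "variational_eigenvalue k p S \<le> ennreal \<Lambda>"
  unfolding variational_eigenvalue_def
  by (rule INF_lower2[OF combination_in_genus_family]) (auto intro!: SUP_least rayleigh_combination)

end

subsection \<open>Displacing a domain\<close>

definition displaced :: "'a::euclidean_space set \<Rightarrow> 'a \<Rightarrow> 'a set" where
  "displaced \<Omega> h = {x \<in> \<Omega>. x + h \<notin> \<Omega>}"

lemma emeasure_lborel_translate:
  assumes "A \<in> sets borel"
  shows "emeasure lborel {x. x + h \<in> A} = emeasure lborel (A :: 'a::euclidean_space set)"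
proof -
  have "emeasure lborel A = emeasure (distr lborel borel ((+) h)) A"
    by (simp add: lborel_distr_plus)
  also have "\<dots> = emeasure lborel {x. x + h \<in> A}"
    using assms by (subst emeasure_distr) (auto simp: vimage_def add.commute)
  finally show ?thesis by simp
qed

lemma displaced_borel:
  assumes "open \<Omega>"
  shows "displaced \<Omega> h \<in> sets borel"
proof -
  have "open {x. x + h \<in> \<Omega>}"
    using continuous_open_preimage[of UNIV "\<lambda>x. x + h" \<Omega>] assms
    by (simp add: vimage_def continuous_intros)
  moreover have "displaced \<Omega> h = \<Omega> - {x. x + h \<in> \<Omega>}" by (auto simp: displaced_def)
  ultimately show ?thesis using assms by auto
qed

lemma bounded_borel_fmeasurable: "bounded A \<Longrightarrow> A \<in> sets borel \<Longrightarrow> A \<in> fmeasurable lborel"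
  by (intro fmeasurableI) (auto dest: emeasure_bounded_finite)

lemma displaced_fmeasurable:
  "open \<Omega> \<Longrightarrow> bounded \<Omega> \<Longrightarrow> displaced \<Omega> h \<in> fmeasurable lborel"
  by (intro bounded_borel_fmeasurable displaced_borel) (auto simp: displaced_def intro: bounded_subset)

text \<open>A point that leaves under \<open>h + h'\<close> either leaves under \<open>h\<close> or
  is moved by \<open>h\<close> to a point that leaves under \<open>h'\<close>; the second set is a
  translate of \<open>displaced \<Omega> h'\<close>.\<close>

lemma measure_displaced_add:
  assumes "open \<Omega>" "bounded \<Omega>"
  shows "measure lborel (displaced \<Omega> (h + h')) \<le> measure lborel (displaced \<Omega> h) + measure lborel (displaced \<Omega> h')"
proof -
  let ?T = "{x. x + h \<in> displaced \<Omega> h'}"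
  have e: "emeasure lborel ?T = emeasure lborel (displaced \<Omega> h')"
    by (rule emeasure_lborel_translate[OF displaced_borel[OF assms(1)]])
  have Tb: "?T \<in> sets borel"
  proof -
    have "(\<lambda>x. x + h) \<in> borel_measurable borel" by measurable
    from measurable_sets[OF this displaced_borel[OF assms(1)]] show ?thesis by (simp add: vimage_def)
  qed
  have T: "?T \<in> fmeasurable lborel"
    using displaced_fmeasurable[OF assms, of h'] e Tb by (simp add: fmeasurable_def)
  have "displaced \<Omega> (h + h') \<subseteq> displaced \<Omega> h \<union> ?T"
    by (auto simp: displaced_def add.assoc)
  then have "measure lborel (displaced \<Omega> (h + h')) \<le> measure lborel (displaced \<Omega> h \<union> ?T)"
    using displaced_fmeasurable[OF assms] T displaced_borel[OF assms(1)]
    by (intro measure_mono_fmeasurable fmeasurable.Un) auto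
  also have "\<dots> \<le> measure lborel (displaced \<Omega> h) + measure lborel ?T"
    using displaced_borel[OF assms(1)] Tb by (intro measure_Un_le) auto
  also have "measure lborel ?T = measure lborel (displaced \<Omega> h')" using e by (simp add: measure_def)
  finally show ?thesis .
qed

lemma measure_displaced_sum:
  assumes "open \<Omega>" "bounded \<Omega>" "finite I"
  shows "measure lborel (displaced \<Omega> (\<Sum>i\<in>I. v i)) \<le> (\<Sum>i\<in>I. measure lborel (displaced \<Omega> (v i)))"
  using assms(3)
proof (induction I)
  case empty
  have "displaced \<Omega> 0 = {}" by (simp add: displaced_def)
  then show ?case by simp
next
  case (insert i I)
  then show ?case using measure_displaced_add[OF assms(1,2), of "v i" "\<Sum>i\<in>I. v i"] by simp
qed

text \<open>On average over all displacements in a cube of volume \<open>4 |\<Omega>|\<close>, at most a quarter of \<open>\<Omega>\<close>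
  stays inside \<open>\<Omega>\<close>.\<close>

lemma exists_large_displacement:
  fixes \<Omega> :: "(real ^ 'n) set"
  assumes \<Omega>: "open \<Omega>" "bounded \<Omega>" and V: "V = measure lborel \<Omega>" "V > 0"
    and R: "R > 0" "(2 * R) ^ CARD('n) = 4 * V"
  obtains h where "\<And>i. \<bar>h $ i\<bar> \<le> R" "V / 2 \<le> measure lborel (displaced \<Omega> h)"
proof (rule ccontr)
  note found = that
  assume neg: "\<not> thesis"
  have neg': "measure lborel (displaced \<Omega> h) \<le> V / 2" if "\<forall>i. \<bar>h $ i\<bar> \<le> R" for h
  proof (rule ccontr)
    assume "\<not> ?thesis"
    then have "V / 2 \<le> measure lborel (displaced \<Omega> h)" by simp
    then show False using notE[OF neg found[of h]] that by blast
  qed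
  define a b :: "real ^ 'n" where "a = (\<chi> i. - R)" and "b = (\<chi> i. R)"
  have box: "h \<in> cbox a b \<longleftrightarrow> (\<forall>i. \<bar>h $ i\<bar> \<le> R)" for h
    by (auto simp: mem_box_cart a_def b_def abs_le_iff minus_le_iff)
  have \<Omega>b [measurable]: "\<Omega> \<in> sets borel" using \<Omega> by simp
  have fin: "\<Omega> \<in> fmeasurable lborel" by (rule bounded_borel_fmeasurable[OF \<Omega>(2) \<Omega>b])
  have eV: "emeasure lborel \<Omega> = ennreal V" using fin V by (simp add: emeasure_eq_measure2)
  have small: "ennreal (V / 2) \<le> emeasure lborel {x \<in> \<Omega>. x + h \<in> \<Omega>}" if "h \<in> cbox a b" for h
  proof -
    have d: "measure lborel (displaced \<Omega> h) \<le> V / 2" using neg'[of h] box[of h] that by simp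
    have eq: "{x \<in> \<Omega>. x + h \<in> \<Omega>} = \<Omega> - displaced \<Omega> h" by (auto simp: displaced_def)
    have "measure lborel (\<Omega> - displaced \<Omega> h) = V - measure lborel (displaced \<Omega> h)"
      unfolding V(1) using fin displaced_fmeasurable[OF \<Omega>, of h]
      by (intro measurable_measure_Diff) (auto simp: displaced_def dest: fmeasurableD)
    then have "V / 2 \<le> measure lborel {x \<in> \<Omega>. x + h \<in> \<Omega>}" using d unfolding eq by simp
    moreover have "{x \<in> \<Omega>. x + h \<in> \<Omega>} \<in> fmeasurable lborel"
      unfolding eq using fin displaced_fmeasurable[OF \<Omega>, of h] by (intro fmeasurable_Diff) (auto dest: fmeasurableD)
    ultimately show ?thesis by (simp add: emeasure_eq_measure2 ennreal_leI)
  qed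
  define f :: "(real ^ 'n) \<times> (real ^ 'n) \<Rightarrow> ennreal"
    where "f = (\<lambda>(h, x). indicator \<Omega> x * indicator \<Omega> (x + h))"
  have fm: "f \<in> borel_measurable (lborel \<Otimes>\<^sub>M lborel)" unfolding f_def by measurable
  have inner: "(\<integral>\<^sup>+x. f (h, x) \<partial>lborel) = emeasure lborel {x \<in> \<Omega>. x + h \<in> \<Omega>}" for h
  proof -
    have "(\<integral>\<^sup>+x. f (h, x) \<partial>lborel) = (\<integral>\<^sup>+x. indicator {x \<in> \<Omega>. x + h \<in> \<Omega>} x \<partial>lborel)"
      by (rule nn_integral_cong) (simp add: f_def indicator_def)
    also have "\<dots> = emeasure lborel {x \<in> \<Omega>. x + h \<in> \<Omega>}"
      by (rule nn_integral_indicator) measurable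
    finally show ?thesis .
  qed
  \<comment> \<open>Integrating the overlap of \<open>\<Omega>\<close> with its translates over all
    \<open>h\<close> gives \<open>V * V\<close> by Fubini. If every \<open>h\<close> in the cube, of
    volume \<open>4 * V\<close>, kept overlap \<open>V / 2\<close>, the integral would be at least
    \<open>2 * V * V\<close>.\<close>
  have "ennreal (V / 2) * emeasure lborel (cbox a b) = (\<integral>\<^sup>+h. ennreal (V / 2) * indicator (cbox a b) h \<partial>lborel)"
    by (subst nn_integral_cmult_indicator) auto
  also have "\<dots> \<le> (\<integral>\<^sup>+h. (\<integral>\<^sup>+x. f (h, x) \<partial>lborel) \<partial>lborel)"
    unfolding inner using small by (intro nn_integral_mono) (auto simp: indicator_def)
  also have "\<dots> = (\<integral>\<^sup>+x. (\<integral>\<^sup>+h. f (h, x) \<partial>lborel) \<partial>lborel)"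
    by (rule lborel_pair.Fubini[OF fm, symmetric])
  also have "\<dots> = (\<integral>\<^sup>+x. indicator \<Omega> x * emeasure lborel \<Omega> \<partial>lborel)"
  proof (rule nn_integral_cong)
    fix x :: "real ^ 'n"
    have "(\<integral>\<^sup>+h. f (h, x) \<partial>lborel) = (\<integral>\<^sup>+h. indicator \<Omega> x * indicator {h. h + x \<in> \<Omega>} h \<partial>lborel)"
      by (rule nn_integral_cong) (simp add: f_def indicator_def add.commute)
    also have "\<dots> = indicator \<Omega> x * emeasure lborel {h. h + x \<in> \<Omega>}"
      by (rule nn_integral_cmult_indicator) measurable
    finally show "(\<integral>\<^sup>+h. f (h, x) \<partial>lborel) = indicator \<Omega> x * emeasure lborel \<Omega>"
      by (simp add: emeasure_lborel_translate)
  qed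
  also have "\<dots> = emeasure lborel \<Omega> * emeasure lborel \<Omega>"
    by (subst nn_integral_multc) auto
  finally have main: "ennreal (V / 2) * emeasure lborel (cbox a b) \<le> ennreal V * ennreal V" by (simp add: eV)
  have "emeasure lborel (cbox a b) = ennreal (4 * V)"
  proof -
    have "measure lborel (cbox a b) = (\<Prod>i\<in>(UNIV::'n set). b $ i - a $ i)"
      using R by (intro content_cbox_cart) (simp add: interval_eq_empty_cart a_def b_def not_less)
    also have "\<dots> = 4 * V" using R by (simp add: a_def b_def)
    finally show ?thesis by (simp add: emeasure_eq_measure2 bounded_borel_fmeasurable)
  qed
  moreover have "ennreal (V / 2 * (4 * V)) = ennreal (V / 2) * ennreal (4 * V)" "ennreal (V * V) = ennreal V * ennreal V"
    using V(2) by (intro ennreal_mult; simp)+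
  ultimately have "ennreal (V / 2 * (4 * V)) \<le> ennreal (V * V)" using main by (simp only:)
  then have "V / 2 * (4 * V) \<le> V * V" using V(2) by (subst (asm) ennreal_le_iff) auto
  then show False using V(2) by simp
qed

text \<open>Subadditivity is used twice: on the axis components of \<open>h\<close>, one of which
  displaces at least \<open>V / (2 * n)\<close>, and on the division of that component into about
  \<open>R / r\<close> equal steps.\<close>

lemma exists_axis_displacement:
  fixes \<Omega> :: "(real ^ 'n) set"
  assumes \<Omega>: "open \<Omega>" "bounded \<Omega>" and V: "V = measure lborel \<Omega>" "V > 0"
    and R: "R > 0" "(2 * R) ^ CARD('n) = 4 * V" and r: "0 < r" "r \<le> R"
  obtains i t where "\<bar>t\<bar> \<le> r"
    "V * r / (4 * real CARD('n) * R) \<le> measure lborel (displaced \<Omega> (t *\<^sub>R axis i 1))"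
proof -
  obtain h where h: "\<And>i. \<bar>h $ i\<bar> \<le> R" "V / 2 \<le> measure lborel (displaced \<Omega> h)"
    using exists_large_displacement[OF \<Omega> V R] by blast
  let ?D = "\<lambda>v. measure lborel (displaced \<Omega> v)"
  define n where "n = real CARD('n)"
  have n: "n > 0" by (simp add: n_def)
  have "h = (\<Sum>i\<in>UNIV. h $ i *\<^sub>R axis i 1)"
    using basis_expansion[of h] by (simp add: scalar_mult_eq_scaleR)
  then have "?D h \<le> (\<Sum>i\<in>UNIV. ?D (h $ i *\<^sub>R axis i 1))"
    using measure_displaced_sum[OF \<Omega>, of UNIV "\<lambda>i. h $ i *\<^sub>R axis i 1"] by simp
  then have sum: "V / 2 \<le> (\<Sum>i\<in>UNIV. ?D (h $ i *\<^sub>R axis i 1))" using h(2) by linarith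
  have "\<exists>i. V / (2 * n) \<le> ?D (h $ i *\<^sub>R axis i 1)"
  proof (rule ccontr)
    assume "\<not> ?thesis"
    then have "(\<Sum>i\<in>UNIV. ?D (h $ i *\<^sub>R axis i 1)) < (\<Sum>i\<in>(UNIV::'n set). V / (2 * n))"
      by (intro sum_strict_mono) (auto simp: not_le)
    also have "\<dots> = V / 2" using n by (simp add: n_def)
    finally show False using sum by simp
  qed
  then obtain i where i: "V / (2 * n) \<le> ?D (h $ i *\<^sub>R axis i 1)" by blast
  \<comment> \<open>Rounding up makes the steps at most \<open>r\<close> long; since
    \<open>R / r \<ge> 1\<close> it costs at most a factor 2.\<close>
  define m where "m = nat \<lceil>R / r\<rceil>"
  have Rr: "1 \<le> R / r" using r by simp
  have m: "R / r \<le> real m" "real m \<le> 2 * (R / r)" unfolding m_def using Rr by linarith+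
  then have m0: "0 < real m" using Rr by linarith
  define t where "t = h $ i / real m"
  have "\<bar>t\<bar> = \<bar>h $ i\<bar> / real m" by (simp add: t_def)
  also have "\<dots> \<le> R / real m" using h(1) by (intro divide_right_mono) auto
  also have "\<dots> \<le> r" using m(1) m0 r by (simp add: field_simps)
  finally have t: "\<bar>t\<bar> \<le> r" .
  have "(\<Sum>j<m. t *\<^sub>R axis i 1) = h $ i *\<^sub>R (axis i 1 :: real ^ 'n)"
    unfolding sum_constant_scaleR card_lessThan scaleR_scaleR using m0 by (simp add: t_def)
  then have "?D (h $ i *\<^sub>R axis i 1) \<le> real m * ?D (t *\<^sub>R axis i 1)"
    using measure_displaced_sum[OF \<Omega>, of "{..<m}" "\<lambda>_. t *\<^sub>R axis i 1"] by simp
  also have "\<dots> \<le> 2 * (R / r) * ?D (t *\<^sub>R axis i 1)" using m(2) by (intro mult_right_mono) auto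
  finally have "V / (2 * n) \<le> 2 * (R / r) * ?D (t *\<^sub>R axis i 1)" using i by linarith
  then have "V * r / (4 * n * R) \<le> ?D (t *\<^sub>R axis i 1)" using R r n by (simp add: field_simps)
  then show thesis using that[OF t] by (simp add: n_def)
qed

subsection \<open>Projections do not increase Hausdorff measure\<close>

text \<open>\<open>W\<close> lies in a slab of width \<open>r\<close>.  A set of diameter \<open>d\<close> in a cover of \<open>S\<close> accounts for a part of
  \<open>W\<close> inside a box of volume \<open>r (2 d)\<^sup>n\<^sup>-\<^sup>1\<close>.\<close>

lemma measure_le_hausdorff_projection:
  fixes W S :: "(real ^ 'n) set"
  assumes W: "W \<in> sets borel" "\<And>x. x \<in> W \<Longrightarrow> lo \<le> x $ i \<and> x $ i \<le> lo + r"
    and r: "r > 0"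
    and line: "\<And>x. x \<in> W \<Longrightarrow> \<exists>s. x + s *\<^sub>R axis i 1 \<in> S"
  shows "ennreal (unit_ball_vol (real (CARD('n) - 1)) / (4 ^ (CARD('n) - 1) * r)) * emeasure lborel W
    \<le> hausdorff_outer (CARD('n) - 1) S"
proof -
  define m where "m = CARD('n) - 1"
  \<comment> \<open>The ratio of the gauge \<open>unit_ball_vol m * (d / 2) ^ m\<close> to the box
    volume \<open>r * (2 * d) ^ m\<close>.\<close>
  define \<kappa> where "\<kappa> = unit_ball_vol (real m) / (4 ^ m * r)"
  have \<kappa>0: "0 \<le> \<kappa>" using r by (simp add: \<kappa>_def)
  \<comment> \<open>The estimate holds for each bounded covering set separately, whatever its
    diameter; the mesh 1 is an arbitrary choice.\<close>
  have "ennreal \<kappa> * emeasure lborel W \<le> hausdorff_pre m 1 S"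
    unfolding hausdorff_pre_def
  proof (rule INF_greatest)
    fix C :: "nat \<Rightarrow> (real ^ 'n) set"
    assume "C \<in> {C. S \<subseteq> (\<Union>j. C j) \<and> (\<forall>j. bounded (C j) \<and> diameter (C j) \<le> 1)}"
    then have C: "S \<subseteq> (\<Union>j. C j)" "\<And>j. bounded (C j)" by auto
    define c where "c = (\<lambda>j. SOME y. y \<in> C j)"
    define d where "d = (\<lambda>j. diameter (C j))"
    have d0: "0 \<le> d j" for j unfolding d_def by (rule diameter_ge_0[OF C(2)])
    define p q :: "nat \<Rightarrow> real ^ 'n" where
      "p = (\<lambda>j. \<chi> l. if l = i then lo else c j $ l - d j)" and
      "q = (\<lambda>j. \<chi> l. if l = i then lo + r else c j $ l + d j)"
    \<comment> \<open>An empty covering set has gauge 0 and no centre \<open>c j\<close>, so its box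
      has to be empty.\<close>
    define B where "B = (\<lambda>j. if C j = {} then {} else cbox (p j) (q j))"
    have WB: "W \<subseteq> (\<Union>j. B j)"
    proof
      fix x assume x: "x \<in> W"
      obtain s where "x + s *\<^sub>R axis i 1 \<in> S" using line[OF x] by blast
      then obtain j where j: "x + s *\<^sub>R axis i 1 \<in> C j" using C(1) by blast
      then have cj: "c j \<in> C j" unfolding c_def by (rule someI)
      have "x \<in> cbox (p j) (q j)"
        unfolding mem_box_cart
      proof
        fix l
        show "p j $ l \<le> x $ l \<and> x $ l \<le> q j $ l"
        proof (cases "l = i")
          case False
          have "\<bar>(x + s *\<^sub>R axis i 1 - c j) $ l\<bar> \<le> norm (x + s *\<^sub>R axis i 1 - c j)"
            by (rule component_le_norm_cart)
          also have "\<dots> \<le> d j" unfolding d_def using diameter_bounded_bound[OF C(2) j cj] by (simp add: dist_norm)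
          finally have "\<bar>x $ l - c j $ l\<bar> \<le> d j" using False by (simp add: axis_def)
          then show ?thesis using False by (simp add: p_def q_def abs_le_iff)
        qed (use W(2)[OF x] in \<open>simp add: p_def q_def\<close>)
      qed
      then show "x \<in> (\<Union>j. B j)" using j by (intro UN_I[of j]) (auto simp: B_def)
    qed
    have eB: "ennreal \<kappa> * emeasure lborel (B j) \<le> hausdorff_gauge m (C j)" for j
    proof (cases "C j = {}")
      case False
      have "measure lborel (cbox (p j) (q j)) = (\<Prod>l\<in>UNIV. q j $ l - p j $ l)"
        using r d0 by (intro content_cbox_cart) (auto simp: interval_eq_empty_cart p_def q_def not_less)
      also have "\<dots> = r * (\<Prod>l\<in>UNIV - {i}. q j $ l - p j $ l)"
        by (subst prod.remove[of UNIV i]) (auto simp: p_def q_def)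
      also have "(\<Prod>l\<in>UNIV - {i}. q j $ l - p j $ l) = (\<Prod>l\<in>UNIV - {i}. 2 * d j)"
        by (rule prod.cong) (auto simp: p_def q_def)
      also have "\<dots> = (2 * d j) ^ m" by (simp add: m_def card_Diff_singleton)
      finally have mB: "measure lborel (cbox (p j) (q j)) = r * (2 * d j) ^ m" .
      have "\<kappa> * (r * (2 * d j) ^ m) = unit_ball_vol (real m) * ((2 * d j) ^ m / 4 ^ m)" using r by (simp add: \<kappa>_def)
      also have "(2 * d j) ^ m / 4 ^ m = (d j / 2) ^ m"
        unfolding power_divide[symmetric] by (rule arg_cong[where f="\<lambda>x. x ^ m"]) simp
      finally have "\<kappa> * measure lborel (cbox (p j) (q j)) = unit_ball_vol (real m) * (d j / 2) ^ m" by (simp add: mB)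
      moreover have "ennreal \<kappa> * emeasure lborel (cbox (p j) (q j)) = ennreal (\<kappa> * measure lborel (cbox (p j) (q j)))"
        by (subst emeasure_eq_measure2) (simp_all only: bounded_borel_fmeasurable[OF bounded_cbox] borel_closed
            closed_cbox ennreal_mult[OF \<kappa>0 measure_nonneg])
      ultimately show ?thesis using False by (simp add: B_def hausdorff_gauge_def d_def)
    qed (simp add: B_def)
    have "ennreal \<kappa> * emeasure lborel W \<le> ennreal \<kappa> * emeasure lborel (\<Union>j. B j)"
      by (intro mult_left_mono emeasure_mono WB) (auto simp: B_def)
    also have "\<dots> \<le> ennreal \<kappa> * suminf (\<lambda>j. emeasure lborel (B j))"
      by (intro mult_left_mono emeasure_subadditive_countably) (auto simp: B_def)
    also have "\<dots> = suminf (\<lambda>j. ennreal \<kappa> * emeasure lborel (B j))" by simp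
    also have "\<dots> \<le> suminf (\<lambda>j. hausdorff_gauge m (C j))" by (intro suminf_le eB) auto
    finally show "ennreal \<kappa> * emeasure lborel W \<le> suminf (\<lambda>j. hausdorff_gauge m (C j))" .
  qed
  also have "\<dots> \<le> hausdorff_outer m S" by (rule hausdorff_pre_le_outer) simp
  finally show ?thesis by (simp add: m_def \<kappa>_def)
qed

subsection \<open>Distributing weights into groups\<close>

text \<open>Greedy choice: a set of least cardinality with weight at least \<open>a\<close> weighs
  less than \<open>2 * a\<close>, because removing an element drops it below \<open>a\<close> and no
  element exceeds \<open>a\<close>. What is left suffices for the remaining groups.\<close>

lemma exists_weight_groups:
  fixes w :: "'z \<Rightarrow> real"
  assumes "finite Z" "\<And>z. z \<in> Z \<Longrightarrow> 0 \<le> w z" "\<And>z. z \<in> Z \<Longrightarrow> w z \<le> a" "a > 0"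
    "2 * a * real m \<le> (\<Sum>z\<in>Z. w z)"
  shows "\<exists>G. \<forall>j<m. G j \<subseteq> Z \<and> a \<le> (\<Sum>z\<in>G j. w z) \<and> (\<forall>i<m. i \<noteq> j \<longrightarrow> G i \<inter> G j = {})"
  using assms
proof (induction m arbitrary: Z)
  case 0
  then show ?case by simp
next
  case (Suc m)
  have "2 * a * real (Suc m) = 2 * a * real m + 2 * a" by (simp add: algebra_simps)
  moreover have "0 \<le> 2 * a * real m" using Suc.prems(4) by simp
  ultimately have "a \<le> (\<Sum>z\<in>Z. w z)" using Suc.prems(4,5) by linarith
  then have "Z \<subseteq> Z \<and> a \<le> (\<Sum>z\<in>Z. w z)" by simp
  from ex_has_least_nat[where P="\<lambda>T. T \<subseteq> Z \<and> a \<le> (\<Sum>z\<in>T. w z)" and m=card, OF this]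
  obtain T where T: "T \<subseteq> Z" "a \<le> (\<Sum>z\<in>T. w z)"
    and min: "\<And>T'. T' \<subseteq> Z \<and> a \<le> (\<Sum>z\<in>T'. w z) \<Longrightarrow> card T \<le> card T'"
    by auto
  have finT: "finite T" using T Suc.prems(1) finite_subset by blast
  have "T \<noteq> {}" using T(2) Suc.prems(4) by auto
  then obtain z where z: "z \<in> T" by blast
  have "card (T - {z}) < card T" using z finT by (rule card_Diff1_less[rotated])
  moreover have "T - {z} \<subseteq> Z" using T(1) by blast
  ultimately have "(\<Sum>z\<in>T - {z}. w z) < a" using min[of "T - {z}"] by linarith
  then have T2: "(\<Sum>z\<in>T. w z) < 2 * a" using sum.remove[OF finT z, of w] Suc.prems(3)[of z] z T(1) by auto
  have "(\<Sum>z\<in>Z. w z) = (\<Sum>z\<in>Z - T. w z) + (\<Sum>z\<in>T. w z)" by (rule sum.subset_diff[OF T(1) Suc.prems(1)])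
  then have "2 * a * real m \<le> (\<Sum>z\<in>Z - T. w z)" using T2 Suc.prems(5) by (simp add: algebra_simps)
  then obtain G where G: "\<forall>j<m. G j \<subseteq> Z - T \<and> a \<le> (\<Sum>z\<in>G j. w z) \<and> (\<forall>i<m. i \<noteq> j \<longrightarrow> G i \<inter> G j = {})"
    using Suc.IH[of "Z - T"] Suc.prems by auto
  define H where "H = G(m := T)"
  have "H j \<subseteq> Z \<and> a \<le> (\<Sum>z\<in>H j. w z)" if "j < Suc m" for j
  proof (cases "j = m")
    case False
    then have "G j \<subseteq> Z - T" "a \<le> (\<Sum>z\<in>G j. w z)" using that G by auto
    then show ?thesis using False by (auto simp: H_def)
  qed (use T in \<open>simp add: H_def\<close>)
  moreover have "H i \<inter> H j = {}" if ij: "i < Suc m" "j < Suc m" "i \<noteq> j" for i j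
  proof -
    have dT: "G l \<inter> T = {}" if "l < m" for l using G that by blast
    consider "i = m" "j < m" | "j = m" "i < m" | "i < m" "j < m" using ij by linarith
    then show ?thesis
    proof cases
      case 3
      then show ?thesis using G ij(3) by (simp add: H_def)
    qed (use dT in \<open>auto simp: H_def\<close>)
  qed
  ultimately show ?case by (intro exI[of _ H]) simp
qed

subsection \<open>Test functions on a grid\<close>

text \<open>Three nested cubes in units of \<open>r\<close>: cells are half-open in order to
  partition space, \<open>grid_block\<close> contains whatever is reached from the cell by moving at
  most \<open>r\<close> along an axis, and outside \<open>grid_support\<close> the cutoff
  vanishes.\<close>

definition grid_cell :: "real \<Rightarrow> ('n::finite \<Rightarrow> int) \<Rightarrow> (real ^ 'n) set" where
  "grid_cell r z = {x. \<forall>i. of_int (z i) \<le> x $ i / r \<and> x $ i / r < of_int (z i) + 1}"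

definition grid_block :: "real \<Rightarrow> ('n::finite \<Rightarrow> int) \<Rightarrow> (real ^ 'n) set" where
  "grid_block r z = {x. \<forall>i. -1 \<le> x $ i / r - of_int (z i) \<and> x $ i / r - of_int (z i) \<le> 2}"

definition grid_support :: "real \<Rightarrow> ('n::finite \<Rightarrow> int) \<Rightarrow> (real ^ 'n) set" where
  "grid_support r z = {x. \<forall>i. -2 < x $ i / r - of_int (z i) \<and> x $ i / r - of_int (z i) < 3}"

text \<open>Supports are open cubes of side \<open>5 * r\<close>, so indices that differ by a
  nonzero multiple of 5 in some coordinate keep them apart.\<close>

definition grid_colour :: "('n::finite \<Rightarrow> int) \<Rightarrow> 'n \<Rightarrow> int" where
  "grid_colour z = (\<lambda>i. z i mod 5)"

lemma grid_block_subset_support: "grid_block r z \<subseteq> grid_support r z"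
proof
  fix x assume "x \<in> grid_block r z"
  then have x: "-1 \<le> x $ i / r - of_int (z i)" "x $ i / r - of_int (z i) \<le> 2" for i
    by (simp_all add: grid_block_def)
  have "-2 < x $ i / r - of_int (z i) \<and> x $ i / r - of_int (z i) < 3" for i using x[of i] by linarith
  then show "x \<in> grid_support r z" by (simp add: grid_support_def)
qed

lemma grid_support_disjoint:
  assumes "grid_colour z = grid_colour z'" "z \<noteq> z'"
  shows "grid_support r z \<inter> grid_support r z' = {}"
proof (rule equals0I)
  fix x assume "x \<in> grid_support r z \<inter> grid_support r z'"
  then have x: "-2 < x $ i / r - of_int (z i)" "x $ i / r - of_int (z i) < 3"
     "-2 < x $ i / r - of_int (z' i)" "x $ i / r - of_int (z' i) < 3" for i
    by (simp_all add: grid_support_def)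
  obtain i where i: "z i \<noteq> z' i" using assms(2) by (auto simp: fun_eq_iff)
  have "z i mod 5 = z' i mod 5" using fun_cong[OF assms(1), of i] by (simp add: grid_colour_def)
  then have "5 dvd z i - z' i" by (simp add: mod_eq_dvd_iff)
  then have "\<bar>z i - z' i\<bar> \<ge> 5" using i dvd_imp_le_int[of "z i - z' i" 5] by simp
  moreover have "\<bar>real_of_int (z i) - real_of_int (z' i)\<bar> < 5" using x[of i] by linarith
  then have "\<bar>z i - z' i\<bar> < 5" by linarith
  ultimately show False by simp
qed

lemma closed_coordinate_ge: "closed {x::real ^ 'n. c \<le> x $ i / r}" and closed_coordinate_le: "closed {x::real ^ 'n. x $ i / r \<le> c}"
  unfolding divide_inverse
  by (intro closed_Collect_le continuous_on_const continuous_on_mult_right continuous_on_component[of UNIV] | 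
      rule linear_continuous_on[OF bounded_linear_vec_nth])+

lemma open_coordinate_gt: "open {x::real ^ 'n. c < x $ i / r}" and open_coordinate_lt: "open {x::real ^ 'n. x $ i / r < c}"
  unfolding divide_inverse
  by (intro open_Collect_less continuous_on_const continuous_on_mult_right |
      rule linear_continuous_on[OF bounded_linear_vec_nth])+

lemma grid_cell_borel: "grid_cell r z \<in> sets borel"
proof -
  have "grid_cell r z = (\<Inter>i\<in>UNIV. {x. of_int (z i) \<le> x $ i / r} \<inter> {x. x $ i / r < of_int (z i) + 1})"
    by (auto simp: grid_cell_def)
  also have "\<dots> \<in> sets borel"
    by (intro sets.finite_INT sets.Int borel_closed[OF closed_coordinate_ge] borel_open[OF open_coordinate_lt]) auto
  finally show ?thesis .
qed

lemma grid_block_borel: "grid_block r z \<in> sets borel"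
proof -
  have "grid_block r z = (\<Inter>i\<in>UNIV. {x. of_int (z i) - 1 \<le> x $ i / r} \<inter> {x. x $ i / r \<le> of_int (z i) + 2})"
    by (auto simp: grid_block_def algebra_simps)
  also have "\<dots> \<in> sets borel"
    by (intro sets.finite_INT sets.Int borel_closed[OF closed_coordinate_ge] borel_closed[OF closed_coordinate_le]) auto
  finally show ?thesis .
qed

lemma grid_support_borel: "grid_support r z \<in> sets borel"
proof -
  have "grid_support r z = (\<Inter>i\<in>UNIV. {x. of_int (z i) - 2 < x $ i / r} \<inter> {x. x $ i / r < of_int (z i) + 3})"
    by (auto simp: grid_support_def algebra_simps)
  also have "\<dots> \<in> sets borel"
    by (intro sets.finite_INT sets.Int borel_open[OF open_coordinate_gt] borel_open[OF open_coordinate_lt]) auto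
  finally show ?thesis .
qed

lemma grid_cell_bounds:
  assumes "x \<in> grid_cell r z" "r > 0"
  shows "r * of_int (z i) \<le> x $ i" "x $ i \<le> r * of_int (z i) + r"
proof -
  have "of_int (z i) \<le> x $ i / r" "x $ i / r < of_int (z i) + 1" using assms(1) by (auto simp: grid_cell_def)
  then have "of_int (z i) * r \<le> x $ i" "x $ i < (of_int (z i) + 1) * r"
    using assms(2) by (simp_all add: pos_le_divide_eq pos_divide_less_eq)
  then show "r * of_int (z i) \<le> x $ i" "x $ i \<le> r * of_int (z i) + r" by (simp_all add: algebra_simps)
qed

lemma measure_grid_cell_le:
  fixes z :: "'n::finite \<Rightarrow> int"
  assumes "A \<in> sets borel" "A \<subseteq> grid_cell r z" "r > 0"
  shows "measure lborel A \<le> r ^ CARD('n)"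
proof -
  define a b :: "real ^ 'n" where "a = (\<chi> i. r * of_int (z i))" and "b = (\<chi> i. r * of_int (z i) + r)"
  have "A \<subseteq> cbox a b"
  proof
    fix x assume "x \<in> A"
    then have "x \<in> grid_cell r z" using assms(2) by blast
    from grid_cell_bounds[OF this assms(3)] show "x \<in> cbox a b" by (simp add: mem_box_cart a_def b_def)
  qed
  then have "measure lborel A \<le> measure lborel (cbox a b)"
    using assms(1) by (intro measure_mono_fmeasurable) (auto intro: bounded_borel_fmeasurable)
  also have "\<dots> = (\<Prod>i\<in>(UNIV::'n set). b $ i - a $ i)"
    using assms(3) by (intro content_cbox_cart) (simp add: interval_eq_empty_cart a_def b_def not_less)
  also have "\<dots> = r ^ CARD('n)" by (simp add: a_def b_def)
  finally show ?thesis .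
qed

text \<open>The segment from a point of \<open>\<Omega>\<close> to its image outside
  \<open>\<Omega>\<close> is connected, so it meets the frontier. Its length is at most
  \<open>r\<close>, so the meeting point is still in the block.\<close>

lemma displaced_cell_hausdorff:
  fixes \<Omega> :: "(real ^ 'n) set"
  assumes \<Omega>: "open \<Omega>" and r: "r > 0" and t: "\<bar>t\<bar> \<le> r"
  shows "ennreal (unit_ball_vol (real (CARD('n) - 1)) / (4 ^ (CARD('n) - 1) * r)) *
      emeasure lborel (grid_cell r z \<inter> displaced \<Omega> (t *\<^sub>R axis i 1))
    \<le> hausdorff_outer (CARD('n) - 1) (frontier \<Omega> \<inter> grid_block r z)"
proof (rule measure_le_hausdorff_projection[OF _ _ r])
  show "grid_cell r z \<inter> displaced \<Omega> (t *\<^sub>R axis i 1) \<in> sets borel"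
    by (intro sets.Int grid_cell_borel displaced_borel \<Omega>)
next
  fix x assume "x \<in> grid_cell r z \<inter> displaced \<Omega> (t *\<^sub>R axis i 1)"
  then show "r * of_int (z i) \<le> x $ i \<and> x $ i \<le> r * of_int (z i) + r"
    using grid_cell_bounds[OF _ r] by blast
next
  fix x assume x: "x \<in> grid_cell r z \<inter> displaced \<Omega> (t *\<^sub>R axis i 1)"
  let ?L = "closed_segment x (x + t *\<^sub>R axis i 1)"
  have "x \<in> \<Omega>" "x + t *\<^sub>R axis i 1 \<notin> \<Omega>" using x by (auto simp: displaced_def)
  then have "?L \<inter> \<Omega> \<noteq> {}" "?L - \<Omega> \<noteq> {}" by auto
  then have "?L \<inter> frontier \<Omega> \<noteq> {}" by (intro connected_Int_frontier connected_segment)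
  then obtain y where y: "y \<in> ?L" "y \<in> frontier \<Omega>" by blast
  then obtain s where s: "0 \<le> s" "s \<le> 1" "y = (1 - s) *\<^sub>R x + s *\<^sub>R (x + t *\<^sub>R axis i 1)"
    unfolding in_segment by blast
  have ys: "y = x + (s * t) *\<^sub>R axis i 1" unfolding s(3) by (simp add: algebra_simps)
  have "\<bar>s * t\<bar> \<le> 1 * r" unfolding abs_mult using s t by (intro mult_mono) auto
  then have st: "\<bar>s * t / r\<bar> \<le> 1" using r by (simp add: abs_divide)
  have "-1 \<le> y $ j / r - of_int (z j) \<and> y $ j / r - of_int (z j) \<le> 2" for j
  proof -
    have c: "of_int (z j) \<le> x $ j / r" "x $ j / r < of_int (z j) + 1" using x by (auto simp: grid_cell_def)
    define \<epsilon> where "\<epsilon> = (if j = i then s * t / r else 0)"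
    have "y $ j / r = x $ j / r + \<epsilon>"
      unfolding ys \<epsilon>_def by (simp add: axis_def add_divide_distrib)
    moreover have "\<bar>\<epsilon>\<bar> \<le> 1" using st by (auto simp: \<epsilon>_def)
    ultimately show ?thesis using c by linarith
  qed
  then have "y \<in> grid_block r z" by (simp add: grid_block_def)
  then show "\<exists>s. x + s *\<^sub>R axis i 1 \<in> frontier \<Omega> \<inter> grid_block r z"
    using y(2) unfolding ys by blast
qed

section \<open>Test functions attached to groups of cells\<close>

definition grid_function :: "real \<Rightarrow> ('n::finite \<Rightarrow> int) set \<Rightarrow> real ^ 'n \<Rightarrow> real" where
  "grid_function r G x = (\<Sum>z\<in>G. cube_cutoff r (\<chi> i. of_int (z i)) x)"

lemma smooth_grid_function: "smooth_on UNIV (grid_function r G)"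
  unfolding grid_function_def[abs_def] by (intro smooth_on_sum smooth_cube_cutoff open_UNIV)

lemma gradient_grid_function:
  "gradient (grid_function r G) x = (\<Sum>z\<in>G. gradient (cube_cutoff r (\<chi> i. of_int (z i))) x)"
proof (rule gradient_eqI)
  show "(grid_function r G has_derivative
      (\<lambda>v. \<Sum>z\<in>G. frechet_derivative (cube_cutoff r (\<chi> i. of_int (z i))) (at x) v)) (at x)"
    unfolding grid_function_def[abs_def]
    by (intro has_derivative_sum smooth_on_has_derivative[OF smooth_cube_cutoff UNIV_I])
  show "(\<Sum>z\<in>G. gradient (cube_cutoff r (\<chi> i. of_int (z i))) x) \<bullet> v =
      (\<Sum>z\<in>G. frechet_derivative (cube_cutoff r (\<chi> i. of_int (z i))) (at x) v)" for v
    by (simp add: inner_sum_left gradient_eq_frechet[OF smooth_cube_cutoff])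
qed

lemma cube_cutoff_outside_support:
  assumes "x \<notin> grid_support r z"
  shows "cube_cutoff r (\<chi> i. of_int (z i)) x = 0" "gradient (cube_cutoff r (\<chi> i. of_int (z i))) x = 0"
proof -
  obtain i where "x $ i / r - of_int (z i) \<le> -2 \<or> 3 \<le> x $ i / r - of_int (z i)"
    using assms by (auto simp: grid_support_def not_less)
  then have i: "x $ i / r - (\<chi> i. of_int (z i)) $ i \<le> -2 \<or> 3 \<le> x $ i / r - (\<chi> i. of_int (z i)) $ i" by simp
  show "cube_cutoff r (\<chi> i. of_int (z i)) x = 0" "gradient (cube_cutoff r (\<chi> i. of_int (z i))) x = 0"
    using cube_cutoff_outside[OF i] by auto
qed

lemma grid_function_outside:
  assumes "x \<notin> (\<Union>z\<in>G. grid_support r z)"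
  shows "grid_function r G x = 0" "gradient (grid_function r G) x = 0"
proof -
  have n: "x \<notin> grid_support r z" if "z \<in> G" for z using assms that by blast
  show "grid_function r G x = 0" unfolding grid_function_def
    by (rule sum.neutral) (simp add: n cube_cutoff_outside_support)
  show "gradient (grid_function r G) x = 0" unfolding gradient_grid_function
    by (rule sum.neutral) (simp add: n cube_cutoff_outside_support)
qed

text \<open>Supports of one colour are disjoint, so at most one cutoff contributes at a point and
  the bound does not grow with \<open>G\<close>.\<close>

lemma norm_gradient_grid_function:
  fixes G :: "('n::finite \<Rightarrow> int) set"
  assumes "finite G" "\<And>z. z \<in> G \<Longrightarrow> grid_colour z = c" "r > 0"
  shows "norm (gradient (grid_function r G) x) \<le> 4 * real CARD('n) / r"
proof (cases "x \<in> (\<Union>z\<in>G. grid_support r z)")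
  case True
  then obtain z where z: "z \<in> G" "x \<in> grid_support r z" by blast
  have "x \<notin> grid_support r z'" if "z' \<in> G - {z}" for z'
    using grid_support_disjoint[of z z' r] assms(2)[OF z(1)] assms(2)[of z'] that z(2) by auto
  then have "(\<Sum>z'\<in>G - {z}. gradient (cube_cutoff r (\<chi> i. of_int (z' i))) x) = 0"
    by (intro sum.neutral ballI cube_cutoff_outside_support)
  then have "gradient (grid_function r G) x = gradient (cube_cutoff r (\<chi> i. of_int (z i))) x"
    unfolding gradient_grid_function by (subst sum.remove[OF assms(1) z(1)]) simp
  then show ?thesis using norm_gradient_cube_cutoff[OF assms(3)] by simp
next
  case False
  then show ?thesis using grid_function_outside(2)[OF False] assms(3) by simp
qed

lemma grid_function_nonneg: "0 \<le> grid_function r G x"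
  unfolding grid_function_def by (intro sum_nonneg cube_cutoff_nonneg)

lemma grid_function_lower:
  fixes G :: "('n::finite \<Rightarrow> int) set"
  assumes "finite G" "z \<in> G" "x \<in> grid_block r z"
  shows "exp (-2) ^ CARD('n) \<le> grid_function r G x"
proof -
  have "exp (-2) ^ CARD('n) \<le> cube_cutoff r (\<chi> i. of_int (z i)) x"
    using assms(3) by (intro cube_cutoff_lower) (auto simp: grid_block_def)
  also have "\<dots> \<le> grid_function r G x"
    unfolding grid_function_def using assms by (intro member_le_sum cube_cutoff_nonneg)
  finally show ?thesis .
qed

lemma sets_surface_measure_Int: "A \<in> sets borel \<Longrightarrow> S \<inter> A \<in> sets (surface_measure S)"
  by (auto simp: sets_surface_measure sets_restrict_space)

text \<open>The gradient energy is charged to the supports and the value energy to the blocks. The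
  blocks are disjoint because the larger supports are, so their areas add up.\<close>

lemma grid_energies:
  fixes G :: "('n::finite \<Rightarrow> int) set" and S :: "(real ^ 'n) set"
  assumes S: "smooth_hypersurface S" "compact S" and p: "p > 1"
    and G: "finite G" "\<And>z. z \<in> G \<Longrightarrow> grid_colour z = c" and r: "r > 0"
  shows "(LINT x|surface_measure S. norm (surface_grad S (grid_function r G) x) powr p)
      \<le> (4 * real CARD('n) / r) powr p * measure (surface_measure S) (S \<inter> (\<Union>z\<in>G. grid_support r z))" (is ?A)
    and "(exp (-2) ^ CARD('n)) powr p * (\<Sum>z\<in>G. measure (surface_measure S) (S \<inter> grid_block r z))
      \<le> (LINT x|surface_measure S. \<bar>grid_function r G x\<bar> powr p)" (is ?B)
proof -
  let ?M = "surface_measure S" and ?u = "grid_function r G"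
  interpret finite_measure ?M by (rule finite_surface_measure[OF S])
  have p0: "p > 0" using p by simp
  have ig: "integrable ?M (\<lambda>x. norm (surface_grad S ?u x) powr p)"
    using in_Lp_continuous[OF S continuous_on_surface_grad[OF S(1) smooth_grid_function] p0]
    by (simp add: in_Lp_def)
  have iu: "integrable ?M (\<lambda>x. norm (?u x) powr p)"
    using in_Lp_continuous[OF S continuous_on_subset[OF smooth_on_continuous[OF smooth_grid_function]] p0]
    by (simp add: in_Lp_def)
  let ?U = "S \<inter> (\<Union>z\<in>G. grid_support r z)" and ?W = "S \<inter> (\<Union>z\<in>G. grid_block r z)"
  have Us: "?U \<in> sets ?M" using G(1) by (intro sets_surface_measure_Int sets.finite_UN grid_support_borel)
  have Bs: "?W \<in> sets ?M" using G(1) by (intro sets_surface_measure_Int sets.finite_UN grid_block_borel)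
  have int: "integrable ?M (\<lambda>x. c * indicator A x)" "(LINT x|?M. c * indicator A x) = c * measure ?M A"
    if "A \<in> sets ?M" for A and c :: real
  proof -
    have "emeasure ?M A < \<infinity>" by (simp add: top.not_eq_extremum emeasure_eq_measure)
    moreover have "A \<inter> S = A" using sets.sets_into_space[OF that] by auto
    ultimately show "integrable ?M (\<lambda>x. c * indicator A x)" "(LINT x|?M. c * indicator A x) = c * measure ?M A"
      using that by (auto simp: measure_def intro!: integrable_mult_right integrable_real_indicator)
  qed
  define q where "q = (4 * real CARD('n) / r) powr p"
  have "(LINT x|?M. norm (surface_grad S ?u x) powr p) \<le> (LINT x|?M. q * indicator ?U x)"
  proof (rule Bochner_Integration.integral_mono[OF ig int(1)[OF Us]])
    fix x assume "x \<in> space ?M"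
    then have x: "x \<in> S" by simp
    have n: "norm (surface_grad S ?u x) \<le> norm (gradient ?u x)"
      by (rule norm_surface_grad_le[OF S(1) x smooth_grid_function])
    show "norm (surface_grad S ?u x) powr p \<le> q * indicator ?U x"
    proof (cases "x \<in> ?U")
      case True
      have "norm (surface_grad S ?u x) powr p \<le> q"
        unfolding q_def using order_trans[OF n norm_gradient_grid_function[OF G r]] p0 by (intro powr_mono2) auto
      then show ?thesis using True by simp
    next
      case False
      then have "x \<notin> (\<Union>z\<in>G. grid_support r z)" using x by blast
      then have "gradient ?u x = 0" by (rule grid_function_outside)
      then have "norm (surface_grad S ?u x) = 0" using n by simp
      then show ?thesis using False by simp
    qed
  qed
  also have "\<dots> = q * measure ?M ?U" by (rule int(2)[OF Us])
  finally show ?A by (simp add: q_def)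
  have "disjoint_family_on (\<lambda>z. S \<inter> grid_block r z) G"
    unfolding disjoint_family_on_def
  proof (intro ballI impI)
    fix z z' assume zz: "z \<in> G" "z' \<in> G" "z \<noteq> z'"
    have "grid_support r z \<inter> grid_support r z' = {}"
      using zz by (intro grid_support_disjoint) (simp_all add: G(2))
    then show "(S \<inter> grid_block r z) \<inter> (S \<inter> grid_block r z') = {}"
      using grid_block_subset_support[of r z] grid_block_subset_support[of r z'] by blast
  qed
  then have "measure ?M (\<Union>z\<in>G. S \<inter> grid_block r z) = (\<Sum>z\<in>G. measure ?M (S \<inter> grid_block r z))"
    using G(1) by (intro finite_measure_finite_Union) (auto intro: sets_surface_measure_Int grid_block_borel)
  moreover have "(\<Union>z\<in>G. S \<inter> grid_block r z) = ?W" by blast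
  ultimately have mB: "(\<Sum>z\<in>G. measure ?M (S \<inter> grid_block r z)) = measure ?M ?W" by simp
  define q' where "q' = (exp (-2::real) ^ CARD('n)) powr p"
  have "q' * measure ?M ?W = (LINT x|?M. q' * indicator ?W x)" by (rule int(2)[OF Bs, symmetric])
  also have "\<dots> \<le> (LINT x|?M. norm (?u x) powr p)"
  proof (rule Bochner_Integration.integral_mono[OF int(1)[OF Bs] iu])
    fix x assume "x \<in> space ?M"
    show "q' * indicator ?W x \<le> norm (?u x) powr p"
    proof (cases "x \<in> ?W")
      case True
      then obtain z where z: "z \<in> G" "x \<in> grid_block r z" by blast
      have "exp (-2) ^ CARD('n) \<le> norm (?u x)"
        using grid_function_lower[OF G(1) z] grid_function_nonneg[of r G x] by simp
      then have "q' \<le> norm (?u x) powr p" unfolding q'_def using p0 by (intro powr_mono2) auto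
      then show ?thesis using True by simp
    qed simp
  qed
  finally show ?B unfolding mB by (simp add: q'_def)
qed

lemma finite_grid_cells:
  fixes \<Omega> :: "(real ^ 'n) set"
  assumes "bounded \<Omega>" "r > 0"
  shows "finite {z. grid_cell r z \<inter> \<Omega> \<noteq> {}}"
proof -
  obtain B where B: "\<And>x. x \<in> \<Omega> \<Longrightarrow> norm x \<le> B" using assms(1) unfolding bounded_iff by auto
  define K where "K = \<lceil>B / r\<rceil> + 1"
  have "{z. grid_cell r z \<inter> \<Omega> \<noteq> {}} \<subseteq> PiE UNIV (\<lambda>_. {-K..K})"
  proof
    fix z :: "'n \<Rightarrow> int" assume "z \<in> {z. grid_cell r z \<inter> \<Omega> \<noteq> {}}"
    then obtain x where x: "x \<in> grid_cell r z" "x \<in> \<Omega>" by blast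
    have "- K \<le> z i \<and> z i \<le> K" for i
    proof -
      have "\<bar>x $ i\<bar> \<le> B" using component_le_norm_cart[of x i] B[OF x(2)] by linarith
      then have "\<bar>x $ i / r\<bar> \<le> B / r" using assms(2) by (simp add: abs_divide divide_right_mono)
      moreover have "of_int (z i) \<le> x $ i / r" "x $ i / r < of_int (z i) + 1" using x(1) by (auto simp: grid_cell_def)
      moreover have "B / r \<le> of_int K - 1" unfolding K_def by simp
      ultimately have "- real_of_int K \<le> of_int (z i)" "of_int (z i) \<le> real_of_int K" by linarith+
      then show ?thesis by linarith
    qed
    then show "z \<in> PiE UNIV (\<lambda>_. {-K..K})" by (simp add: PiE_UNIV_domain)
  qed
  moreover have "finite (PiE (UNIV::'n set) (\<lambda>_. {-K..K}))" by (intro finite_PiE) auto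
  ultimately show ?thesis by (rule finite_subset)
qed

section \<open>The eigenvalue bound at a fixed scale\<close>

text \<open>Some colour class keeps at least \<open>N / 5 ^ CARD('n) = 2 * a * (2 * k)\<close> of
  the displaced volume, exactly what \<open>exists_weight_groups\<close> asks for
  \<open>2 * k\<close> groups of weight \<open>a\<close>; \<open>r ^ CARD('n) \<le> a\<close> bounds
  the weight of one cell. Each group forces positive area, whence the first conclusion.\<close>

lemma eigenvalue_bound_at_scale:
  fixes \<Omega> :: "(real ^ 'n) set"
  assumes \<Omega>: "open \<Omega>" "bounded \<Omega>" and hyp: "smooth_hypersurface (frontier \<Omega>)"
    and k: "k \<ge> 1" and p: "p > 1" and r: "r > 0" and t: "\<bar>t\<bar> \<le> r"
    and N: "0 < N" "N \<le> measure lborel (displaced \<Omega> (t *\<^sub>R axis i 1))"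
    and a: "a = N / (4 * 5 ^ CARD('n) * real k)" "r ^ CARD('n) \<le> a"
    and \<kappa>: "\<kappa> = unit_ball_vol (real (CARD('n) - 1)) / 4 ^ (CARD('n) - 1)"
  shows "0 < area (frontier \<Omega>)"
    and "variational_eigenvalue k p (frontier \<Omega>) \<le>
      ennreal ((4 * real CARD('n) / r) powr p * (area (frontier \<Omega>) / real k) /
        ((exp (-2) ^ CARD('n)) powr p * (\<kappa> * a / r)))"
proof -
  define S where "S = frontier \<Omega>"
  define M where "M = surface_measure S"
  define A where "A = area S"
  define D where "D = displaced \<Omega> (t *\<^sub>R axis i 1)"
  have Sc: "compact S" unfolding S_def using \<Omega>(2) by (simp add: compact_frontier_bounded)
  note S = hyp[folded S_def] Sc
  interpret finite_measure M unfolding M_def by (rule finite_surface_measure[OF S])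
  have A: "A = measure M S" by (simp add: A_def M_def area_def)
  have \<kappa>0: "\<kappa> > 0" unfolding \<kappa> by simp
  have a0: "a > 0" unfolding a(1) using N(1) k by simp
  have D: "D \<in> sets borel" unfolding D_def by (rule displaced_borel[OF \<Omega>(1)])
  define \<nu> where "\<nu> = (\<lambda>z. measure lborel (grid_cell r z \<inter> D))"
  have fm: "grid_cell r z \<inter> D \<in> fmeasurable lborel" for z
    using \<Omega>(2) D by (intro bounded_borel_fmeasurable sets.Int grid_cell_borel)
      (auto simp: D_def displaced_def intro: bounded_subset)
  have \<nu>0: "0 \<le> \<nu> z" and \<nu>a: "\<nu> z \<le> a" for z
    using order_trans[OF measure_grid_cell_le[OF sets.Int[OF grid_cell_borel D, of r z] Int_lower1 r] a(2)]
    by (simp_all add: \<nu>_def)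
  have sm: "S \<inter> B \<in> sets M" if "B \<in> sets borel" for B unfolding M_def by (rule sets_surface_measure_Int[OF that])

  \<comment> \<open>This turns displaced volume, by which the cells are grouped, into area for the
    denominators.\<close>
  have low: "\<kappa> / r * \<nu> z \<le> measure M (S \<inter> grid_block r z)" for z
  proof -
    have "ennreal (\<kappa> / r) * emeasure lborel (grid_cell r z \<inter> D) \<le> hausdorff_outer (CARD('n) - 1) (S \<inter> grid_block r z)"
      using displaced_cell_hausdorff[OF \<Omega>(1) r t, of z i] by (simp add: \<kappa> D_def S_def)
    also have "\<dots> = emeasure M (S \<inter> grid_block r z)"
      unfolding M_def using Sc grid_block_borel[of r z]
      by (subst emeasure_surface_measure) (auto simp: compact_imp_closed borel_closed)
    also have "\<dots> = ennreal (measure M (S \<inter> grid_block r z))" by (rule emeasure_eq_measure)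
    also have "emeasure lborel (grid_cell r z \<inter> D) = ennreal (\<nu> z)"
      unfolding \<nu>_def by (rule emeasure_eq_measure2[OF fm])
    also have "ennreal (\<kappa> / r) * ennreal (\<nu> z) = ennreal (\<kappa> / r * \<nu> z)"
      using \<kappa>0 r \<nu>0 by (intro ennreal_mult[symmetric]) auto
    finally show ?thesis by (simp add: ennreal_le_iff)
  qed

  define Z where "Z = {z. grid_cell r z \<inter> \<Omega> \<noteq> {}}"
  have finZ: "finite Z" unfolding Z_def by (rule finite_grid_cells[OF \<Omega>(2) r])
  have "N \<le> (\<Sum>z\<in>Z. \<nu> z)"
  proof -
    have "D = (\<Union>z\<in>Z. grid_cell r z \<inter> D)"
    proof (rule subset_antisym; rule subsetI)
      fix x assume x: "x \<in> D"
      have c: "x \<in> grid_cell r (\<lambda>i. \<lfloor>x $ i / r\<rfloor>)" by (simp add: grid_cell_def)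
      moreover have "x \<in> \<Omega>" using x by (simp add: D_def displaced_def)
      ultimately have "(\<lambda>i. \<lfloor>x $ i / r\<rfloor>) \<in> Z" unfolding Z_def by blast
      then show "x \<in> (\<Union>z\<in>Z. grid_cell r z \<inter> D)" using c x by blast
    qed blast
    then have "measure lborel D = measure lborel (\<Union>z\<in>Z. grid_cell r z \<inter> D)" by simp
    also have "\<dots> \<le> (\<Sum>z\<in>Z. \<nu> z)"
      unfolding \<nu>_def using finZ D by (intro measure_UNION_le) (auto simp: grid_cell_borel)
    finally show ?thesis using N(2) by (simp add: D_def)
  qed
  define Col where "Col = grid_colour ` Z"
  have finCol: "finite Col" using finZ by (simp add: Col_def)
  have "Col \<subseteq> PiE UNIV (\<lambda>_. {0..4})" unfolding Col_def PiE_UNIV_domain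
  proof (intro image_subsetI Pi_I)
    fix z :: "'n \<Rightarrow> int" and i
    have "0 \<le> z i mod 5" "z i mod 5 < 5" by simp_all
    then show "grid_colour z i \<in> {0..4}" by (simp add: grid_colour_def)
  qed
  then have "card Col \<le> card (PiE (UNIV::'n set) (\<lambda>_. {0..4::int}))"
    by (intro card_mono finite_PiE) auto
  also have "\<dots> = 5 ^ CARD('n)" by (simp add: card_PiE)
  finally have "real (card Col) \<le> real (5 ^ CARD('n))" by (simp only: of_nat_le_iff)
  then have cardCol: "real (card Col) \<le> 5 ^ CARD('n)" by simp
  have group: "(\<Sum>c\<in>Col. \<Sum>z\<in>{z \<in> Z. grid_colour z = c}. \<nu> z) = (\<Sum>z\<in>Z. \<nu> z)"
    by (rule sum.group[OF finZ finCol]) (simp add: Col_def)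
  have "Col \<noteq> {}" using \<open>N \<le> (\<Sum>z\<in>Z. \<nu> z)\<close> N(1) by (auto simp: Col_def)
  have "\<exists>c. N / 5 ^ CARD('n) \<le> (\<Sum>z\<in>{z \<in> Z. grid_colour z = c}. \<nu> z)"
  proof (rule ccontr)
    assume "\<not> ?thesis"
    then have "(\<Sum>c\<in>Col. \<Sum>z\<in>{z \<in> Z. grid_colour z = c}. \<nu> z) < (\<Sum>c\<in>Col. N / 5 ^ CARD('n))"
      using finCol \<open>Col \<noteq> {}\<close> by (intro sum_strict_mono) (auto simp: not_le)
    also have "\<dots> = real (card Col) * (N / 5 ^ CARD('n))" by simp
    also have "\<dots> \<le> 5 ^ CARD('n) * (N / 5 ^ CARD('n))" using N(1) cardCol by (intro mult_right_mono) auto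
    also have "\<dots> = N" by simp
    finally show False using group \<open>N \<le> (\<Sum>z\<in>Z. \<nu> z)\<close> by simp
  qed
  then obtain c where c: "N / 5 ^ CARD('n) \<le> (\<Sum>z\<in>{z \<in> Z. grid_colour z = c}. \<nu> z)" by blast
  have "2 * a * real (2 * k) = N / 5 ^ CARD('n)" using k by (simp add: a(1) field_simps)
  then have "2 * a * real (2 * k) \<le> (\<Sum>z\<in>{z \<in> Z. grid_colour z = c}. \<nu> z)" using c by simp
  from exists_weight_groups[OF _ \<nu>0 \<nu>a a0 this] finZ
  obtain G where "\<forall>j<2 * k. G j \<subseteq> {z \<in> Z. grid_colour z = c} \<and> a \<le> (\<Sum>z\<in>G j. \<nu> z) \<and>
      (\<forall>i<2 * k. i \<noteq> j \<longrightarrow> G i \<inter> G j = {})"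
    by auto
  then have GZ: "G j \<subseteq> {z \<in> Z. grid_colour z = c}" and Ga: "a \<le> (\<Sum>z\<in>G j. \<nu> z)"
    and Gd: "\<And>i. i < 2 * k \<Longrightarrow> i \<noteq> j \<Longrightarrow> G i \<inter> G j = {}" if "j < 2 * k" for j
    using that by blast+
  have Gfin: "finite (G j)" if "j < 2 * k" for j using GZ[OF that] finZ finite_subset by fastforce
  have Gc: "grid_colour z = c" if "j < 2 * k" "z \<in> G j" for j z using GZ[OF that(1)] that(2) by blast
  define U where "U = (\<lambda>j. \<Union>z\<in>G j. grid_support r z)"
  have Ub: "U j \<in> sets borel" if "j < 2 * k" for j
    unfolding U_def using Gfin[OF that] by (intro sets.finite_UN grid_support_borel)
  have Ud: "U i \<inter> U j = {}" if ij: "i < 2 * k" "j < 2 * k" "i \<noteq> j" for i j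
  proof (rule equals0I)
    fix x assume "x \<in> U i \<inter> U j"
    then obtain z z' where z: "z \<in> G i" "x \<in> grid_support r z" "z' \<in> G j" "x \<in> grid_support r z'"
      by (auto simp: U_def)
    have "z \<noteq> z'" using Gd[OF ij(2,1,3)] z(1,3) by blast
    moreover have "grid_colour z = grid_colour z'" using Gc[OF ij(1) z(1)] Gc[OF ij(2) z(3)] by simp
    ultimately have "grid_support r z \<inter> grid_support r z' = {}" by (intro grid_support_disjoint)
    then show False using z(2,4) by blast
  qed
  define \<sigma> where "\<sigma> = (\<lambda>j. measure M (S \<inter> U j))"
  have \<sigma>sum: "(\<Sum>j<2 * k. \<sigma> j) \<le> A"
  proof -
    have "disjoint_family_on (\<lambda>j. S \<inter> U j) {..<2 * k}"
      unfolding disjoint_family_on_def using Ud by blast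
    then have "measure M (\<Union>j<2 * k. S \<inter> U j) = (\<Sum>j<2 * k. \<sigma> j)"
      unfolding \<sigma>_def by (intro finite_measure_finite_Union) (auto intro: sm Ub)
    moreover have "measure M (\<Union>j<2 * k. S \<inter> U j) \<le> measure M (space M)" by (rule bounded_measure)
    ultimately show ?thesis by (simp add: A M_def)
  qed

  have block: "\<kappa> * a / r \<le> (\<Sum>z\<in>G j. measure M (S \<inter> grid_block r z))" if "j < 2 * k" for j
  proof -
    have "\<kappa> * a / r = \<kappa> / r * a" by simp
    also have "\<dots> \<le> \<kappa> / r * (\<Sum>z\<in>G j. \<nu> z)" using Ga[OF that] \<kappa>0 r by (intro mult_left_mono) auto
    also have "\<dots> = (\<Sum>z\<in>G j. \<kappa> / r * \<nu> z)" by (rule sum_distrib_left)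
    also have "\<dots> \<le> (\<Sum>z\<in>G j. measure M (S \<inter> grid_block r z))" by (intro sum_mono low)
    finally show ?thesis .
  qed
  have A0: "A > 0"
  proof (rule ccontr)
    assume "\<not> A > 0"
    have "measure M B \<le> A" for B unfolding A using bounded_measure[of B] by (simp add: M_def)
    then have "measure M B = 0" for B using \<open>\<not> A > 0\<close> measure_nonneg[of M B] by (smt (verit))
    then have "\<kappa> * a / r \<le> 0" using block[of 0] k by simp
    moreover have "0 < \<kappa> * a / r" using \<kappa>0 a0 r by simp
    ultimately show False by simp
  qed
  then show "0 < area (frontier \<Omega>)" by (simp add: A_def S_def)

  define J where "J = {j. j < 2 * k \<and> \<sigma> j \<le> A / real k}"
  have finJ: "finite J" by (simp add: J_def)
  \<comment> \<open>The groups with area above \<open>A / k\<close> number at most \<open>k\<close>,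
    as the areas sum to at most \<open>A\<close>; at least \<open>k\<close> of the
    \<open>2 * k\<close> groups remain.\<close>
  have kJ: "k \<le> card J"
  proof -
    define B where "B = {j. j < 2 * k \<and> A / real k < \<sigma> j}"
    have "card B \<le> k"
    proof -
      have "real (card B) * (A / real k) = (\<Sum>j\<in>B. A / real k)" by simp
      also have "\<dots> \<le> (\<Sum>j\<in>B. \<sigma> j)" by (intro sum_mono) (auto simp: B_def)
      also have "\<dots> \<le> (\<Sum>j<2 * k. \<sigma> j)" by (intro sum_mono2) (auto simp: B_def \<sigma>_def)
      also have "\<dots> \<le> A" by (rule \<sigma>sum)
      finally have "real (card B) \<le> real k" using A0 k by (simp add: field_simps)
      then show ?thesis by simp
    qed
    moreover have "{..<2 * k} = J \<union> B" by (auto simp: J_def B_def not_le)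
    moreover have "card (J \<union> B) = card J + card B"
      by (rule card_Un_disjoint) (auto simp: J_def B_def)
    ultimately have "2 * k = card J + card B" using card_lessThan[of "2 * k"] by simp
    then show ?thesis using \<open>card B \<le> k\<close> by simp
  qed
  obtain e where "bij_betw e {0..<card J} J" using ex_bij_betw_nat_finite[OF finJ] by blast
  then have e: "e j \<in> J" if "j < k" for j using that kJ by (auto simp: bij_betw_def)
  have einj: "e i \<noteq> e j" if "i < k" "j < k" "i \<noteq> j" for i j
    using \<open>bij_betw e {0..<card J} J\<close> that kJ by (auto simp: bij_betw_def inj_on_def)
  have e2: "e j < 2 * k" and e\<sigma>: "\<sigma> (e j) \<le> A / real k" if "j < k" for j using e[OF that] by (auto simp: J_def)
  define q where "q = (exp (-2::real) ^ CARD('n)) powr p"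
  have q: "q > 0" by (simp add: q_def)
  define \<Lambda> where "\<Lambda> = (4 * real CARD('n) / r) powr p * (A / real k) / (q * (\<kappa> * a / r))"
  have \<Lambda>0: "0 \<le> \<Lambda>" using q \<kappa>0 a0 r A0 by (simp add: \<Lambda>_def)
  have qp: "0 < q * (\<kappa> * a / r)" using q \<kappa>0 a0 r by simp
  have val: "q * (\<kappa> * a / r) \<le> (LINT x|M. \<bar>grid_function r (G (e j)) x\<bar> powr p)" if "j < k" for j
  proof -
    have "q * (\<kappa> * a / r) \<le> q * (\<Sum>z\<in>G (e j). measure M (S \<inter> grid_block r z))"
      using q block[OF e2[OF that]] by (intro mult_left_mono) auto
    also have "\<dots> \<le> (LINT x|M. \<bar>grid_function r (G (e j)) x\<bar> powr p)"
      unfolding q_def M_def by (rule grid_energies(2)[OF S p Gfin[OF e2[OF that]] Gc[OF e2[OF that]] r])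
    finally show ?thesis .
  qed
  interpret test_functions S "\<lambda>j. grid_function r (G (e j))" k p \<Lambda>
  proof
    show "smooth_hypersurface S" "compact S" "p > 1" by (rule S p)+
    show "smooth_on UNIV (grid_function r (G (e j)))" for j by (rule smooth_grid_function)
  next
    fix x i j assume ij: "i < k" "j < k" "i \<noteq> j"
    have "x \<notin> U (e i) \<or> x \<notin> U (e j)" using Ud[OF e2[OF ij(1)] e2[OF ij(2)] einj[OF ij]] by blast
    moreover have "grid_function r (G l) x = 0 \<and> gradient (grid_function r (G l)) x = 0" if "x \<notin> U l" for l
      using grid_function_outside[where x=x and G="G l" and r=r] that by (simp add: U_def)
    ultimately show "(grid_function r (G (e i)) x = 0 \<and> gradient (grid_function r (G (e i))) x = 0) \<or>
        (grid_function r (G (e j)) x = 0 \<and> gradient (grid_function r (G (e j))) x = 0)"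
      by blast
  next
    fix j assume j: "j < k"
    show "0 < (LINT x|surface_measure S. \<bar>grid_function r (G (e j)) x\<bar> powr p)"
      using val[OF j] qp by (simp add: M_def)
    have "(LINT x|M. norm (surface_grad S (grid_function r (G (e j))) x) powr p)
        \<le> (4 * real CARD('n) / r) powr p * \<sigma> (e j)"
      unfolding M_def \<sigma>_def U_def
      by (rule grid_energies(1)[OF S p Gfin[OF e2[OF j]] Gc[OF e2[OF j]] r])
    also have "\<dots> \<le> (4 * real CARD('n) / r) powr p * (A / real k)" by (intro mult_left_mono e\<sigma>[OF j]) simp
    also have "\<dots> = \<Lambda> * (q * (\<kappa> * a / r))" 
      by (simp only: \<Lambda>_def times_divide_eq_left nonzero_mult_div_cancel_right[OF qp[THEN less_imp_neq, symmetric]])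
    also have "\<dots> \<le> \<Lambda> * (LINT x|M. \<bar>grid_function r (G (e j)) x\<bar> powr p)"
      by (rule mult_left_mono[OF val[OF j] \<Lambda>0])
    finally show "(LINT x|surface_measure S. norm (surface_grad S (grid_function r (G (e j))) x) powr p)
        \<le> \<Lambda> * (LINT x|surface_measure S. \<bar>grid_function r (G (e j)) x\<bar> powr p)"
      by (simp only: M_def)
  qed
  show "variational_eigenvalue k p (frontier \<Omega>) \<le>
      ennreal ((4 * real CARD('n) / r) powr p * (area (frontier \<Omega>) / real k) /
        ((exp (-2) ^ CARD('n)) powr p * (\<kappa> * a / r)))"
    using variational_eigenvalue_le by (simp only: \<Lambda>_def A_def S_def q_def)
qed

subsection \<open>The choice of the scale\<close>

text \<open>In the application \<open>A / L ^ m\<close> is the isoperimetric ratio and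
  \<open>\<beta> * L ^ m / k\<close> is \<open>a / r\<close>. The identity rests on
  \<open>(A / L ^ m) * (k / A) = k / L ^ m\<close>, raised to the power
  \<open>p / m\<close>.\<close>

lemma scale_arithmetic:
  fixes A L k \<rho> q \<kappa> \<beta> p d :: real and m :: nat
  assumes pos: "A > 0" "L > 0" "k > 0" "\<rho> > 0" "q > 0" "\<kappa> > 0" "\<beta> > 0" "d > 0" and m: "m > 0"
    and r: "r = \<rho> * L / k powr (1 / real m)"
  shows "(d / r) powr p * (A / k) / (q * (\<kappa> * (\<beta> * L ^ m / k))) =
    (d powr p / (\<rho> powr p * (q * \<kappa> * \<beta>))) * (A / L ^ m) powr (1 + p / real m) * (k / A) powr (p / real m)"
proof -
  have "d / r = d * k powr (1 / real m) / (\<rho> * L)" using pos by (simp add: r)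
  also have "\<dots> powr p = d powr p * k powr (p / real m) / (\<rho> powr p * L powr p)"
    using pos by (simp add: powr_divide powr_mult powr_powr)
  finally have 1: "(d / r) powr p = d powr p * k powr (p / real m) / (\<rho> powr p * L powr p)" .
  have "(A / L ^ m) powr (1 + p / real m) * (k / A) powr (p / real m) =
      (A / L ^ m) * ((A / L ^ m) powr (p / real m) * (k / A) powr (p / real m))"
    using pos by (simp add: powr_add)
  also have "(A / L ^ m) powr (p / real m) * (k / A) powr (p / real m) = (k / L ^ m) powr (p / real m)"
    using pos by (subst powr_mult[symmetric]) auto
  also have "\<dots> = k powr (p / real m) / L powr p"
    using pos m by (simp add: powr_divide powr_powr flip: powr_realpow)
  finally have 2: "(A / L ^ m) powr (1 + p / real m) * (k / A) powr (p / real m) =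
      (A / L ^ m) * (k powr (p / real m) / L powr p)" .
  show ?thesis
    unfolding mult.assoc[of "d powr p / (\<rho> powr p * (q * \<kappa> * \<beta>))"] 1 2
    using pos by (simp add: field_simps)
qed

theorem corollaryA3:
  fixes p :: real
  assumes "CARD('n::finite) \<ge> 2" and "p > 1"
  shows "\<exists>C>0. \<forall>(\<Omega> :: (real ^ 'n) set) (k::nat).
           bounded_domain \<Omega> \<longrightarrow> smooth_boundary \<Omega> \<longrightarrow> k \<ge> 1 \<longrightarrow>
           variational_eigenvalue k p (frontier \<Omega>) \<le>
             ennreal (C * isoperimetric_ratio \<Omega> powr (1 + p / (real CARD('n) - 1)) *
               (real k / area (frontier \<Omega>)) powr (p / (real CARD('n) - 1)))"
proof -
  define n where "n = CARD('n)"
  define m where "m = n - 1"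
  have n2: "n \<ge> 2" using assms(1) by (simp add: n_def)
  then have m: "m > 0" "n = Suc m" "real m = real n - 1" by (auto simp: m_def)
  define \<kappa> where "\<kappa> = unit_ball_vol (real m) / 4 ^ m"
  define q where "q = (exp (-2::real) ^ n) powr p"
  \<comment> \<open>Chosen so that a cube of side \<open>2 * R0 * L\<close> has volume
    \<open>4 * V\<close>.\<close>
  define R0 where "R0 = 4 powr (1 / real n) / 2"
  \<comment> \<open>\<open>4 * n * R0\<close> comes from \<open>exists_axis_displacement\<close> and
    \<open>4 * 5 ^ n\<close> from the definition of \<open>a\<close>; together they give
    \<open>a / r = \<beta> * L ^ m / k\<close>.\<close>
  define \<beta> where "\<beta> = 1 / (16 * real n * R0 * 5 ^ n)"
  \<comment> \<open>\<open>R0\<close> keeps \<open>r\<close> in the range of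
    \<open>exists_axis_displacement\<close>; 1 and \<open>\<beta>\<close> together give
    \<open>\<rho> ^ m \<le> \<beta>\<close>, which becomes \<open>r ^ n \<le> a\<close>.\<close>
  define \<rho> where "\<rho> = min R0 (min 1 \<beta>)"
  have pos: "\<kappa> > 0" "q > 0" "R0 > 0" by (simp_all add: \<kappa>_def q_def R0_def)
  then have \<beta>: "\<beta> > 0" using n2 by (simp add: \<beta>_def)
  then have \<rho>: "\<rho> > 0" "\<rho> \<le> R0" "\<rho> \<le> 1" "\<rho> \<le> \<beta>" using pos by (auto simp: \<rho>_def)
  have "\<rho> ^ m \<le> \<rho> ^ 1" using \<rho> m by (intro power_decreasing) auto
  then have \<rho>m: "\<rho> ^ m \<le> \<beta>" using \<rho>(4) by simp
  define C where "C = (4 * real n) powr p / (\<rho> powr p * (q * \<kappa> * \<beta>))"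
  have C: "C > 0" using n2 \<rho>(1) pos \<beta> by (simp add: C_def)
  have main: "variational_eigenvalue k p (frontier \<Omega>) \<le>
      ennreal (C * isoperimetric_ratio \<Omega> powr (1 + p / (real n - 1)) *
               (real k / area (frontier \<Omega>)) powr (p / (real n - 1)))"
    if dom: "bounded_domain \<Omega>" and sb: "smooth_boundary \<Omega>" and k: "k \<ge> 1" for \<Omega> :: "(real ^ 'n) set" and k :: nat
  proof -
    have \<Omega>: "open \<Omega>" "bounded \<Omega>" "\<Omega> \<noteq> {}" using dom by (auto simp: bounded_domain_def)
    define V where "V = measure lborel \<Omega>"
    have V: "V > 0"
    proof -
      obtain x \<epsilon> where x: "\<epsilon> > 0" "ball x \<epsilon> \<subseteq> \<Omega>" using \<Omega>(1,3) open_contains_ball by blast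
      have "0 < measure lborel (ball x \<epsilon>)" using x(1) by (rule content_ball_pos)
      also have "\<dots> \<le> V" unfolding V_def using x(2) \<Omega>
        by (intro measure_mono_fmeasurable bounded_borel_fmeasurable) auto
      finally show ?thesis .
    qed
    define L where "L = V powr (1 / real n)"
    have L: "L > 0" using V by (simp add: L_def)
    have Ln: "L ^ n = V" using V n2 by (simp add: L_def powr_powr flip: powr_realpow)
    have VL: "V = L * L ^ m" using Ln m(2) by simp
    have R0n: "(2 * R0) ^ n = 4" using n2 by (simp add: R0_def powr_powr flip: powr_realpow)
    have Rn: "(2 * (R0 * L)) ^ CARD('n) = 4 * V"
      using R0n Ln by (simp add: power_mult_distrib n_def flip: mult.assoc)
    define r where "r = \<rho> * L / real k powr (1 / real m)"
    have k1: "1 \<le> real k powr (1 / real m)" using k by (intro ge_one_powr_ge_zero) auto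
    have r: "r > 0" using \<rho>(1) L k by (simp add: r_def)
    have "r \<le> \<rho> * L / 1" unfolding r_def using k1 \<rho>(1) L k by (intro divide_left_mono) auto
    then have "r \<le> \<rho> * L" by simp
    also have "\<dots> \<le> R0 * L" using \<rho>(2) L by (intro mult_right_mono) auto
    finally have rR: "r \<le> R0 * L" .
    have RL: "R0 * L > 0" using pos L by simp
    obtain i t where t: "\<bar>t\<bar> \<le> r"
      "V * r / (4 * real CARD('n) * (R0 * L)) \<le> measure lborel (displaced \<Omega> (t *\<^sub>R axis i 1))"
      using exists_axis_displacement[OF \<Omega>(1,2) V_def V RL Rn r rR] by blast
    define N where "N = V * r / (4 * real n * (R0 * L))"
    have N: "0 < N" "N \<le> measure lborel (displaced \<Omega> (t *\<^sub>R axis i 1))"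
      using V r RL n2 t(2) by (simp_all add: N_def n_def)
    define a where "a = N / (4 * 5 ^ CARD('n) * real k)"
    have ar: "a / r = \<beta> * L ^ m / real k"
      using r L pos k n2 by (simp add: a_def N_def \<beta>_def VL n_def field_simps)
    have rm: "r ^ m = \<rho> ^ m * L ^ m / real k"
      using k m by (simp add: r_def power_divide power_mult_distrib powr_powr flip: powr_realpow)
    have "r ^ m \<le> a / r"
      unfolding ar rm using \<rho>m L k by (intro divide_right_mono mult_right_mono) auto
    then have ra: "r ^ CARD('n) \<le> a" using r m(2) by (simp add: pos_le_divide_eq n_def mult.commute)
    have \<kappa>': "\<kappa> = unit_ball_vol (real (CARD('n) - 1)) / 4 ^ (CARD('n) - 1)" by (simp add: \<kappa>_def m_def n_def)
    note bound = eigenvalue_bound_at_scale[OF \<Omega>(1,2) smooth_boundary_imp_hypersurface[OF sb] k assms(2) r t(1) N a_def ra \<kappa>']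
    define A where "A = area (frontier \<Omega>)"
    have A: "A > 0" using bound(1) by (simp add: A_def)
    \<comment> \<open>\<open>\<Omega>\<close> is Borel, so completing the measure does not change
      its volume, and \<open>L ^ m\<close> is the denominator of the isoperimetric ratio.\<close>
    have "measure lebesgue \<Omega> powr ((real n - 1) / real n) = L ^ m"
      using V \<Omega>(1) m by (simp add: L_def V_def powr_powr measure_completion flip: powr_realpow)
    then have I: "isoperimetric_ratio \<Omega> = A / L ^ m" by (simp add: isoperimetric_ratio_def A_def n_def)
    have "(4 * real n / r) powr p * (A / real k) / (q * (\<kappa> * a / r)) =
        (4 * real n / r) powr p * (A / real k) / (q * (\<kappa> * (\<beta> * L ^ m / real k)))"
      by (simp add: ar[symmetric])
    also have "\<dots> = C * (A / L ^ m) powr (1 + p / real m) * (real k / A) powr (p / real m)"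
      unfolding C_def using A L k \<rho>(1) pos \<beta> n2 m(1) r_def by (intro scale_arithmetic) auto
    finally show ?thesis
      using bound(2)[folded n_def A_def, folded q_def] by (simp only: I A_def[symmetric] m(3)[symmetric])
  qed
  show ?thesis using C main unfolding n_def by blast
qed

end
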